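(* Let $\chi\in C([0,T];\mathbb R^{d\times d})$ satisfy $T\|\chi\|_\infty<1$, where $\|\chi\|_\infty=\sup_{t\in[0,T]}|\chi(t)|$. Define $\sigma\in C([0,T];\mathbb R^{d\times d})$ by \[ \sigma(t)=\chi(t)-\int_t^T\chi(u)^\dagger\chi(u)\,du,\qquad t\in[0,T]. \] Then $(\iota+F_\chi)^{-1}$ exists and is a continuous linear operator from $\mathcal W$ to itself, and \[ \int_{\mathcal W}e^{\mathfrak p_\sigma}f\,d\mu=e^{\frac12\int_0^T\mathrm{tr}(\chi(t)-\sigma(t))\,dt}\int_{\mathcal W}f\circ(\iota+F_\chi)^{-1}\,d\mu\qquad\text{for all }f\in C_b(\mathcal W). \]
   Context: Standing setting: $T>0$, $d\in\mathbb N$. $\mathcal W$ is the Banach space (sup norm) of continuous $w:[0,T]\to\mathbb R^d$ with $w(0)=0$, $\mu$ the Wiener measure, $\theta(t)(w)=w(t)$ the coordinate process, $d\theta$ Itô integration. Vectors are columns, $|M|$ is the Frobenius norm and $M^\dagger$ the transpose of $M\in\mathbb R^{d\times d}$. For $\chi,\sigma\in C([0,T];\mathbb R^{d\times d})$: $F_\chi:\mathcal W\to\mathcal W$ is the linear map $[F_\chi(w)](t)=-\int_0^t\chi(s)w(s)\,ds$, and $\mathfrak p_\sigma=\int_0^T\langle\sigma(t)\theta(t),d\theta(t)\rangle$ (Itô integral). $\iota$ is the identity of $\mathcal W$, $C_b(\mathcal W)$ the bounded continuous real functions on $\mathcal W$. *)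

theory Defs
  imports "HOL-Probability.Probability"
begin

text \<open>Paths w : [0,T] -> R^d are represented as total functions real => real^'d which are
  constant outside [0,T] (w t = w (clamp t)); this is a bijective encoding of C([0,T];R^d).\<close>

definition clampT :: "real \<Rightarrow> real \<Rightarrow> real" where
  "clampT T t = max 0 (min T t)"

definition Wsp :: "real \<Rightarrow> (real \<Rightarrow> real^'d) set" where
  "Wsp T = {w. continuous_on UNIV w \<and> w 0 = 0 \<and> (\<forall>t. w t = w (clampT T t))}"

definition supn :: "real \<Rightarrow> (real \<Rightarrow> real^'d) \<Rightarrow> real" where
  "supn T w = Sup ((\<lambda>t. norm (w t)) ` {0..T})"

text \<open>sup norm of a matrix-valued function (Frobenius norm, which is norm on real^'d^'d)\<close>
definition supnM :: "real \<Rightarrow> (real \<Rightarrow> real^'d^'d) \<Rightarrow> real" where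
  "supnM T chi = Sup ((\<lambda>t. norm (chi t)) ` {0..T})"

definition Cb :: "real \<Rightarrow> ((real \<Rightarrow> real^'d) \<Rightarrow> real) set" where
  "Cb T = {f. (\<exists>B. \<forall>w\<in>Wsp T. \<bar>f w\<bar> \<le> B) \<and>
     (\<forall>w\<in>Wsp T. \<forall>e>0. \<exists>\<delta>>0. \<forall>v\<in>Wsp T. supn T (v - w) < \<delta> \<longrightarrow> \<bar>f v - f w\<bar> < e)}"

text \<open>Wiener measure on W: probability measure with space W, the sigma-algebra generated by
  the coordinate maps (= Borel sets of the sup norm), under which the coordinate process is a
  d-dimensional standard Brownian motion on [0,T] (joint characteristic function of the
  increments over every partition).\<close>
definition wiener :: "real \<Rightarrow> (real \<Rightarrow> real^'d) measure \<Rightarrow> bool" where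
  "wiener T \<mu> \<longleftrightarrow> prob_space \<mu> \<and> space \<mu> = Wsp T \<and>
     sets \<mu> = sets (restrict_space (Pi\<^sub>M UNIV (\<lambda>_. borel)) (Wsp T)) \<and>
     (\<forall>(n::nat) (t::nat \<Rightarrow> real) (\<xi>::nat \<Rightarrow> real^'d).
        t 0 = 0 \<and> (\<forall>k<n. t k \<le> t (Suc k)) \<and> t n \<le> T \<longrightarrow>
        integral\<^sup>L \<mu> (\<lambda>w. cis (\<Sum>k<n. \<xi> k \<bullet> (w (t (Suc k)) - w (t k))))
          = complex_of_real (exp (- (\<Sum>k<n. (t (Suc k) - t k) * (norm (\<xi> k))\<^sup>2) / 2)))"

definition Fchi :: "real \<Rightarrow> (real \<Rightarrow> real^'d^'d) \<Rightarrow> (real \<Rightarrow> real^'d) \<Rightarrow> (real \<Rightarrow> real^'d)" where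
  "Fchi T chi w = (\<lambda>t. - integral {0..clampT T t} (\<lambda>s. chi s *v w s))"

text \<open>left-point Riemann sum of int_0^T <sigma(t) theta(t), d theta(t)> on the uniform
  partition with n steps\<close>
definition riemann_p :: "real \<Rightarrow> (real \<Rightarrow> real^'d^'d) \<Rightarrow> nat \<Rightarrow> (real \<Rightarrow> real^'d) \<Rightarrow> real" where
  "riemann_p T \<sigma> n w = (\<Sum>k<n. (\<sigma> (real k * T / real n) *v w (real k * T / real n))
        \<bullet> (w (real (Suc k) * T / real n) - w (real k * T / real n)))"

text \<open>X is (a version of) the Ito integral p_sigma: the limit in probability of the left-point
  Riemann sums.\<close>
definition is_ito_p :: "real \<Rightarrow> (real \<Rightarrow> real^'d) measure \<Rightarrow> (real \<Rightarrow> real^'d^'d)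
    \<Rightarrow> ((real \<Rightarrow> real^'d) \<Rightarrow> real) \<Rightarrow> bool" where
  "is_ito_p T \<mu> \<sigma> X \<longleftrightarrow> X \<in> borel_measurable \<mu> \<and>
     (\<forall>\<epsilon>>0. (\<lambda>n. measure \<mu> {w\<in>space \<mu>. \<bar>riemann_p T \<sigma> n w - X w\<bar> > \<epsilon>}) \<longlonglongrightarrow> 0)"

end

(* The path y = (iota + F_chi)^{-1} w solves dy = chi y dt + dw. On the grid t_k = kT/n its Euler scheme
   is a unitriangular map of the Gaussian increments, so a shift of one Gaussian at a time gives
     E[D_n f(w^n)] = E[f(y^n)],
     D_n = exp (sum <chi_k w_k, dw_k> - h/2 sum |chi_k w_k|^2),
   where w^n interpolates w and y^n is the interpolated Euler scheme, which converges uniformly to y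
   for every single path. With A(t) = int_t^T chi^* chi, summation by parts of <A w, w> replaces
   h/2 sum |chi_k w_k|^2 by sum <A_k w_k, dw_k> up to a pathwise null sequence and the quadratic
   variation sum <A_k dw_k, dw_k>, which tends to int tr A in L2. Hence
   D_n -> exp (p_sigma - 1/2 int tr A) in probability. The family D_n is uniformly integrable because
   E[D_n; D_n > K] = P(D_n(y^n) > K), and log D_n(y^n) has bounded moments. *)

theory Submission
  imports Defs
begin

subsection \<open>Joint characteristic functions\<close>

text \<open>The formula for \<open>\<sigma>\<close> is dictated by Ito's rule for <A w, w>. Since A'
  = - chi^* chi and A(T) = 0, it gives - int <A w, dw> = 1/2 int tr A - 1/2 int |chi w|^2, so
  p_sigma - 1/2 int tr A is exactly the Girsanov exponent for the drift chi y. The work takes place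
  on grids because \<open>wiener\<close> prescribes the joint law of finitely many increments and
  \<open>is_ito_p\<close> describes the Ito integral through left-point sums. The main obstacle is
  the loss of mass in the limit: the exponent is quadratic in a Gaussian path, so exponential
  moments are not at hand, and Fatou alone leaves the limit density with mass at most 1. Convergence
  in probability suffices, because an identity valid for every grid may be followed along a
  subsequence. The condition that T times the sup norm of chi is below 1 acts path by path: it makes
  the Picard map a contraction, bounds the inverse, and lets the Euler error be absorbed into
  itself.\<close>

text \<open>Bounded weights are admitted so that the joint law can be identified one coordinate at a time.\<close>

lemma weighted_char_eq_imp_eq:
  fixes X :: "'a \<Rightarrow> real" and X' :: "'b \<Rightarrow> real" and u :: "'a \<Rightarrow> real" and u' :: "'b \<Rightarrow> real"
  assumes "prob_space M" "prob_space M'"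
    and [measurable]: "X \<in> borel_measurable M" "X' \<in> borel_measurable M'"
      "u \<in> borel_measurable M" "u' \<in> borel_measurable M'"
    and u: "\<And>x. 0 \<le> u x" "\<And>x. u x \<le> B" and u': "\<And>x. 0 \<le> u' x" "\<And>x. u' x \<le> B"
    and eq: "\<And>s. (\<integral>x. u x *\<^sub>R cis (s * X x) \<partial>M) = (\<integral>x. u' x *\<^sub>R cis (s * X' x) \<partial>M')"
    and [measurable]: "A \<in> sets borel"
  shows "(\<integral>x. u x * indicator A (X x) \<partial>M) = (\<integral>x. u' x * indicator A (X' x) \<partial>M')"
proof -
  interpret M: prob_space M by fact
  interpret M': prob_space M' by fact
  have iu: "integrable M u" by (rule M.integrable_const_bound[of _ B]) (use u in auto)
  have iu': "integrable M' u'" by (rule M'.integrable_const_bound[of _ B]) (use u' in auto)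
  define m where "m = (\<integral>x. u x \<partial>M)"
  \<comment> \<open>At \<open>s = 0\<close> the hypothesis says that both weights have the same
    mass, so a single \<open>m\<close> normalises both to probability densities and Levy's
    uniqueness theorem applies.\<close>
  have "complex_of_real (\<integral>x. u x \<partial>M) = complex_of_real (\<integral>x. u' x \<partial>M')"
    using eq[of 0] by (simp add: scaleR_conv_of_real)
  then have m': "m = (\<integral>x. u' x \<partial>M')" unfolding m_def of_real_eq_iff .
  have m0: "0 \<le> m" unfolding m_def by (simp add: u)
  show ?thesis
  proof (cases "m = 0")
    case True
    have "AE x in M. u x = 0" using True iu u unfolding m_def
      by (subst (asm) integral_nonneg_eq_0_iff_AE) auto
    moreover have "AE x in M'. u' x = 0" using True iu' u' unfolding m'
      by (subst (asm) integral_nonneg_eq_0_iff_AE) auto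
    ultimately have "(\<integral>x. u x * indicator A (X x) \<partial>M) = 0"
      "(\<integral>x. u' x * indicator A (X' x) \<partial>M') = 0"
      by (auto intro!: integral_eq_zero_AE)
    then show ?thesis by simp
  next
    case False
    then have mp: "m > 0" using m0 by simp
    define N where "N = distr (density M (\<lambda>x. u x / m)) borel X"
    define N' where "N' = distr (density M' (\<lambda>x. u' x / m)) borel X'"
    have pN: "prob_space N" unfolding N_def
    proof (rule prob_space.prob_space_distr)
      show "prob_space (density M (\<lambda>x. ennreal (u x / m)))"
      proof
        have "emeasure (density M (\<lambda>x. ennreal (u x / m))) (space M) = (\<integral>\<^sup>+x. ennreal (u x / m) \<partial>M)"
          by (subst emeasure_density) (auto intro!: nn_integral_cong)
        also have "\<dots> = ennreal (\<integral>x. u x / m \<partial>M)"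
          using iu u mp by (intro nn_integral_eq_integral) auto
        also have "\<dots> = 1" using mp by (simp add: m_def)
        finally show "emeasure (density M (\<lambda>x. ennreal (u x / m))) (space (density M (\<lambda>x. ennreal (u x / m)))) = 1" by simp
      qed
    qed simp
    have pN': "prob_space N'" unfolding N'_def
    proof (rule prob_space.prob_space_distr)
      show "prob_space (density M' (\<lambda>x. ennreal (u' x / m)))"
      proof
        have "emeasure (density M' (\<lambda>x. ennreal (u' x / m))) (space M') = (\<integral>\<^sup>+x. ennreal (u' x / m) \<partial>M')"
          by (subst emeasure_density) (auto intro!: nn_integral_cong)
        also have "\<dots> = ennreal (\<integral>x. u' x / m \<partial>M')"
          using iu' u' mp by (intro nn_integral_eq_integral) auto
        also have "\<dots> = 1" using mp by (simp add: m')
        finally show "emeasure (density M' (\<lambda>x. ennreal (u' x / m))) (space (density M' (\<lambda>x. ennreal (u' x / m)))) = 1" by simp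
      qed
    qed simp
    have rd: "real_distribution N" "real_distribution N'"
      using pN pN' by (auto simp: real_distribution_def real_distribution_axioms_def N_def N'_def)
    have "char N = char N'"
    proof
      fix s
      have "char N s = (\<integral>x. (u x / m) *\<^sub>R cis (s * X x) \<partial>M)"
        unfolding char_def N_def using u mp
        by (subst integral_distr) (auto simp: integral_density cis_conv_exp intro!: Bochner_Integration.integral_cong)
      also have "\<dots> = (\<integral>x. (1 / m) *\<^sub>R (u x *\<^sub>R cis (s * X x)) \<partial>M)"
        by (simp add: field_simps)
      also have "\<dots> = (\<integral>x. (1 / m) *\<^sub>R (u' x *\<^sub>R cis (s * X' x)) \<partial>M')"
        using eq[of s] by (subst (1 2) integral_scaleR_right) simp
      also have "\<dots> = (\<integral>x. (u' x / m) *\<^sub>R cis (s * X' x) \<partial>M')"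
        by (simp add: field_simps)
      also have "\<dots> = char N' s"
        unfolding char_def N'_def using u' mp
        by (subst integral_distr) (auto simp: integral_density cis_conv_exp intro!: Bochner_Integration.integral_cong)
      finally show "char N s = char N' s" .
    qed
    then have NN: "N = N'" using rd Levy_uniqueness by blast
    have "(\<integral>x. indicator A x \<partial>N) = (\<integral>x. (u x / m) * indicator A (X x) \<partial>M)"
      unfolding N_def using u mp
      by (subst integral_distr) (auto simp: integral_density)
    moreover have "(\<integral>x. indicator A x \<partial>N') = (\<integral>x. (u' x / m) * indicator A (X' x) \<partial>M')"
      unfolding N'_def using u' mp
      by (subst integral_distr) (auto simp: integral_density)
    ultimately have "(\<integral>x. (u x * indicator A (X x)) / m \<partial>M) = (\<integral>x. (u' x * indicator A (X' x)) / m \<partial>M')"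
      using NN by simp
    then show ?thesis using mp by simp
  qed
qed

text \<open>The coordinates pass one at a time from the Fourier side to the side of indicators: the
  auxiliary fact mixes indicators of the coordinates in \<open>J\<close> with a character of the
  others. For \<open>J = {}\<close> it is the hypothesis; for \<open>J = I\<close> it gives the
  measures of boxes, which generate the product and are stable under intersection.\<close>

lemma joint_char_eq_imp_eq:
  fixes M M' :: "('i \<Rightarrow> real) measure"
  assumes "prob_space M" "prob_space M'" and fin: "finite I"
    and sM: "sets M = sets (Pi\<^sub>M I (\<lambda>_. borel))" and sM': "sets M' = sets (Pi\<^sub>M I (\<lambda>_. borel))"
    and eq: "\<And>\<xi>. (\<integral>x. cis (\<Sum>i\<in>I. \<xi> i * x i) \<partial>M) = (\<integral>x. cis (\<Sum>i\<in>I. \<xi> i * x i) \<partial>M')"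
  shows "M = M'"
proof -
  interpret M: prob_space M by fact
  interpret M': prob_space M' by fact
  note [measurable_cong] = sM sM'
  have J: "(\<integral>x. (\<Prod>i\<in>J. indicator (A i) (x i)) *\<^sub>R cis (\<Sum>i\<in>I-J. \<xi> i * x i) \<partial>M)
         = (\<integral>x. (\<Prod>i\<in>J. indicator (A i) (x i)) *\<^sub>R cis (\<Sum>i\<in>I-J. \<xi> i * x i) \<partial>M')"
    if "finite J" "J \<subseteq> I" "\<And>i. i \<in> J \<Longrightarrow> A i \<in> sets borel" for J A \<xi>
    using that
  proof (induction J arbitrary: \<xi> rule: finite_induct)
    case empty
    then show ?case using eq by simp
  next
    case (insert j J)
    define g :: "('i \<Rightarrow> real) \<Rightarrow> real" where "g x = (\<Prod>i\<in>J. indicator (A i) (x i))" for x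
    define Y where "Y x = (\<Sum>i\<in>I - insert j J. \<xi> i * x i)" for x
    have jI: "j \<in> I" and [simp]: "j \<notin> J" and JI: "J \<subseteq> I" using insert by auto
    have [measurable]: "(\<lambda>x. x j) \<in> borel_measurable M" "(\<lambda>x. x j) \<in> borel_measurable M'"
      using measurable_component_singleton[OF jI, of "\<lambda>_. borel :: real measure"] by (simp_all add: measurable_cong_sets[OF sM refl] measurable_cong_sets[OF sM' refl])
    have [measurable]: "A j \<in> sets borel" "\<And>i. i \<in> J \<Longrightarrow> A i \<in> sets borel" using insert by auto
    have xi: "(\<lambda>x. x i) \<in> borel_measurable M" "(\<lambda>x. x i) \<in> borel_measurable M'" if "i \<in> I" for i
      using measurable_component_singleton[OF that, of "\<lambda>_. borel :: real measure"] by (simp_all add: measurable_cong_sets[OF sM refl] measurable_cong_sets[OF sM' refl])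
    have gm[measurable]: "g \<in> borel_measurable M" "g \<in> borel_measurable M'"
      unfolding g_def using JI insert.prems(2)
      by (auto intro!: borel_measurable_prod measurable_compose[OF xi(1) borel_measurable_indicator]
            measurable_compose[OF xi(2) borel_measurable_indicator])
    have Ym[measurable]: "Y \<in> borel_measurable M" "Y \<in> borel_measurable M'"
      unfolding Y_def using xi by (auto intro!: borel_measurable_sum borel_measurable_times)
    have g01: "0 \<le> g x" "g x \<le> 1" for x
      unfolding g_def by (auto intro!: prod_nonneg prod_le_1)
    \<comment> \<open>The free scale \<open>a\<close> on the frequencies of the remaining
      coordinates later yields both \<open>cis (Y x)\<close> and its conjugate.\<close>
    have IH: "(\<integral>x. g x *\<^sub>R cis (s * x j + a * Y x) \<partial>M) = (\<integral>x. g x *\<^sub>R cis (s * x j + a * Y x) \<partial>M')" for s a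
    proof -
      have "(\<Sum>i\<in>I-J. (if i = j then s else a * \<xi> i) * x i) = s * x j + a * Y x" for x
      proof -
        have IJ: "I - J = insert j (I - insert j J)" using jI by auto
        have "(\<Sum>i\<in>I-J. (if i = j then s else a * \<xi> i) * x i)
          = s * x j + (\<Sum>i\<in>I - insert j J. (if i = j then s else a * \<xi> i) * x i)"
          unfolding IJ using fin by (subst sum.insert) auto
        also have "(\<Sum>i\<in>I - insert j J. (if i = j then s else a * \<xi> i) * x i) = a * Y x"
          unfolding Y_def sum_distrib_left by (rule sum.cong) auto
        finally show ?thesis .
      qed
      then show ?thesis
        using insert.IH[of "\<lambda>i. if i = j then s else a * \<xi> i"] insert.prems by (simp add: g_def)
    qed
    have int: "integrable M (\<lambda>x. g x *\<^sub>R cis (s * x j + a * Y x))" 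
      "integrable M' (\<lambda>x. g x *\<^sub>R cis (s * x j + a * Y x))" for s a
      using g01 by (auto intro!: M.integrable_const_bound[of _ 1] M'.integrable_const_bound[of _ 1]
          borel_measurable_scaleR simp: cis_conv_exp)
    \<comment> \<open>Adding 1 makes the weights \<^term>\<open>g x * cos (Y x)\<close> and \<^term>\<open>g x * sin (Y x)\<close> nonnegative.\<close>
    have W: "(\<integral>x. (g x * (1 + b * cos (Y x) + c * sin (Y x))) * indicator (A j) (x j) \<partial>M)
         = (\<integral>x. (g x * (1 + b * cos (Y x) + c * sin (Y x))) * indicator (A j) (x j) \<partial>M')"
      if bc: "\<bar>b\<bar> + \<bar>c\<bar> \<le> 1" for b c
    proof (rule weighted_char_eq_imp_eq[where B=2])
      have bd: "\<bar>b * cos y + c * sin y\<bar> \<le> 1" for y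
      proof -
        have "\<bar>b * cos y + c * sin y\<bar> \<le> \<bar>b\<bar> * \<bar>cos y\<bar> + \<bar>c\<bar> * \<bar>sin y\<bar>"
          by (metis abs_mult abs_triangle_ineq)
        also have "\<dots> \<le> \<bar>b\<bar> * 1 + \<bar>c\<bar> * 1" by (intro add_mono mult_left_mono) auto
        finally show ?thesis using bc by simp
      qed
      show nn: "0 \<le> g x * (1 + b * cos (Y x) + c * sin (Y x))" for x
        using bd[of "Y x"] g01[of x] by (intro mult_nonneg_nonneg) (auto simp: abs_le_iff)
      show "g x * (1 + b * cos (Y x) + c * sin (Y x)) \<le> 2" for x
      proof -
        have "g x * (1 + b * cos (Y x) + c * sin (Y x)) \<le> 1 * 2"
          using bd[of "Y x"] g01[of x] by (intro mult_mono) (auto simp: abs_le_iff)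
        then show ?thesis by simp
      qed
      then show "g x * (1 + b * cos (Y x) + c * sin (Y x)) \<le> 2" for x .
      show "0 \<le> g x * (1 + b * cos (Y x) + c * sin (Y x))" for x by (rule nn)
      fix s
      have lin: "(\<integral>x. p x + C * q x + D * r x \<partial>N) = (\<integral>x. p x \<partial>N) + C * (\<integral>x. q x \<partial>N) + D * (\<integral>x. r x \<partial>N)"
        if "integrable N p" "integrable N q" "integrable N r" for N :: "('i \<Rightarrow> real) measure" and p q r :: "_ \<Rightarrow> complex" and C D
        using that by simp
      \<comment> \<open>Euler's formulas for \<open>cos\<close> and \<open>sin\<close>: the weight
        combines the cases \<open>a = 0\<close>, \<open>a = 1\<close> and \<open>a = -1\<close> of
        \<open>IH\<close>, the last two with coefficients (b - ic)/2 and (b + ic)/2.\<close>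
      have *: "(g x * (1 + b * cos (Y x) + c * sin (Y x))) *\<^sub>R cis (s * x j)
        = g x *\<^sub>R cis (s * x j + 0 * Y x) + Complex (b/2) (-c/2) * (g x *\<^sub>R cis (s * x j + 1 * Y x))
          + Complex (b/2) (c/2) * (g x *\<^sub>R cis (s * x j + (-1) * Y x))" for x
        by (simp add: complex_eq_iff cos_add sin_add cos_diff sin_diff algebra_simps)
      show "(\<integral>x. (g x * (1 + b * cos (Y x) + c * sin (Y x))) *\<^sub>R cis (s * x j) \<partial>M)
         = (\<integral>x. (g x * (1 + b * cos (Y x) + c * sin (Y x))) *\<^sub>R cis (s * x j) \<partial>M')"
        unfolding * lin[OF int(1) int(1) int(1)] lin[OF int(2) int(2) int(2)] IH ..
    qed (auto intro: assms)
    have i2: "integrable M (\<lambda>x. g x * p (Y x) * indicator (A j) (x j))"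
       "integrable M' (\<lambda>x. g x * p (Y x) * indicator (A j) (x j))"
      if "p = cos \<or> p = sin \<or> p = (\<lambda>_. 1)" for p :: "real \<Rightarrow> real"
    proof -
      have pm[measurable]: "p \<in> borel_measurable borel" using that by auto
      have "\<bar>p y\<bar> \<le> 1" for y using that by auto
      then have "norm (g x * p (Y x) * indicator (A j) (x j)) \<le> 1" for x
        using g01[of x] by (auto simp: abs_mult indicator_def intro!: mult_le_one)
      then show "integrable M (\<lambda>x. g x * p (Y x) * indicator (A j) (x j))"
       "integrable M' (\<lambda>x. g x * p (Y x) * indicator (A j) (x j))"
        by (auto intro!: M.integrable_const_bound[of _ 1] M'.integrable_const_bound[of _ 1])
    qed
    \<comment> \<open>The constant part of the weight is subtracted again to isolate the cosine and
      sine parts.\<close>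
    have e0: "(\<integral>x. g x * indicator (A j) (x j) \<partial>M) = (\<integral>x. g x * indicator (A j) (x j) \<partial>M')"
      using W[of 0 0] by simp
    have ec: "(\<integral>x. g x * cos (Y x) * indicator (A j) (x j) \<partial>M) = (\<integral>x. g x * cos (Y x) * indicator (A j) (x j) \<partial>M')"
      using W[of 1 0] e0 i2[of cos] i2[of "\<lambda>_. 1"] by (simp add: distrib_left distrib_right)
    have es: "(\<integral>x. g x * sin (Y x) * indicator (A j) (x j) \<partial>M) = (\<integral>x. g x * sin (Y x) * indicator (A j) (x j) \<partial>M')"
      using W[of 0 1] e0 i2[of sin] i2[of "\<lambda>_. 1"] by (simp add: distrib_left distrib_right)
    have **: "(\<Prod>i\<in>insert j J. indicator (A i) (x i)) *\<^sub>R cis (\<Sum>i\<in>I-insert j J. \<xi> i * x i)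
      = complex_of_real (g x * cos (Y x) * indicator (A j) (x j))
        + \<i> * complex_of_real (g x * sin (Y x) * indicator (A j) (x j))" for x
    proof -
      have "(\<Prod>i\<in>insert j J. indicator (A i) (x i)) = indicator (A j) (x j) * g x"
        unfolding g_def using insert.hyps by simp
      then show ?thesis by (simp add: complex_eq_iff Y_def[symmetric] mult_ac)
    qed
    show ?case
      unfolding ** using i2[of sin] i2[of cos] ec es
      by (subst (1 2) Bochner_Integration.integral_add) (auto intro!: integrable_of_real integrable_mult_right simp del: of_real_mult)
  qed
  show ?thesis
  proof (rule measure_eqI_PiM_finite[OF fin, where M="\<lambda>_. borel" and A="\<lambda>_. space (Pi\<^sub>M I (\<lambda>_. borel))"])
    fix A :: "'i \<Rightarrow> real set" assume A: "\<And>i. i \<in> I \<Longrightarrow> A i \<in> sets borel"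
    have PA: "Pi\<^sub>E I A \<in> sets (Pi\<^sub>M I (\<lambda>_. borel))" using A fin by (intro sets_PiM_I_finite) auto
    have pr: "(\<Prod>i\<in>I. indicator (A i) (x i)) = (indicator (Pi\<^sub>E I A) x :: real)"
      if "x \<in> space (Pi\<^sub>M I (\<lambda>_. borel :: real measure))" for x
      using that fin by (auto simp: indicator_def space_PiM PiE_iff prod_zero_iff)
    have "(\<integral>x. (\<Prod>i\<in>I. indicator (A i) (x i)) *\<^sub>R (1::complex) \<partial>M) = (\<integral>x. (\<Prod>i\<in>I. indicator (A i) (x i)) *\<^sub>R (1::complex) \<partial>M')"
      using J[of I A "\<lambda>_. 0"] A fin by simp
    also have "(\<integral>x. (\<Prod>i\<in>I. indicator (A i) (x i)) *\<^sub>R (1::complex) \<partial>M) = (\<integral>x. indicator (Pi\<^sub>E I A) x *\<^sub>R (1::complex) \<partial>M)"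
      using sets_eq_imp_space_eq[OF sM] pr by (intro Bochner_Integration.integral_cong) auto
    also have "(\<integral>x. (\<Prod>i\<in>I. indicator (A i) (x i)) *\<^sub>R (1::complex) \<partial>M') = (\<integral>x. indicator (Pi\<^sub>E I A) x *\<^sub>R (1::complex) \<partial>M')"
      using sets_eq_imp_space_eq[OF sM'] pr by (intro Bochner_Integration.integral_cong) auto
    finally have "complex_of_real (measure M (Pi\<^sub>E I A)) = complex_of_real (measure M' (Pi\<^sub>E I A))"
      using PA sM sM' by (simp add: M.emeasure_eq_measure M'.emeasure_eq_measure scaleR_conv_of_real)
    then show "emeasure M (Pi\<^sub>E I A) = emeasure M' (Pi\<^sub>E I A)"
      by (simp add: M.emeasure_eq_measure M'.emeasure_eq_measure)
  next
    show "range (\<lambda>_. space (Pi\<^sub>M I (\<lambda>_. borel))) \<subseteq> prod_algebra I (\<lambda>_. borel :: real measure)"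
      using fin by (auto simp: space_PiM intro!: prod_algebraI_finite)
  qed (use sM sM' in auto)
qed

subsection \<open>Standard Gaussian vectors\<close>

definition std_gauss :: "(real^'d) measure" where
  "std_gauss = distr (Pi\<^sub>M UNIV (\<lambda>_::'d::finite. std_normal_distribution)) borel (\<lambda>x. \<chi> i. x i)"

text \<open>Scaling a standard vector gives a probability measure for every real \<open>s\<close>;
  \<open>gauss 0\<close> is the point mass at the origin, which covers repeated nodes of a
  partition.\<close>

definition gauss :: "real \<Rightarrow> (real^'d) measure" where
  "gauss s = distr std_gauss borel (\<lambda>z. sqrt s *\<^sub>R z)"

lemma sets_std_gauss [measurable_cong, simp]: "sets std_gauss = sets borel" by (simp add: std_gauss_def)
lemma sets_gauss [measurable_cong, simp]: "sets (gauss s) = sets borel" by (simp add: gauss_def)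
lemma space_std_gauss [simp]: "space std_gauss = UNIV" by (simp add: std_gauss_def)
lemma space_gauss [simp]: "space (gauss s) = UNIV" by (simp add: gauss_def)

lemma borel_measurable_vecI:
  fixes f :: "'a \<Rightarrow> real^'d"
  assumes "\<And>i. (\<lambda>x. f x $ i) \<in> borel_measurable M"
  shows "f \<in> borel_measurable M"
  using assms by (subst borel_measurable_euclidean_space) (auto simp: Basis_vec_def inner_axis)

lemma measurable_vec_lambda_PiM [measurable]:
  "(\<lambda>x. \<chi> i. x i) \<in> borel_measurable (Pi\<^sub>M UNIV (\<lambda>_::'d::finite. std_normal_distribution))"
  by (rule borel_measurable_vecI) simp

interpretation nrm: prob_space std_normal_distribution
  by (rule prob_space_normal_density) simp

interpretation nrms: product_prob_space "\<lambda>_::'i. std_normal_distribution" UNIV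
  by standard

lemma prob_space_std_gauss: "prob_space std_gauss"
  unfolding std_gauss_def by (intro prob_space.prob_space_distr measurable_vec_lambda_PiM prob_space_PiM nrm.prob_space_axioms)

lemma prob_space_gauss: "prob_space (gauss s)"
  unfolding gauss_def by (intro prob_space.prob_space_distr prob_space_std_gauss) simp

interpretation std_gauss: prob_space std_gauss by (rule prob_space_std_gauss)
interpretation gauss: prob_space "gauss s" for s by (rule prob_space_gauss)

lemma integral_std_gauss_prod:
  fixes f :: "'d::finite \<Rightarrow> real \<Rightarrow> 'b::{real_normed_field,banach,second_countable_topology}"
  assumes "\<And>i. integrable std_normal_distribution (f i)"
  shows "(\<integral>z. (\<Prod>i\<in>UNIV. f i (z $ i)) \<partial>std_gauss) = (\<Prod>i\<in>UNIV. integral\<^sup>L std_normal_distribution (f i))"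
    and "integrable std_gauss (\<lambda>z. (\<Prod>i\<in>UNIV. f i (z $ i)))"
proof -
  have [measurable]: "f i \<in> borel_measurable borel" for i
    using borel_measurable_integrable[OF assms[of i]] by simp
  have m: "(\<lambda>z. \<Prod>i\<in>UNIV. f i (z $ i)) \<in> borel_measurable borel" by simp
  show "(\<integral>z. (\<Prod>i\<in>UNIV. f i (z $ i)) \<partial>std_gauss) = (\<Prod>i\<in>UNIV. integral\<^sup>L std_normal_distribution (f i))"
    unfolding std_gauss_def using nrms.product_integral_prod[of UNIV f] assms
    by (subst integral_distr[OF measurable_vec_lambda_PiM m]) simp
  show "integrable std_gauss (\<lambda>z. (\<Prod>i\<in>UNIV. f i (z $ i)))"
    unfolding std_gauss_def using nrms.product_integrable_prod[of UNIV f] assms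
    by (subst integrable_distr_eq[OF measurable_vec_lambda_PiM m]) simp
qed

lemma norm_power2_vec: "(norm (x :: real^'d))\<^sup>2 = (\<Sum>i\<in>UNIV. (x $ i)\<^sup>2)"
  unfolding power2_norm_eq_inner by (simp add: inner_vec_def power2_eq_square)

lemma char_std_gauss: "(\<integral>z. cis (\<xi> \<bullet> z) \<partial>std_gauss) = complex_of_real (exp (- (norm \<xi>)\<^sup>2 / 2))"
proof -
  have c1: "(\<integral>y. cis (b * y) \<partial>std_normal_distribution) = complex_of_real (exp (- b\<^sup>2 / 2))" for b
    using fun_cong[OF char_std_normal_distribution, of b] by (simp add: char_def cis_conv_exp)
  have "cis (\<xi> \<bullet> z) = (\<Prod>i\<in>UNIV. cis (\<xi> $ i * z $ i))" for z
    by (simp add: inner_vec_def cis_conv_exp exp_sum[symmetric] sum_distrib_left)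
  then have "(\<integral>z. cis (\<xi> \<bullet> z) \<partial>std_gauss) = (\<Prod>i\<in>UNIV. (\<integral>y. cis (\<xi> $ i * y) \<partial>std_normal_distribution))"
    using integral_std_gauss_prod(1)[of "\<lambda>i y. cis (\<xi> $ i * y)"]
    by (simp add: cis_conv_exp nrm.integrable_const_bound[of _ 1])
  also have "\<dots> = complex_of_real (exp (- (norm \<xi>)\<^sup>2 / 2))"
    by (simp add: c1 norm_power2_vec of_real_prod[symmetric] exp_sum[symmetric] sum_negf sum_divide_distrib del: of_real_prod)
  finally show ?thesis .
qed

lemma char_gauss:
  assumes "s \<ge> 0"
  shows "(\<integral>z. cis (\<xi> \<bullet> z) \<partial>gauss s) = complex_of_real (exp (- s * (norm \<xi>)\<^sup>2 / 2))"
proof -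
  have "(\<integral>z. cis (\<xi> \<bullet> z) \<partial>gauss s) = (\<integral>z. cis ((sqrt s *\<^sub>R \<xi>) \<bullet> z) \<partial>std_gauss)"
    unfolding gauss_def by (subst integral_distr) (auto simp: cis_conv_exp)
  then show ?thesis using assms char_std_gauss[of "sqrt s *\<^sub>R \<xi>"] by (simp add: power_mult_distrib)
qed

lemma std_normal_integrable_power: "integrable std_normal_distribution (\<lambda>x. x ^ k)"
  by (subst integrable_density) (auto simp: integrable_std_normal_moment)

lemma std_normal_moments:
  "(\<integral>x. x \<partial>std_normal_distribution) = 0" "(\<integral>x. x\<^sup>2 \<partial>std_normal_distribution) = 1"
  using integral_std_normal_moment_odd[of 0] integral_std_normal_moment_even[of 1]
  by (simp_all add: integral_density)

lemma integrable_if: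
  "(P \<Longrightarrow> integrable M f) \<Longrightarrow> (\<not> P \<Longrightarrow> integrable M g) \<Longrightarrow> integrable M (\<lambda>x. if P then f x else g x)"
  by (cases P) auto

lemma std_gauss_integrable_power: "integrable std_gauss (\<lambda>z. (z $ i) ^ k)"
proof -
  \<comment> \<open>Factors equal to 1 in the other coordinates bring a moment of one coordinate
    into product form.\<close>
  have "integrable std_gauss (\<lambda>z. (\<Prod>l\<in>UNIV. (if l = i then (z $ l) ^ k else 1)))"
    by (intro integral_std_gauss_prod(2) integrable_if std_normal_integrable_power) simp
  then show ?thesis by simp
qed

lemma std_gauss_integral_comp: "(\<integral>z. z $ i \<partial>std_gauss) = 0"
proof -
  have "(\<integral>z. (\<Prod>l\<in>UNIV. (if l = i then z $ l else 1)) \<partial>std_gauss)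
    = (\<Prod>l\<in>UNIV. (\<integral>y. (if l = i then y else 1) \<partial>std_normal_distribution))"
    by (intro integral_std_gauss_prod(1) integrable_if) (use std_normal_integrable_power[of 1] in simp_all)
  also have "\<dots> = 0" by (rule prod_zero) (auto intro!: exI[of _ i] simp: std_normal_moments)
  finally show ?thesis by simp
qed

lemma std_gauss_integrable_mult: "integrable std_gauss (\<lambda>z. z $ i * z $ j)"
proof (rule Bochner_Integration.integrable_bound)
  show "integrable std_gauss (\<lambda>z. (z $ i)\<^sup>2 + (z $ j)\<^sup>2)"
    by (intro Bochner_Integration.integrable_add std_gauss_integrable_power)
  have "\<bar>a * b\<bar> \<le> \<bar>a\<^sup>2 + b\<^sup>2\<bar>" for a b :: real
  proof -
    have "2 * (\<bar>a\<bar> * \<bar>b\<bar>) \<le> a\<^sup>2 + b\<^sup>2" using sum_squares_bound[of "\<bar>a\<bar>" "\<bar>b\<bar>"] by simp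
    moreover have "0 \<le> \<bar>a\<bar> * \<bar>b\<bar>" by simp
    ultimately show ?thesis unfolding abs_mult by linarith
  qed
  then show "AE z in std_gauss. norm (z $ i * z $ j) \<le> norm ((z $ i)\<^sup>2 + (z $ j)\<^sup>2)" by simp
qed simp

lemma std_gauss_integral_mult: "(\<integral>z. z $ i * z $ j \<partial>std_gauss) = (if i = j then 1 else 0)"
proof (cases "i = j")
  case True
  have "(\<integral>z. (\<Prod>l\<in>UNIV. (if l = i then (z $ l)\<^sup>2 else 1)) \<partial>std_gauss)
    = (\<Prod>l\<in>UNIV. (\<integral>y. (if l = i then y\<^sup>2 else 1) \<partial>std_normal_distribution))"
    by (intro integral_std_gauss_prod(1) integrable_if std_normal_integrable_power) simp
  also have "\<dots> = 1"
  proof (rule prod.neutral, rule ballI)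
    fix l show "(\<integral>y. (if l = i then y\<^sup>2 else 1) \<partial>std_normal_distribution) = 1"
      using std_normal_moments(2) nrm.prob_space by (cases "l = i") simp_all
  qed
  finally show ?thesis using True by (simp add: power2_eq_square)
next
  case False
  have "(\<integral>z. (\<Prod>l\<in>UNIV. (if l = i then z $ l else if l = j then z $ l else 1)) \<partial>std_gauss)
    = (\<Prod>l\<in>UNIV. (\<integral>y. (if l = i then y else if l = j then y else 1) \<partial>std_normal_distribution))"
    by (intro integral_std_gauss_prod(1) integrable_if) (use std_normal_integrable_power[of 1] in simp_all)
  also have "\<dots> = 0" by (rule prod_zero) (auto intro!: exI[of _ i] simp: std_normal_moments)
  finally have eq0: "(\<integral>z. (\<Prod>l\<in>UNIV. (if l = i then z $ l else if l = j then z $ l else 1)) \<partial>std_gauss) = 0" .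
  have "(\<Prod>l\<in>UNIV. (if l = i then z $ l else if l = j then z $ l else 1)) = z $ i * z $ j" for z :: "real^'a"
  proof -
    have "(\<Prod>l\<in>UNIV. (if l = i then z $ l else if l = j then z $ l else 1))
      = (\<Prod>l\<in>UNIV. (if l = i then z $ l else 1) * (if l = j then z $ l else 1))"
      by (rule prod.cong) (use False in auto)
    then show ?thesis by (simp add: prod.distrib)
  qed
  then show ?thesis using False eq0 by simp
qed

lemma norm_matrix_vector_le: "norm (A *v x) \<le> norm A * norm (x :: real^'n)" for A :: "real^'n^'m"
proof -
  have "(norm (A *v x))\<^sup>2 = (\<Sum>i\<in>UNIV. (A $ i \<bullet> x)\<^sup>2)"
    by (simp add: norm_power2_vec matrix_vector_mult_def inner_vec_def)
  also have "\<dots> \<le> (\<Sum>i\<in>UNIV. (norm (A $ i))\<^sup>2 * (norm x)\<^sup>2)"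
    by (intro sum_mono) (simp add: Cauchy_Schwarz_ineq power2_norm_eq_inner)
  also have "\<dots> = (norm A * norm x)\<^sup>2"
    by (simp add: power_mult_distrib sum_distrib_right norm_vec_def[of A] L2_set_def sum_nonneg)
  finally show ?thesis by (rule power2_le_imp_le) simp
qed

lemma std_gauss_integral_inner: "integrable std_gauss (\<lambda>z. a \<bullet> z)" "(\<integral>z. a \<bullet> z \<partial>std_gauss) = 0"
proof -
  have i: "integrable std_gauss (\<lambda>z. a $ i * z $ i)" for i using std_gauss_integrable_power[of i 1] by simp
  then show "integrable std_gauss (\<lambda>z. a \<bullet> z)" by (simp add: inner_vec_def)
  show "(\<integral>z. a \<bullet> z \<partial>std_gauss) = 0"
    using i by (simp add: inner_vec_def Bochner_Integration.integral_sum std_gauss_integral_comp)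
qed

lemma std_gauss_integral_quad:
  "integrable std_gauss (\<lambda>z. z \<bullet> (A *v z))" "(\<integral>z. z \<bullet> (A *v z) \<partial>std_gauss) = trace A"
proof -
  have *: "z \<bullet> (A *v z) = (\<Sum>i\<in>UNIV. \<Sum>j\<in>UNIV. A $ i $ j * (z $ i * z $ j))" for z
    by (simp add: inner_vec_def matrix_vector_mult_def sum_distrib_left mult_ac)
  show "integrable std_gauss (\<lambda>z. z \<bullet> (A *v z))" unfolding *
    by (intro Bochner_Integration.integrable_sum integrable_mult_right std_gauss_integrable_mult)
  have "(\<integral>z. z \<bullet> (A *v z) \<partial>std_gauss) = (\<Sum>i\<in>UNIV. \<Sum>j\<in>UNIV. A $ i $ j * (if i = j then 1 else 0))"
    unfolding * by (simp add: std_gauss_integrable_mult std_gauss_integral_mult)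
  also have "\<dots> = trace A" unfolding trace_def by (intro sum.cong) (simp_all add: if_distrib sum.delta' cong: if_cong)
  finally show "(\<integral>z. z \<bullet> (A *v z) \<partial>std_gauss) = trace A" .
qed

lemma std_gauss_integrable_norm4: "integrable std_gauss (\<lambda>z. (norm z) ^ 4)"
proof (rule Bochner_Integration.integrable_bound)
  show "integrable std_gauss (\<lambda>z::real^'d. (\<Sum>i\<in>UNIV. \<Sum>j\<in>(UNIV::'d set). (z $ i) ^ 4 + (z $ j) ^ 4))"
    by (intro Bochner_Integration.integrable_sum Bochner_Integration.integrable_add std_gauss_integrable_power)
  have ab: "a\<^sup>2 * b\<^sup>2 \<le> a ^ 4 + b ^ 4" for a b :: real
  proof -
    have "2 * (a\<^sup>2 * b\<^sup>2) \<le> a ^ 4 + b ^ 4" using sum_squares_bound[of "a\<^sup>2" "b\<^sup>2"] by simp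
    moreover have "0 \<le> a\<^sup>2 * b\<^sup>2" by simp
    ultimately show ?thesis by linarith
  qed
  have "(norm z) ^ 4 \<le> (\<Sum>i\<in>UNIV. \<Sum>j\<in>UNIV. (z $ i) ^ 4 + (z $ j) ^ 4)" for z :: "real^'d"
  proof -
    have "(norm z) ^ 4 = ((norm z)\<^sup>2)\<^sup>2" by simp
    also have "\<dots> = (\<Sum>i\<in>UNIV. \<Sum>j\<in>UNIV. (z $ i)\<^sup>2 * (z $ j)\<^sup>2)"
      unfolding norm_power2_vec by (simp add: power2_eq_square sum_product)
    also have "\<dots> \<le> (\<Sum>i\<in>UNIV. \<Sum>j\<in>UNIV. (z $ i) ^ 4 + (z $ j) ^ 4)"
      by (intro sum_mono ab)
    finally show ?thesis .
  qed
  then show "AE z in std_gauss. norm ((norm (z::real^'d)) ^ 4) \<le> norm (\<Sum>i\<in>UNIV. \<Sum>j\<in>UNIV. (z $ i) ^ 4 + (z $ j) ^ 4)"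
    by (auto intro: order_trans[OF _ abs_ge_self])
qed simp

lemma gauss_integral_inner: "integrable (gauss s) (\<lambda>z. a \<bullet> z)" "(\<integral>z. a \<bullet> z \<partial>gauss s) = 0"
  unfolding gauss_def using std_gauss_integral_inner[of a]
  by (simp_all add: integrable_distr_eq integral_distr)

lemma gauss_integral_quad:
  assumes "s \<ge> 0"
  shows "integrable (gauss s) (\<lambda>z. z \<bullet> (A *v z))" "(\<integral>z. z \<bullet> (A *v z) \<partial>gauss s) = s * trace A"
proof -
  have [measurable]: "(\<lambda>z. A *v z) \<in> borel_measurable borel"
    by (intro borel_measurable_continuous_onI linear_continuous_on) simp
  have *: "(sqrt s *\<^sub>R z) \<bullet> (A *v (sqrt s *\<^sub>R z)) = s * (z \<bullet> (A *v z))" for z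
    using assms by (simp add: matrix_vector_mult_scaleR mult.assoc[symmetric])
  show "integrable (gauss s) (\<lambda>z. z \<bullet> (A *v z))" "(\<integral>z. z \<bullet> (A *v z) \<partial>gauss s) = s * trace A"
    unfolding gauss_def using std_gauss_integral_quad[of A]
    by (simp_all add: integrable_distr_eq integral_distr * del: inner_scaleR_left inner_scaleR_right)
qed

lemma gauss_integral_norm2:
  assumes "s \<ge> 0"
  shows "integrable (gauss s) (\<lambda>z::real^'d. (norm z)\<^sup>2)" "(\<integral>z. (norm (z::real^'d))\<^sup>2 \<partial>gauss s) = s * CARD('d)"
  using gauss_integral_quad[OF assms, of "mat 1"] by (simp_all add: power2_norm_eq_inner trace_I)

lemma gauss_integral_inner2:
  assumes "s \<ge> 0"
  shows "integrable (gauss s) (\<lambda>z. (a \<bullet> z)\<^sup>2)" "(\<integral>z. (a \<bullet> z)\<^sup>2 \<partial>gauss s) = s * (norm a)\<^sup>2"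
proof -
  \<comment> \<open>The rank-one matrix built from \<open>a\<close> turns the squared linear form
    into a quadratic form.\<close>
  define A where "A = (\<chi> i j. a $ i * a $ j)"
  have "(a \<bullet> z)\<^sup>2 = z \<bullet> (A *v z)" for z
    unfolding A_def by (simp add: power2_eq_square inner_vec_def matrix_vector_mult_def sum_product sum_distrib_left mult_ac)
  moreover have "trace A = (norm a)\<^sup>2"
    unfolding norm_power2_vec by (simp add: trace_def A_def power2_eq_square)
  ultimately show "integrable (gauss s) (\<lambda>z. (a \<bullet> z)\<^sup>2)" "(\<integral>z. (a \<bullet> z)\<^sup>2 \<partial>gauss s) = s * (norm a)\<^sup>2"
    using gauss_integral_quad[OF assms, of A] by simp_all
qed

text \<open>An upper bound for the variance of \<open>z \<bullet> (A *v z)\<close> over matrices of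
  Frobenius norm 1, from (x - y)^2 \<le> 2 x^2 + 2 y^2 with |z . A z| \<le> |A| |z|^2 and |tr A|
  \<le> d |A|. What counts is that it depends neither on \<open>A\<close> nor on the step
  size.\<close>

definition gauss_quad_const :: "'d::finite itself \<Rightarrow> real" where
  "gauss_quad_const _ = (\<integral>z. 2 * (norm (z::real^'d)) ^ 4 + 2 * (real CARD('d))\<^sup>2 \<partial>std_gauss)"

lemma trace_le_norm: "\<bar>trace A\<bar> \<le> real CARD('d) * norm (A :: real^'d^'d)"
proof -
  have "\<bar>A $ i $ i\<bar> \<le> norm A" for i
    by (rule order_trans[OF component_le_norm_cart Finite_Cartesian_Product.norm_nth_le])
  then have "(\<Sum>i\<in>UNIV. \<bar>A $ i $ i\<bar>) \<le> (\<Sum>i\<in>(UNIV::'d set). norm A)" by (intro sum_mono)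
  then show ?thesis unfolding trace_def by (simp add: order_trans[OF sum_abs])
qed

text \<open>By scaling, the deviation is \<open>s\<close> times a standard one, so its variance is
  of order \<open>s\<^sup>2\<close>. Over \<open>n\<close> steps of length \<open>T / n\<close> such
  variances add up to order \<open>1 / n\<close>, which is why the quadratic variation
  concentrates.\<close>

lemma gauss_integral_quad_var:
  fixes A :: "real^'d^'d"
  assumes s: "s \<ge> 0"
  shows "integrable (gauss s) (\<lambda>z. (z \<bullet> (A *v z) - s * trace A)\<^sup>2)"
    "(\<integral>z. (z \<bullet> (A *v z) - s * trace A)\<^sup>2 \<partial>gauss s) \<le> gauss_quad_const TYPE('d) * (s\<^sup>2 * (norm A)\<^sup>2)"
proof -
  have [measurable]: "(\<lambda>z. A *v z) \<in> borel_measurable borel"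
    by (intro borel_measurable_continuous_onI linear_continuous_on) simp
  have *: "((sqrt s *\<^sub>R z) \<bullet> (A *v (sqrt s *\<^sub>R z)) - s * trace A)\<^sup>2 = s\<^sup>2 * (z \<bullet> (A *v z) - trace A)\<^sup>2" for z
  proof -
    have "(sqrt s *\<^sub>R z) \<bullet> (A *v (sqrt s *\<^sub>R z)) = s * (z \<bullet> (A *v z))"
      using s by (simp add: matrix_vector_mult_scaleR mult.assoc[symmetric])
    then show ?thesis by (simp only:) (simp add: power2_eq_square algebra_simps)
  qed
  have bd: "(z \<bullet> (A *v z) - trace A)\<^sup>2 \<le> (norm A)\<^sup>2 * (2 * (norm z) ^ 4 + 2 * (real CARD('d))\<^sup>2)" for z
  proof -
    have q: "\<bar>z \<bullet> (A *v z)\<bar> \<le> norm A * (norm z)\<^sup>2"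
      using order_trans[OF Cauchy_Schwarz_ineq2 mult_left_mono[OF norm_matrix_vector_le[of A z] norm_ge_zero[of z]]]
      by (simp add: power2_eq_square mult_ac)
    have "(z \<bullet> (A *v z) - trace A)\<^sup>2 \<le> 2 * (z \<bullet> (A *v z))\<^sup>2 + 2 * (trace A)\<^sup>2"
      using zero_le_power2[of "z \<bullet> (A *v z) + trace A"] by (simp add: power2_eq_square algebra_simps)
    also have "\<dots> \<le> 2 * (norm A * (norm z)\<^sup>2)\<^sup>2 + 2 * (real CARD('d) * norm A)\<^sup>2"
      using power_mono[OF q, of 2] power_mono[OF trace_le_norm[of A], of 2] by simp
    also have "\<dots> = (norm A)\<^sup>2 * (2 * (norm z) ^ 4 + 2 * (real CARD('d))\<^sup>2)"
      by (simp add: power_mult_distrib algebra_simps)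
    finally show ?thesis .
  qed
  have i1: "integrable std_gauss (\<lambda>z::real^'d. (norm A)\<^sup>2 * (2 * (norm z) ^ 4 + 2 * (real CARD('d))\<^sup>2))"
    by (intro integrable_mult_right Bochner_Integration.integrable_add std_gauss_integrable_norm4) simp
  have i2: "integrable std_gauss (\<lambda>z. (z \<bullet> (A *v z) - trace A)\<^sup>2)"
    by (rule Bochner_Integration.integrable_bound[OF i1])
       (use bd in \<open>auto intro: order_trans[OF _ abs_ge_self]\<close>)
  then show "integrable (gauss s) (\<lambda>z. (z \<bullet> (A *v z) - s * trace A)\<^sup>2)"
    unfolding gauss_def by (subst integrable_distr_eq) (auto simp only: * intro!: integrable_mult_right, measurable)
  have "(\<integral>z. (z \<bullet> (A *v z) - s * trace A)\<^sup>2 \<partial>gauss s) = s\<^sup>2 * (\<integral>z. (z \<bullet> (A *v z) - trace A)\<^sup>2 \<partial>std_gauss)"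
    unfolding gauss_def by (subst integral_distr) (auto simp only: * integral_mult_right_zero, measurable)
  also have "\<dots> \<le> s\<^sup>2 * (\<integral>z. (norm A)\<^sup>2 * (2 * (norm (z::real^'d)) ^ 4 + 2 * (real CARD('d))\<^sup>2) \<partial>std_gauss)"
    by (rule mult_left_mono[OF Bochner_Integration.integral_mono[OF i2 i1 bd]]) simp
  also have "\<dots> = gauss_quad_const TYPE('d) * (s\<^sup>2 * (norm A)\<^sup>2)"
    unfolding gauss_quad_const_def integral_mult_right_zero by simp
  finally show "(\<integral>z. (z \<bullet> (A *v z) - s * trace A)\<^sup>2 \<partial>gauss s) \<le> gauss_quad_const TYPE('d) * (s\<^sup>2 * (norm A)\<^sup>2)" .
qed

text \<open>Completing the square: the tilted standard density is its translate by \<open>b\<close>.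
  This is the Cameron-Martin formula in one dimension; it is put for nonnegative integrals so that
  Tonelli carries it to products.\<close>

lemma std_normal_shift:
  assumes [measurable]: "g \<in> borel_measurable borel"
  shows "(\<integral>\<^sup>+y. ennreal (exp (b * y - b\<^sup>2 / 2)) * g y \<partial>std_normal_distribution) = (\<integral>\<^sup>+y. g (y + b) \<partial>std_normal_distribution)"
proof -
  have *: "std_normal_density y * exp (b * y - b\<^sup>2 / 2) = std_normal_density (y - b)" for y
    by (simp add: std_normal_density_def exp_add[symmetric] power2_eq_square field_simps)
  have "(\<integral>\<^sup>+y. ennreal (exp (b * y - b\<^sup>2 / 2)) * g y \<partial>std_normal_distribution)
    = (\<integral>\<^sup>+y. ennreal (std_normal_density (y - b)) * g y \<partial>lborel)"
    by (subst nn_integral_density) (auto simp: mult.assoc[symmetric] ennreal_mult[symmetric] normal_density_nonneg *[symmetric])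
  also have "\<dots> = (\<integral>\<^sup>+y. ennreal (std_normal_density y) * g (y + b) \<partial>lborel)"
    by (subst nn_integral_real_affine[where c=1 and t=b]) (auto simp: add_ac)
  also have "\<dots> = (\<integral>\<^sup>+y. g (y + b) \<partial>std_normal_distribution)"
    by (subst nn_integral_density) auto
  finally show ?thesis .
qed

text \<open>Tonelli peels off one coordinate at a time. The shift \<open>b\<close> is deterministic
  here; dependence on earlier noise enters in \<open>girsanov_change_of_variables\<close>, one
  vector at a time.\<close>

lemma std_normal_PiM_shift:
  fixes I :: "'i set"
  assumes "finite I" and "g \<in> borel_measurable (Pi\<^sub>M I (\<lambda>_. borel))"
  shows "(\<integral>\<^sup>+x. (\<Prod>i\<in>I. ennreal (exp (b i * x i - (b i)\<^sup>2 / 2))) * g x \<partial>Pi\<^sub>M I (\<lambda>_. std_normal_distribution))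
    = (\<integral>\<^sup>+x. g (\<lambda>i\<in>I. x i + b i) \<partial>Pi\<^sub>M I (\<lambda>_. std_normal_distribution))"
  using assms
proof (induction I arbitrary: g rule: finite_induct)
  case empty
  show ?case by (simp add: PiM_empty nn_integral_count_space_finite restrict_def)
next
  case (insert i I)
  note [measurable] = insert.prems
  let ?P = "\<lambda>I. Pi\<^sub>M I (\<lambda>_. std_normal_distribution)"
  have cs[measurable_cong]: "sets (?P J) = sets (Pi\<^sub>M J (\<lambda>_. borel))" for J :: "'i set"
    by (intro sets_PiM_cong) auto
  have ne: "j \<noteq> i" if "j \<in> I" for j using that insert.hyps by auto
  have upd[measurable]: "(\<lambda>(f, y). f(i := y)) \<in> measurable (Pi\<^sub>M I (\<lambda>_. borel) \<Otimes>\<^sub>M borel) (Pi\<^sub>M (insert i I) (\<lambda>_. borel :: real measure))"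
    by (rule measurable_add_dim)
  have gm: "(\<lambda>(f, y). g (f(i := y + b i))) \<in> borel_measurable (Pi\<^sub>M I (\<lambda>_. borel) \<Otimes>\<^sub>M borel)"
    using measurable_compose[OF _ insert.prems, of "\<lambda>(f,y). f(i := y + b i)"] by measurable
  \<comment> \<open>The shifted integral over the new coordinate, as a function of the old ones; the
    induction hypothesis is applied to it.\<close>
  define G where "G x = (\<integral>\<^sup>+y. g (x(i := y + b i)) \<partial>std_normal_distribution)" for x
  have Gm: "G \<in> borel_measurable (Pi\<^sub>M I (\<lambda>_. borel))"
    unfolding G_def by (rule nrm.borel_measurable_nn_integral) (use gm in \<open>simp add: measurable_cong_sets[OF sets_pair_measure_cong[OF refl sets_density] refl]\<close>)
  have "(\<integral>\<^sup>+x. (\<Prod>i\<in>insert i I. ennreal (exp (b i * x i - (b i)\<^sup>2 / 2))) * g x \<partial>?P (insert i I))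
    = (\<integral>\<^sup>+x. (\<integral>\<^sup>+y. (\<Prod>j\<in>insert i I. ennreal (exp (b j * (x(i := y)) j - (b j)\<^sup>2 / 2))) * g (x(i := y)) \<partial>std_normal_distribution) \<partial>?P I)"
    using insert.hyps by (intro nrms.product_nn_integral_insert) measurable
  also have "\<dots> = (\<integral>\<^sup>+x. (\<Prod>j\<in>I. ennreal (exp (b j * x j - (b j)\<^sup>2 / 2))) * G x \<partial>?P I)"
  proof (rule nn_integral_cong)
    fix x assume x: "x \<in> space (?P I)"
    have gx[measurable]: "(\<lambda>y. g (x(i := y))) \<in> borel_measurable borel"
      using measurable_compose[OF measurable_compose[OF measurable_Pair1' upd[unfolded case_prod_beta']] insert.prems, of x] x
      by (simp add: space_PiM)
    have p: "(\<Prod>j\<in>I. ennreal (exp (b j * (x(i := y)) j - (b j)\<^sup>2 / 2))) = (\<Prod>j\<in>I. ennreal (exp (b j * x j - (b j)\<^sup>2 / 2)))" for y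
      by (rule prod.cong) (auto simp: ne)
    have "(\<integral>\<^sup>+y. (\<Prod>j\<in>insert i I. ennreal (exp (b j * (x(i := y)) j - (b j)\<^sup>2 / 2))) * g (x(i := y)) \<partial>std_normal_distribution)
      = (\<integral>\<^sup>+y. (\<Prod>j\<in>I. ennreal (exp (b j * x j - (b j)\<^sup>2 / 2))) * (ennreal (exp (b i * y - (b i)\<^sup>2 / 2)) * g (x(i := y))) \<partial>std_normal_distribution)"
      using insert.hyps by (intro nn_integral_cong) (simp add: p mult_ac del: fun_upd_apply, simp add: mult_ac)
    also have "\<dots> = (\<Prod>j\<in>I. ennreal (exp (b j * x j - (b j)\<^sup>2 / 2))) * G x"
      unfolding G_def by (subst nn_integral_cmult) (auto simp: std_normal_shift)
    finally show "(\<integral>\<^sup>+y. (\<Prod>j\<in>insert i I. ennreal (exp (b j * (x(i := y)) j - (b j)\<^sup>2 / 2))) * g (x(i := y)) \<partial>std_normal_distribution) = (\<Prod>j\<in>I. ennreal (exp (b j * x j - (b j)\<^sup>2 / 2))) * G x" .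
  qed
  also have "\<dots> = (\<integral>\<^sup>+x. G (\<lambda>i\<in>I. x i + b i) \<partial>?P I)" by (rule insert.IH[OF Gm])
  also have "\<dots> = (\<integral>\<^sup>+x. (\<integral>\<^sup>+y. g (\<lambda>j\<in>insert i I. (x(i := y)) j + b j) \<partial>std_normal_distribution) \<partial>?P I)"
    unfolding G_def
    by (intro nn_integral_cong arg_cong[where f=g]) (auto simp: fun_eq_iff restrict_def ne)
  also have "\<dots> = (\<integral>\<^sup>+x. g (\<lambda>i\<in>insert i I. x i + b i) \<partial>?P (insert i I))"
    using insert.hyps by (intro nrms.product_nn_integral_insert[symmetric]) measurable
  finally show ?case .
qed

lemma std_gauss_shift:
  fixes a :: "real^'d"
  assumes [measurable]: "g \<in> borel_measurable borel"
  shows "(\<integral>\<^sup>+z. ennreal (exp (a \<bullet> z - (norm a)\<^sup>2 / 2)) * g z \<partial>std_gauss) = (\<integral>\<^sup>+z. g (z + a) \<partial>std_gauss)"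
proof -
  have cs[measurable_cong]: "sets (Pi\<^sub>M UNIV (\<lambda>_::'d::finite. std_normal_distribution)) = sets (Pi\<^sub>M UNIV (\<lambda>_. borel))"
    by (intro sets_PiM_cong) auto
  have vm[measurable]: "(\<lambda>x. \<chi> i. x i) \<in> borel_measurable (Pi\<^sub>M UNIV (\<lambda>_::'d::finite. borel :: real measure))"
    using measurable_vec_lambda_PiM measurable_cong_sets[OF cs refl] by blast
  have "(\<integral>\<^sup>+z. ennreal (exp (a \<bullet> z - (norm a)\<^sup>2 / 2)) * g z \<partial>std_gauss)
    = (\<integral>\<^sup>+x. (\<Prod>i\<in>UNIV. ennreal (exp (a $ i * x i - (a $ i)\<^sup>2 / 2))) * g (\<chi> i. x i) \<partial>Pi\<^sub>M UNIV (\<lambda>_::'d::finite. std_normal_distribution))"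
    unfolding std_gauss_def
    by (subst nn_integral_distr)
       (auto intro!: nn_integral_cong simp: prod_ennreal exp_sum[symmetric] inner_vec_def norm_power2_vec sum_subtractf sum_divide_distrib)
  also have "\<dots> = (\<integral>\<^sup>+x. g (\<chi> i. (\<lambda>i\<in>UNIV. x i + a $ i) i) \<partial>Pi\<^sub>M UNIV (\<lambda>_::'d::finite. std_normal_distribution))"
    by (rule std_normal_PiM_shift) auto
  also have "\<dots> = (\<integral>\<^sup>+x. g ((\<chi> i. x i) + a) \<partial>Pi\<^sub>M UNIV (\<lambda>_::'d::finite. std_normal_distribution))"
    by (intro nn_integral_cong arg_cong[where f=g]) (simp add: vec_eq_iff)
  also have "\<dots> = (\<integral>\<^sup>+z. g (z + a) \<partial>std_gauss)"
    unfolding std_gauss_def by (subst nn_integral_distr) auto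
  finally show ?thesis .
qed

text \<open>Writing a \<open>gauss s\<close> vector as \<open>sqrt s\<close> times a standard one
  changes the tilt to \<open>sqrt s *\<^sub>R a\<close> and the shift to
  \<open>s *\<^sub>R a\<close>, the displacement at velocity \<open>a\<close> during time
  \<open>s\<close>.\<close>

lemma gauss_shift:
  fixes a :: "real^'d"
  assumes [measurable]: "g \<in> borel_measurable borel" and s: "s \<ge> 0"
  shows "(\<integral>\<^sup>+z. ennreal (exp (a \<bullet> z - s / 2 * (norm a)\<^sup>2)) * g z \<partial>gauss s) = (\<integral>\<^sup>+z. g (z + s *\<^sub>R a) \<partial>gauss s)"
proof -
  have "(\<integral>\<^sup>+z. ennreal (exp (a \<bullet> z - s / 2 * (norm a)\<^sup>2)) * g z \<partial>gauss s)
    = (\<integral>\<^sup>+z. ennreal (exp ((sqrt s *\<^sub>R a) \<bullet> z - (norm (sqrt s *\<^sub>R a))\<^sup>2 / 2)) * g (sqrt s *\<^sub>R z) \<partial>std_gauss)"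
    unfolding gauss_def using s by (subst nn_integral_distr) (auto simp: power_mult_distrib)
  also have "\<dots> = (\<integral>\<^sup>+z. g (sqrt s *\<^sub>R (z + sqrt s *\<^sub>R a)) \<partial>std_gauss)"
    by (rule std_gauss_shift) simp
  also have "\<dots> = (\<integral>\<^sup>+z. g (z + s *\<^sub>R a) \<partial>gauss s)"
    unfolding gauss_def using s by (subst nn_integral_distr) (auto simp: scaleR_add_right)
  finally show ?thesis .
qed

subsection \<open>Increments of Brownian motion and the discrete Girsanov transformation\<close>

abbreviation borel_seq :: "nat \<Rightarrow> (nat \<Rightarrow> 'a::topological_space) measure" where
  "borel_seq n \<equiv> Pi\<^sub>M {..<n} (\<lambda>_. borel)"

abbreviation gauss_seq :: "real \<Rightarrow> nat \<Rightarrow> (nat \<Rightarrow> real^'d) measure" where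
  "gauss_seq h n \<equiv> Pi\<^sub>M {..<n} (\<lambda>_. gauss h)"

lemma sets_PiM_gauss [measurable_cong]:
  "sets (Pi\<^sub>M I (\<lambda>k. gauss (s k))) = sets (Pi\<^sub>M I (\<lambda>_. borel))"
  by (intro sets_PiM_cong) auto

lemma space_PiM_gauss: "space (Pi\<^sub>M I (\<lambda>k. gauss (s k))) = space (Pi\<^sub>M I (\<lambda>_. borel))"
  by (rule sets_eq_imp_space_eq) (rule sets_PiM_gauss)

interpretation gausses: product_prob_space "\<lambda>k::'i. gauss (s k) :: (real^'d) measure" UNIV for s
  by standard

lemma matrix_vector_measurable [measurable (raw)]:
  fixes A :: "real^'n^'m"
  assumes "f \<in> borel_measurable M"
  shows "(\<lambda>x. A *v f x) \<in> borel_measurable M"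
proof -
  have "(\<lambda>z. A *v z) \<in> borel_measurable borel"
    by (intro borel_measurable_continuous_onI linear_continuous_on) simp
  then show ?thesis using assms measurable_compose by blast
qed

lemma vec_nth_measurable [measurable (raw)]:
  fixes f :: "'a \<Rightarrow> real^'n"
  assumes "f \<in> borel_measurable M"
  shows "(\<lambda>x. f x $ i) \<in> borel_measurable M"
proof -
  have "(\<lambda>z::real^'n. z $ i) \<in> borel_measurable borel"
    by (intro borel_measurable_continuous_onI continuous_intros)
  then show ?thesis using assms measurable_compose by blast
qed

lemma wiener_prob_space: "wiener T \<mu> \<Longrightarrow> prob_space \<mu>" by (simp add: wiener_def)

lemma wiener_coord_measurable:
  assumes "wiener T \<mu>"
  shows "(\<lambda>w. w t) \<in> borel_measurable \<mu>"
proof -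
  have "(\<lambda>w. w t) \<in> borel_measurable (restrict_space (Pi\<^sub>M UNIV (\<lambda>_. borel)) (Wsp T))"
    by (intro measurable_restrict_space1) simp
  then show ?thesis using assms by (simp add: wiener_def measurable_cong_sets[of \<mu> _ borel borel])
qed

lemma wiener_increments_measurable:
  assumes "wiener T \<mu>"
  shows "(\<lambda>w. \<lambda>k\<in>{..<n::nat}. w (t (Suc k)) - w (t k)) \<in> measurable \<mu> (borel_seq n)"
  by (intro measurable_restrict borel_measurable_diff wiener_coord_measurable[OF assms])

text \<open>The identity in \<open>wiener\<close> is the joint characteristic function of the
  increments, which factorises into those of the Gaussians. The uniqueness lemma speaks of families
  of reals, so the vectors are flattened over pairs of a step and a component, and
  \<open>unflat\<close> carries the equality of laws back.\<close>

lemma wiener_increments_law: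
  fixes \<mu> :: "(real \<Rightarrow> real^'d) measure"
  assumes W: "wiener T \<mu>" and t: "t 0 = 0" "\<And>k. k < n \<Longrightarrow> t k \<le> t (Suc k)" "t n \<le> T"
  shows "distr \<mu> (borel_seq n) (\<lambda>w. \<lambda>k\<in>{..<n::nat}. w (t (Suc k)) - w (t k))
    = Pi\<^sub>M {..<n} (\<lambda>k. gauss (t (Suc k) - t k))" (is "?L = ?R")
proof -
  interpret \<mu>: prob_space \<mu> using W by (rule wiener_prob_space)
  define I where "I = {..<n} \<times> (UNIV :: 'd set)"
  define flat :: "(nat \<Rightarrow> real^'d) \<Rightarrow> nat \<times> 'd \<Rightarrow> real" where "flat z = (\<lambda>p\<in>I. z (fst p) $ snd p)" for z
  define unflat :: "(nat \<times> 'd \<Rightarrow> real) \<Rightarrow> nat \<Rightarrow> real^'d" where "unflat x = (\<lambda>k\<in>{..<n}. \<chi> i. x (k, i))" for x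
  have finI: "finite I" by (simp add: I_def)
  have fm[measurable]: "flat \<in> measurable (borel_seq n) (Pi\<^sub>M I (\<lambda>_. borel))"
    unfolding flat_def I_def
    by (intro measurable_restrict vec_nth_measurable) (auto simp: mem_Times_iff)
  have um[measurable]: "unflat \<in> measurable (Pi\<^sub>M I (\<lambda>_. borel)) (borel_seq n)"
    unfolding unflat_def I_def
    by (intro measurable_restrict borel_measurable_vecI) (auto intro!: measurable_component_singleton)
  have uf: "unflat (flat z) = z" if "z \<in> space (borel_seq n)" for z
    using that by (auto simp: unflat_def flat_def I_def space_PiM PiE_def extensional_def fun_eq_iff vec_eq_iff)
  have pL: "prob_space ?L" by (intro \<mu>.prob_space_distr wiener_increments_measurable[OF W])
  have pR: "prob_space ?R" by (intro prob_space_PiM prob_space_gauss)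
  have sR[simp]: "sets ?R = sets (borel_seq n)" by (rule sets_PiM_gauss)
  have unflat_flat: "distr (distr N (Pi\<^sub>M I (\<lambda>_. borel)) flat) (borel_seq n) unflat = N"
    if s: "sets N = sets (borel_seq n)" for N
  proof -
    have fN: "flat \<in> measurable N (Pi\<^sub>M I (\<lambda>_. borel))" using fm s measurable_cong_sets by blast
    have "distr (distr N (Pi\<^sub>M I (\<lambda>_. borel)) flat) (borel_seq n) unflat = distr N (borel_seq n) (unflat \<circ> flat)"
      by (rule distr_distr[OF um fN])
    also have "\<dots> = distr N N (\<lambda>x. x)"
      using uf sets_eq_imp_space_eq[OF s] by (intro distr_cong) (auto simp: s)
    also have "\<dots> = N" by simp
    finally show ?thesis .
  qed
  have "distr ?L (Pi\<^sub>M I (\<lambda>_. borel)) flat = distr ?R (Pi\<^sub>M I (\<lambda>_. borel)) flat"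
  proof (rule joint_char_eq_imp_eq[OF _ _ finI])
    show "prob_space (distr ?L (Pi\<^sub>M I (\<lambda>_. borel)) flat)" by (intro prob_space.prob_space_distr[OF pL]) simp
    show "prob_space (distr ?R (Pi\<^sub>M I (\<lambda>_. borel)) flat)" by (intro prob_space.prob_space_distr[OF pR]) measurable
    fix \<xi> :: "nat \<times> 'd \<Rightarrow> real"
    define \<eta> where "\<eta> k = (\<chi> i. \<xi> (k, i))" for k
    have fl: "(\<Sum>p\<in>I. \<xi> p * flat z p) = (\<Sum>k<n. \<eta> k \<bullet> z k)" for z
      unfolding I_def by (simp add: sum.cartesian_product[symmetric] flat_def I_def \<eta>_def inner_vec_def split_def sum.Sigma[symmetric])
         (simp add: sum.cartesian_product split_def)
    have m1: "(\<lambda>z. cis (\<Sum>k<n. \<eta> k \<bullet> z k)) \<in> borel_measurable (borel_seq n)"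
      unfolding cis_conv_exp by measurable
    have m2: "(\<lambda>x. cis (\<Sum>p\<in>I. \<xi> p * x p)) \<in> borel_measurable (Pi\<^sub>M I (\<lambda>_. borel))"
      unfolding cis_conv_exp by measurable
    have cisum: "cis (\<Sum>k<n. \<eta> k \<bullet> z k) = (\<Prod>k<n. cis (\<eta> k \<bullet> z k))" for z :: "nat \<Rightarrow> real^'d"
      by (simp add: cis_conv_exp exp_sum[symmetric] sum_distrib_left)
    have "(\<integral>x. cis (\<Sum>p\<in>I. \<xi> p * x p) \<partial>distr ?L (Pi\<^sub>M I (\<lambda>_. borel)) flat) = (\<integral>z. cis (\<Sum>k<n. \<eta> k \<bullet> z k) \<partial>?L)"
      by (subst integral_distr[OF _ m2]) (simp_all add: fl)
    also have "\<dots> = (\<integral>w. cis (\<Sum>k<n. \<eta> k \<bullet> (w (t (Suc k)) - w (t k))) \<partial>\<mu>)"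
      by (subst integral_distr[OF wiener_increments_measurable[OF W] m1]) simp
    also have "\<dots> = complex_of_real (exp (- (\<Sum>k<n. (t (Suc k) - t k) * (norm (\<eta> k))\<^sup>2) / 2))"
      using W t unfolding wiener_def by blast
    also have "\<dots> = (\<Prod>k<n. complex_of_real (exp (- (t (Suc k) - t k) * (norm (\<eta> k))\<^sup>2 / 2)))"
      unfolding of_real_prod[symmetric] by (subst exp_sum[symmetric]) (simp_all add: sum_divide_distrib left_diff_distrib diff_divide_distrib sum_subtractf)
    also have "\<dots> = (\<Prod>k<n. (\<integral>z. cis (\<eta> k \<bullet> z) \<partial>gauss (t (Suc k) - t k)))"
      using t by (intro prod.cong) (simp_all add: char_gauss)
    also have "\<dots> = (\<integral>z. cis (\<Sum>k<n. \<eta> k \<bullet> z k) \<partial>?R)"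
      unfolding cisum by (rule gausses.product_integral_prod[symmetric])
        (auto simp: cis_conv_exp intro!: gauss.integrable_const_bound[where B=1])
    also have "\<dots> = (\<integral>x. cis (\<Sum>p\<in>I. \<xi> p * x p) \<partial>distr ?R (Pi\<^sub>M I (\<lambda>_. borel)) flat)"
      by (subst integral_distr[OF _ m2]) (simp_all add: fl measurable_cong_sets[OF sR refl])
    finally show "(\<integral>x. cis (\<Sum>p\<in>I. \<xi> p * x p) \<partial>distr ?L (Pi\<^sub>M I (\<lambda>_. borel)) flat)
      = (\<integral>x. cis (\<Sum>p\<in>I. \<xi> p * x p) \<partial>distr ?R (Pi\<^sub>M I (\<lambda>_. borel)) flat)" .
  qed simp_all
  then show ?thesis
    by (rule trans[OF unflat_flat[OF sets_distr, symmetric] trans[OF arg_cong[where f="\<lambda>N. distr N _ unflat"] unflat_flat[OF sR]]])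
qed

lemma wiener_nn_integral_increment:
  fixes \<mu> :: "(real \<Rightarrow> real^'d) measure"
  assumes W: "wiener T \<mu>" and st: "0 \<le> s" "s \<le> t" "t \<le> T"
  shows "(\<integral>\<^sup>+w. ennreal ((norm (w t - w s))\<^sup>2) \<partial>\<mu>) = ennreal ((t - s) * CARD('d))"
proof -
  \<comment> \<open>Partitions in \<open>wiener\<close> start at 0; the partition 0, s, t puts the
    wanted increment at index 1.\<close>
  define \<tau> :: "nat \<Rightarrow> real" where "\<tau> k = (if k = 0 then 0 else if k = 1 then s else t)" for k
  have law: "distr \<mu> (borel_seq 2) (\<lambda>w. \<lambda>k\<in>{..<2::nat}. w (\<tau> (Suc k)) - w (\<tau> k))
    = Pi\<^sub>M {..<2} (\<lambda>k. gauss (\<tau> (Suc k) - \<tau> k))"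
    by (rule wiener_increments_law[OF W]) (use st in \<open>auto simp: \<tau>_def\<close>)
  have m: "(\<lambda>z. ennreal ((norm (z 1 :: real^'d))\<^sup>2)) \<in> borel_measurable (borel_seq (2::nat))"
    using measurable_component_singleton[of 1 "{..<2::nat}" "\<lambda>_. borel :: (real^'d) measure"] by simp
  have "(\<integral>\<^sup>+w. ennreal ((norm (w t - w s))\<^sup>2) \<partial>\<mu>)
    = (\<integral>\<^sup>+z. ennreal ((norm (z 1 :: real^'d))\<^sup>2) \<partial>distr \<mu> (borel_seq 2) (\<lambda>w. \<lambda>k\<in>{..<2::nat}. w (\<tau> (Suc k)) - w (\<tau> k)))"
    by (subst nn_integral_distr[OF wiener_increments_measurable[OF W]]) (use m in \<open>simp_all add: \<tau>_def\<close>)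
  also have "\<dots> = (\<integral>\<^sup>+z. ennreal ((norm (z :: real^'d))\<^sup>2) \<partial>distr (Pi\<^sub>M {..<2} (\<lambda>k. gauss (\<tau> (Suc k) - \<tau> k))) (gauss (\<tau> (Suc 1) - \<tau> 1)) (\<lambda>z. z 1))"
    unfolding law by (subst nn_integral_distr) (auto intro!: measurable_component_singleton)
  also have "\<dots> = (\<integral>\<^sup>+z. ennreal ((norm (z::real^'d))\<^sup>2) \<partial>gauss (t - s))"
    by (subst distr_PiM_component) (auto simp: \<tau>_def prob_space_gauss)
  also have "\<dots> = ennreal ((t - s) * CARD('d))"
    using st gauss_integral_norm2[of "t - s", where 'd='d] by (subst nn_integral_eq_integral) auto
  finally show ?thesis .
qed

section \<open>The discrete Girsanov transformation\<close>

text \<open>Here \<^term>\<open>z\<close> is the sequence of increments of a discrete path, so that the partial sums are its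
  values; \<^term>\<open>B k\<close> stands for the drift matrix at the \<^term>\<open>k\<close>-th node.\<close>

definition girsanov :: "real \<Rightarrow> (nat \<Rightarrow> real^'d^'d) \<Rightarrow> nat \<Rightarrow> (nat \<Rightarrow> real^'d) \<Rightarrow> real" where
  "girsanov h B n z = exp (\<Sum>k<n. (B k *v (\<Sum>j<k. z j)) \<bullet> z k - h / 2 * (norm (B k *v (\<Sum>j<k. z j)))\<^sup>2)"

lemma girsanov_pos: "girsanov h B n z > 0" by (simp add: girsanov_def)

primrec euler :: "real \<Rightarrow> (nat \<Rightarrow> real^'d^'d) \<Rightarrow> (nat \<Rightarrow> real^'d) \<Rightarrow> nat \<Rightarrow> real^'d" where
  "euler h B z 0 = 0"
| "euler h B z (Suc k) = euler h B z k + h *\<^sub>R (B k *v euler h B z k) + z k"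

text \<open>These are the increments of the Euler path driven by the noise \<open>z\<close>, in the
  same encoding as \<open>z\<close>, so that any functional of increments can be evaluated on
  both.\<close>

definition euler_shift :: "real \<Rightarrow> (nat \<Rightarrow> real^'d^'d) \<Rightarrow> nat \<Rightarrow> (nat \<Rightarrow> real^'d) \<Rightarrow> (nat \<Rightarrow> real^'d)" where
  "euler_shift h B n z = (\<lambda>k\<in>{..<n}. h *\<^sub>R (B k *v euler h B z k) + z k)"

lemma sum_euler_shift: "k \<le> n \<Longrightarrow> (\<Sum>j<k. euler_shift h B n z j) = euler h B z k"
  by (induction k) (auto simp: euler_shift_def)

text \<open>With b the drift at a node, <b, z + h b> - h/2 |b|^2 = <b, z> + h/2 |b|^2. The quadratic
  term thus changes sign, and the logarithm of the density along the Euler scheme is what the tail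
  bound estimates.\<close>

lemma girsanov_euler_shift:
  "girsanov h B n (euler_shift h B n z) = exp (\<Sum>k<n. (B k *v euler h B z k) \<bullet> z k + h / 2 * (norm (B k *v euler h B z k))\<^sup>2)"
  unfolding girsanov_def
  by (intro arg_cong[where f=exp] sum.cong)
     (auto simp: sum_euler_shift, simp add: euler_shift_def inner_add_right power2_norm_eq_inner)

lemma euler_cong: "(\<And>j. j < k \<Longrightarrow> x j = y j) \<Longrightarrow> euler h B x k = euler h B y k"
  by (induction k) auto

lemma euler_measurable: "k \<le> n \<Longrightarrow> (\<lambda>z. euler h B z k) \<in> borel_measurable (borel_seq n)"
proof (induction k)
  case (Suc k)
  then have [measurable]: "(\<lambda>z. euler h B z k) \<in> borel_measurable (borel_seq n)"
    "(\<lambda>z. z k) \<in> borel_measurable (borel_seq n)" by simp_all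
  show ?case by simp
qed simp

lemma euler_shift_measurable: "euler_shift h B n \<in> measurable (borel_seq n) (borel_seq n)"
  unfolding euler_shift_def
proof (rule measurable_restrict)
  fix k assume "k \<in> {..<n}"
  then have [measurable]: "(\<lambda>z. euler h B z k) \<in> borel_measurable (borel_seq n)"
    "(\<lambda>z. z k) \<in> borel_measurable (Pi\<^sub>M {..<n} (\<lambda>_. borel :: (real^'a) measure))" by (simp_all add: euler_measurable)
  show "(\<lambda>z. h *\<^sub>R (B k *v euler h B z k) + z k) \<in> borel_measurable (borel_seq n)" by simp
qed

lemma girsanov_measurable: "girsanov h B n \<in> borel_measurable (borel_seq n)"
proof -
  have z: "(\<lambda>z. z k) \<in> borel_measurable (Pi\<^sub>M {..<n} (\<lambda>_. borel :: (real^'a) measure))" if "k < n" for k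
    using that by simp
  have s: "(\<lambda>z. \<Sum>j<k. z j) \<in> borel_measurable (Pi\<^sub>M {..<n} (\<lambda>_. borel :: (real^'a) measure))" if "k < n" for k
    using that z by (intro borel_measurable_sum) auto
  have "(\<lambda>z. (B k *v (\<Sum>j<k. z j)) \<bullet> z k - h / 2 * (norm (B k *v (\<Sum>j<k. z j)))\<^sup>2) \<in> borel_measurable (borel_seq n)"
    if "k < n" for k
    using z[OF that] s[OF that] by measurable
  then have "(\<lambda>z. \<Sum>k<n. (B k *v (\<Sum>j<k. z j)) \<bullet> z k - h / 2 * (norm (B k *v (\<Sum>j<k. z j)))\<^sup>2)
      \<in> borel_measurable (borel_seq n)"
    by (intro borel_measurable_sum) auto
  then show ?thesis unfolding girsanov_def
    by (rule measurable_compose) (intro borel_measurable_continuous_onI continuous_intros)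
qed

lemma fun_upd_PiM_measurable:
  "x \<in> space (borel_seq n) \<Longrightarrow> (\<lambda>y. x(n := y)) \<in> measurable borel (borel_seq (Suc n))"
  unfolding lessThan_Suc by (rule measurable_component_update) auto

lemma nn_integral_gauss_Suc:
  assumes "f \<in> borel_measurable (borel_seq (Suc n))"
  shows "integral\<^sup>N (gauss_seq h (Suc n)) f = (\<integral>\<^sup>+ x. (\<integral>\<^sup>+ y. f (x(n := y)) \<partial>gauss h) \<partial>gauss_seq h n)"
  unfolding lessThan_Suc
  by (rule gausses.product_nn_integral_insert)
     (use assms in \<open>auto simp: measurable_cong_sets[OF sets_PiM_gauss refl] lessThan_Suc\<close>)

lemma measurable_nn_integral_gauss:
  assumes "f \<in> borel_measurable (borel_seq (Suc n))"
  shows "(\<lambda>x. \<integral>\<^sup>+ y. f (x(n := y)) \<partial>gauss h) \<in> borel_measurable (borel_seq n)"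
proof -
  have "(\<lambda>(x, y). x(n := y)) \<in> measurable (borel_seq n \<Otimes>\<^sub>M gauss h) (borel_seq (Suc n))"
    using measurable_add_dim[of n "{..<n}" "\<lambda>_. borel"] unfolding lessThan_Suc
    by (simp add: measurable_cong_sets[OF sets_pair_measure_cong[OF refl sets_gauss] refl])
  from measurable_compose[OF this assms]
  show ?thesis by (intro gauss.borel_measurable_nn_integral) (simp add: case_prod_beta')
qed

text \<open>Induction on the number of steps, integrating the last increment first. For fixed
  earlier increments the tilt \<open>a x\<close> is a constant vector, and
  \<open>gauss_shift\<close> replaces the last factor of the density by a translation; the induction
  hypothesis then moves the earlier increments to the Euler scheme.\<close>

lemma girsanov_change_of_variables:
  assumes h: "h \<ge> 0" and F: "F \<in> borel_measurable (borel_seq n)"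
  shows "(\<integral>\<^sup>+z. ennreal (girsanov h B n z) * F z \<partial>gauss_seq h n)
    = (\<integral>\<^sup>+z. F (euler_shift h B n z) \<partial>gauss_seq h n)"
  using F
proof (induction n arbitrary: F)
  case 0
  then show ?case by (simp add: PiM_empty nn_integral_count_space_finite girsanov_def euler_shift_def)
next
  case (Suc n)
  note [measurable] = Suc.prems
  define a where "a x = B n *v (\<Sum>j<n. x j)" for x
  have am: "a \<in> borel_measurable (borel_seq n)"
    unfolding a_def by measurable
  define G where "G x = (\<integral>\<^sup>+y. F (x(n := y + h *\<^sub>R a x)) \<partial>gauss h)" for x
  have gs: "girsanov h B (Suc n) (x(n := y)) = girsanov h B n x * exp (a x \<bullet> y - h / 2 * (norm (a x))\<^sup>2)" for x y
  proof -
    have "(\<Sum>j<k. (x(n := y)) j) = (\<Sum>j<k. x j)" if "k \<le> n" for k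
      using that by (intro sum.cong) auto
    then show ?thesis by (simp add: girsanov_def a_def exp_add[symmetric])
  qed
  \<comment> \<open>\<open>G\<close> is the inner integral of one function on
    \<open>borel_seq (Suc n)\<close>, the one treated here, and inherits its measurability through
    Tonelli.\<close>
  have Fm': "(\<lambda>x. F (\<lambda>k\<in>{..<Suc n}. if k = n then x n + h *\<^sub>R (B n *v (\<Sum>j<n. x j)) else x k)) \<in> borel_measurable (borel_seq (Suc n))"
  proof (rule measurable_compose[OF measurable_restrict Suc.prems])
    fix k assume k: "k \<in> {..<Suc n}"
    have [measurable]: "(\<lambda>x. x j) \<in> borel_measurable (Pi\<^sub>M {..<Suc n} (\<lambda>_. borel :: (real^'a) measure))" if "j < Suc n" for j
      using that by simp
    have [measurable]: "(\<lambda>x. \<Sum>j<n. x j) \<in> borel_measurable (Pi\<^sub>M {..<Suc n} (\<lambda>_. borel :: (real^'a) measure))"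
      by (intro borel_measurable_sum) simp
    show "(\<lambda>x. if k = n then x n + h *\<^sub>R (B n *v (\<Sum>j<n. x j)) else x k) \<in> borel_measurable (borel_seq (Suc n))"
      using k by (cases "k = n") simp_all
  qed
  have G_eq: "G x = (\<integral>\<^sup>+y. F (\<lambda>k\<in>{..<Suc n}. if k = n then (x(n := y)) n + h *\<^sub>R (B n *v (\<Sum>j<n. (x(n := y)) j)) else (x(n := y)) k) \<partial>gauss h)"
    if "x \<in> space (borel_seq n)" for x
    unfolding G_def using that
    by (intro nn_integral_cong arg_cong[where f=F])
       (auto simp: fun_eq_iff restrict_def a_def space_PiM PiE_def extensional_def intro!: sum.cong)
  have Gm: "G \<in> borel_measurable (borel_seq n)"
    using measurable_nn_integral_gauss[OF Fm'] by (subst measurable_cong[OF G_eq]) auto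
  have "(\<integral>\<^sup>+z. ennreal (girsanov h B (Suc n) z) * F z \<partial>gauss_seq h (Suc n))
    = (\<integral>\<^sup>+x. (\<integral>\<^sup>+y. ennreal (girsanov h B (Suc n) (x(n := y))) * F (x(n := y)) \<partial>gauss h) \<partial>gauss_seq h n)"
    using girsanov_measurable[of h B "Suc n"] Suc.prems by (intro nn_integral_gauss_Suc) simp
  also have "\<dots> = (\<integral>\<^sup>+x. ennreal (girsanov h B n x) * G x \<partial>gauss_seq h n)"
  proof (rule nn_integral_cong)
    fix x assume "x \<in> space (Pi\<^sub>M {..<n} (\<lambda>_. gauss h :: (real^'a) measure))"
    then have [measurable]: "(\<lambda>y. F (x(n := y))) \<in> borel_measurable borel"
      unfolding space_PiM_gauss by (rule measurable_compose[OF fun_upd_PiM_measurable Suc.prems])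
    have "(\<integral>\<^sup>+y. ennreal (girsanov h B (Suc n) (x(n := y))) * F (x(n := y)) \<partial>gauss h)
      = (\<integral>\<^sup>+y. ennreal (girsanov h B n x) * (ennreal (exp (a x \<bullet> y - h / 2 * (norm (a x))\<^sup>2)) * F (x(n := y))) \<partial>gauss h)"
      by (intro nn_integral_cong) (simp only: gs ennreal_mult[OF less_imp_le[OF girsanov_pos] exp_ge_zero] mult.assoc)
    also have "\<dots> = ennreal (girsanov h B n x) * G x"
      unfolding G_def by (subst gauss_shift[OF _ h, symmetric], simp, rule nn_integral_cmult) simp
    finally show "(\<integral>\<^sup>+y. ennreal (girsanov h B (Suc n) (x(n := y))) * F (x(n := y)) \<partial>gauss h) = ennreal (girsanov h B n x) * G x" .
  qed
  also have "\<dots> = (\<integral>\<^sup>+x. G (euler_shift h B n x) \<partial>gauss_seq h n)" by (rule Suc.IH[OF Gm])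
  also have "\<dots> = (\<integral>\<^sup>+x. (\<integral>\<^sup>+y. F (euler_shift h B (Suc n) (x(n := y))) \<partial>gauss h) \<partial>gauss_seq h n)"
  proof (intro nn_integral_cong)
    fix x
    have "euler h B (x(n := y)) k = euler h B x k" if "k \<le> n" for k y
      using that by (intro euler_cong) auto
    \<comment> \<open>Along the shifted increments the partial sum inside \<open>a\<close> is the
      Euler value, so translation by \<open>h *\<^sub>R a\<close> is exactly the drift of the last
      Euler step.\<close>
    then have "(euler_shift h B n x)(n := y + h *\<^sub>R a (euler_shift h B n x)) = euler_shift h B (Suc n) (x(n := y))" for y
      unfolding a_def by (auto simp: sum_euler_shift fun_eq_iff) (auto simp: euler_shift_def restrict_def)
    then show "G (euler_shift h B n x) = (\<integral>\<^sup>+y. F (euler_shift h B (Suc n) (x(n := y))) \<partial>gauss h)"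
      unfolding G_def by simp
  qed
  also have "\<dots> = (\<integral>\<^sup>+z. F (euler_shift h B (Suc n) z) \<partial>gauss_seq h (Suc n))"
    by (intro nn_integral_gauss_Suc[symmetric] measurable_compose[OF euler_shift_measurable Suc.prems])
  finally show ?case .
qed

section \<open>Second moments and tails under Gaussian increments\<close>

lemma measure_gauss_UNIV [simp]: "emeasure (gauss s) UNIV = 1" "measure (gauss s) UNIV = 1"
  using gauss.emeasure_space_1[of s] gauss.prob_space[of s] by (simp_all only: space_gauss)

lemma emeasure_PiM_gauss_space:
  "emeasure (Pi\<^sub>M I (\<lambda>i. gauss (s i))) (space (Pi\<^sub>M I (\<lambda>i. gauss (s i)))) = 1"
  by (rule prob_space.emeasure_space_1[OF prob_space_PiM[OF prob_space_gauss]])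

text \<open>When the square is expanded, the cross term has mean zero.\<close>

lemma nn_integral_gauss_square_add:
  assumes "integrable (gauss h) p" "(\<integral>y. p y \<partial>gauss h) = 0"
    and "integrable (gauss h) (\<lambda>y. (p y)\<^sup>2)" "(\<integral>y. (p y)\<^sup>2 \<partial>gauss h) \<le> v"
  shows "(\<integral>\<^sup>+y. ennreal ((c + p y)\<^sup>2) \<partial>gauss h) \<le> ennreal (c\<^sup>2 + v)"
proof -
  have e: "(c + p y)\<^sup>2 = c\<^sup>2 + 2 * c * p y + (p y)\<^sup>2" for y by (simp add: power2_sum)
  have i: "integrable (gauss h) (\<lambda>y. (c + p y)\<^sup>2)" unfolding e using assms by simp
  have "(\<integral>\<^sup>+y. ennreal ((c + p y)\<^sup>2) \<partial>gauss h) = ennreal (\<integral>y. (c + p y)\<^sup>2 \<partial>gauss h)"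
    using i by (intro nn_integral_eq_integral) auto
  also have "(\<integral>y. (c + p y)\<^sup>2 \<partial>gauss h) = c\<^sup>2 + (\<integral>y. (p y)\<^sup>2 \<partial>gauss h)"
    unfolding e using assms gauss.prob_space by simp
  also have "ennreal (c\<^sup>2 + (\<integral>y. (p y)\<^sup>2 \<partial>gauss h)) \<le> ennreal (c\<^sup>2 + v)"
    using assms(4) by (intro ennreal_leI) simp
  finally show ?thesis .
qed

text \<open>Orthogonality of martingale differences, conditional expectation being integration over
  coordinate \<open>k\<close> alone. \<open>\<psi> k\<close> sees the increments up to
  \<open>k\<close>, its variance bound \<open>V k\<close> only those before \<open>k\<close>. The
  two instances are discrete stochastic integrals and centred quadratic forms of the
  increments.\<close>

lemma martingale_square_bound:
  fixes \<psi> V :: "nat \<Rightarrow> (nat \<Rightarrow> real^'d) \<Rightarrow> real"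
  assumes \<psi>_loc: "\<And>k x y. (\<And>j. j \<le> k \<Longrightarrow> x j = y j) \<Longrightarrow> \<psi> k x = \<psi> k y"
    and V_loc: "\<And>k x y. (\<And>j. j < k \<Longrightarrow> x j = y j) \<Longrightarrow> V k x = V k y"
    and \<psi>_m: "\<And>k n. k < n \<Longrightarrow> \<psi> k \<in> borel_measurable (borel_seq n)"
    and V_m: "\<And>k n. k \<le> n \<Longrightarrow> V k \<in> borel_measurable (borel_seq n)"
    and i1: "\<And>k x. integrable (gauss h) (\<lambda>y. \<psi> k (x(k := y)))" "\<And>k x. (\<integral>y. \<psi> k (x(k := y)) \<partial>gauss h) = 0"
    and i2: "\<And>k x. integrable (gauss h) (\<lambda>y. (\<psi> k (x(k := y)))\<^sup>2)" "\<And>k x. (\<integral>y. (\<psi> k (x(k := y)))\<^sup>2 \<partial>gauss h) \<le> V k x"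
  shows "(\<integral>\<^sup>+z. ennreal ((\<Sum>k<n. \<psi> k z)\<^sup>2) \<partial>gauss_seq h n)
    \<le> (\<integral>\<^sup>+z. ennreal (\<Sum>k<n. V k z) \<partial>gauss_seq h n)"
proof (induction n)
  case 0
  show ?case by simp
next
  case (Suc n)
  have V0: "0 \<le> V k x" for k x
    using order_trans[OF integral_nonneg_AE i2(2)[of k x]] by simp
  have S: "(\<Sum>k<Suc n. \<psi> k (x(n := y))) = (\<Sum>k<n. \<psi> k x) + \<psi> n (x(n := y))" for x y
    by (auto intro!: sum.cong \<psi>_loc)
  have SV: "(\<Sum>k<Suc n. V k (x(n := y))) = (\<Sum>k<n. V k x) + V n x" for x y
    by (auto intro!: sum.cong arg_cong2[where f="(+)"] V_loc)
  have mS: "(\<lambda>z. \<Sum>k<m. \<psi> k z) \<in> borel_measurable (borel_seq m)" for m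
    by (intro borel_measurable_sum \<psi>_m) simp
  have mV: "(\<lambda>z. \<Sum>k<m. V k z) \<in> borel_measurable (borel_seq m)" for m
    by (intro borel_measurable_sum V_m) simp
  note cs = measurable_cong_sets[OF sets_PiM_gauss refl]
  note mS2 = measurable_compose[OF borel_measurable_power[OF mS, of _ 2] measurable_ennreal]
  note mV2 = measurable_compose[OF mV measurable_ennreal]
  have "(\<integral>\<^sup>+z. ennreal ((\<Sum>k<Suc n. \<psi> k z)\<^sup>2) \<partial>gauss_seq h (Suc n))
    = (\<integral>\<^sup>+x. (\<integral>\<^sup>+y. ennreal (((\<Sum>k<n. \<psi> k x) + \<psi> n (x(n := y)))\<^sup>2) \<partial>gauss h) \<partial>gauss_seq h n)"
    by (subst nn_integral_gauss_Suc[OF mS2]) (simp only: S)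
  also have "\<dots> \<le> (\<integral>\<^sup>+x. ennreal ((\<Sum>k<n. \<psi> k x)\<^sup>2) + ennreal (V n x) \<partial>gauss_seq h n)"
    using nn_integral_gauss_square_add[OF i1 i2] V0
    by (intro nn_integral_mono) (simp add: ennreal_plus[symmetric] del: ennreal_plus)
  also have "\<dots> = (\<integral>\<^sup>+x. ennreal ((\<Sum>k<n. \<psi> k x)\<^sup>2) \<partial>gauss_seq h n) + (\<integral>\<^sup>+x. ennreal (V n x) \<partial>gauss_seq h n)"
    using mS2[of n] V_m[of n n] by (intro nn_integral_add) (simp_all only: cs, simp)
  also have "\<dots> \<le> (\<integral>\<^sup>+x. ennreal (\<Sum>k<n. V k x) \<partial>gauss_seq h n) + (\<integral>\<^sup>+x. ennreal (V n x) \<partial>gauss_seq h n)"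
    by (intro add_right_mono Suc.IH)
  also have "\<dots> = (\<integral>\<^sup>+x. ennreal (\<Sum>k<n. V k x) + ennreal (V n x) \<partial>gauss_seq h n)"
    using mV2[of n] V_m[of n n] by (intro nn_integral_add[symmetric]) (simp_all only: cs, simp)
  also have "\<dots> = (\<integral>\<^sup>+x. (\<integral>\<^sup>+y. ennreal (\<Sum>k<Suc n. V k (x(n := y))) \<partial>gauss h) \<partial>gauss_seq h n)"
    unfolding SV using V0 by (simp add: sum_nonneg)
  also have "\<dots> = (\<integral>\<^sup>+z. ennreal (\<Sum>k<Suc n. V k z) \<partial>gauss_seq h (Suc n))"
    by (intro nn_integral_gauss_Suc[symmetric] mV2)
  finally show ?case .
qed

text \<open>\<open>c_loc\<close> makes \<open>c\<close> predictable: \<open>c k\<close> is constant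
  while increment \<open>k\<close> is integrated, so the summands are centred.\<close>

lemma ito_isometry_bound:
  fixes c :: "nat \<Rightarrow> (nat \<Rightarrow> real^'d) \<Rightarrow> real^'d"
  assumes h: "h \<ge> 0" and c_loc: "\<And>k x y. (\<And>j. j < k \<Longrightarrow> x j = y j) \<Longrightarrow> c k x = c k y"
    and c_m: "\<And>k n. k \<le> n \<Longrightarrow> c k \<in> borel_measurable (borel_seq n)"
  shows "(\<integral>\<^sup>+z. ennreal ((\<Sum>k<n. c k z \<bullet> z k)\<^sup>2) \<partial>gauss_seq h n)
    \<le> (\<integral>\<^sup>+z. ennreal (\<Sum>k<n. h * (norm (c k z))\<^sup>2) \<partial>gauss_seq h n)"
proof (rule martingale_square_bound)
  have upd: "c k (x(k := y)) = c k x" for k x y by (rule c_loc) auto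
  show "integrable (gauss h) (\<lambda>y. c k (x(k := y)) \<bullet> (x(k := y)) k)"
    "(\<integral>y. c k (x(k := y)) \<bullet> (x(k := y)) k \<partial>gauss h) = 0"
    "integrable (gauss h) (\<lambda>y. (c k (x(k := y)) \<bullet> (x(k := y)) k)\<^sup>2)"
    "(\<integral>y. (c k (x(k := y)) \<bullet> (x(k := y)) k)\<^sup>2 \<partial>gauss h) \<le> h * (norm (c k x))\<^sup>2" for k x
    using gauss_integral_inner[of h "c k x"] gauss_integral_inner2[OF h, of "c k x"] by (simp_all add: upd)
  fix k n :: nat
  show "(\<lambda>z. c k z \<bullet> z k) \<in> borel_measurable (borel_seq n)" if "k < n"
  proof -
    have [measurable]: "c k \<in> borel_measurable (borel_seq n)"
      "(\<lambda>z. z k) \<in> borel_measurable (Pi\<^sub>M {..<n} (\<lambda>_. borel :: (real^'d) measure))" using that c_m by simp_all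
    show ?thesis by simp
  qed
  show "(\<lambda>z. h * (norm (c k z))\<^sup>2) \<in> borel_measurable (borel_seq n)" if "k \<le> n"
    using c_m[OF that] by simp
next
  fix k and x y :: "nat \<Rightarrow> real^'d"
  show "c k x \<bullet> x k = c k y \<bullet> y k" if "\<And>j. j \<le> k \<Longrightarrow> x j = y j"
    using that c_loc[of k x y] by simp
  show "h * (norm (c k x))\<^sup>2 = h * (norm (c k y))\<^sup>2" if "\<And>j. j < k \<Longrightarrow> x j = y j"
    using c_loc[OF that] by simp
qed

text \<open>The new increment is centred and independent of the past, so one step turns a bound v
  into (1 + hc)^2 v + hd, where d is the dimension. The stated expression dominates the solution of
  this recursion, and it is at most T d exp(2Tc) when \<open>k * h\<close> is at most T.\<close>

lemma euler_second_moment: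
  fixes B :: "nat \<Rightarrow> real^'d^'d"
  assumes h: "h \<ge> 0" and B: "\<And>k. norm (B k) \<le> c" and "k \<le> n"
  shows "(\<integral>\<^sup>+z. ennreal ((norm (euler h B z k))\<^sup>2) \<partial>gauss_seq h n)
    \<le> ennreal (real k * h * CARD('d) * (1 + h * c) ^ (2 * k))"
  using \<open>k \<le> n\<close>
proof (induction n arbitrary: k)
  case 0
  then show ?case by simp
next
  case (Suc n)
  have c: "c \<ge> 0" using B[of 0] norm_ge_zero order_trans by blast
  have m: "(\<lambda>z. ennreal ((norm (euler h B z k))\<^sup>2)) \<in> borel_measurable (borel_seq (Suc n))"
    using euler_measurable[OF Suc.prems, of h B] by simp
  have cong: "euler h B (x(n := y)) j = euler h B x j" if "j \<le> n" for x y j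
    using that by (intro euler_cong) auto
  note S = nn_integral_gauss_Suc[OF m, of h]
  show ?case
  proof (cases "k \<le> n")
    case True
    then show ?thesis using Suc.IH[OF True] unfolding S by (simp add: cong)
  next
    case False
    then have k: "k = Suc n" using Suc.prems by simp
    define u where "u x = euler h B x n + h *\<^sub>R (B n *v euler h B x n)" for x
    have ub: "(norm (u x))\<^sup>2 \<le> (1 + h * c)\<^sup>2 * (norm (euler h B x n))\<^sup>2" for x
    proof -
      have "norm (u x) \<le> norm (euler h B x n) + h * (norm (B n) * norm (euler h B x n))"
        unfolding u_def using h norm_matrix_vector_le[of "B n" "euler h B x n"]
        by (intro order_trans[OF norm_triangle_ineq] add_left_mono) (simp add: mult_left_mono)
      also have "\<dots> \<le> norm (euler h B x n) + h * (c * norm (euler h B x n))"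
        using h B[of n] by (intro add_left_mono mult_left_mono mult_right_mono) auto
      also have "\<dots> = (1 + h * c) * norm (euler h B x n)" by (simp add: algebra_simps)
      finally show ?thesis using power_mono[of "norm (u x)" "(1 + h * c) * norm (euler h B x n)" 2] by (simp add: power_mult_distrib)
    qed
    have inner: "(\<integral>\<^sup>+y. ennreal ((norm (u x + y))\<^sup>2) \<partial>gauss h) = ennreal ((norm (u x))\<^sup>2 + h * CARD('d))" for x
    proof -
      have e: "(norm (u x + y))\<^sup>2 = (norm (u x))\<^sup>2 + (2 *\<^sub>R u x) \<bullet> y + (norm y)\<^sup>2" for y
        by (simp add: power2_norm_eq_inner inner_add_left inner_add_right inner_commute)
      have "integrable (gauss h) (\<lambda>y. (norm (u x + y))\<^sup>2)"
        unfolding e by (intro Bochner_Integration.integrable_add gauss_integral_inner gauss_integral_norm2 h) simp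
      then have "(\<integral>\<^sup>+y. ennreal ((norm (u x + y))\<^sup>2) \<partial>gauss h) = ennreal (\<integral>y. (norm (u x + y))\<^sup>2 \<partial>gauss h)"
        by (intro nn_integral_eq_integral) auto
      also have "(\<integral>y. (norm (u x + y))\<^sup>2 \<partial>gauss h) = (norm (u x))\<^sup>2 + h * CARD('d)"
        unfolding e using gauss_integral_inner[of h "2 *\<^sub>R u x"] gauss_integral_norm2[OF h, where 'd='d] gauss.prob_space
        by (simp del: inner_scaleR_left)
      finally show ?thesis .
    qed
    have "(\<integral>\<^sup>+z. ennreal ((norm (euler h B z k))\<^sup>2) \<partial>gauss_seq h (Suc n))
      = (\<integral>\<^sup>+x. (\<integral>\<^sup>+y. ennreal ((norm (u x + y))\<^sup>2) \<partial>gauss h) \<partial>gauss_seq h n)"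
      unfolding S unfolding k by (simp add: cong u_def)
    also have "\<dots> \<le> (\<integral>\<^sup>+x. ennreal ((1 + h * c)\<^sup>2) * ennreal ((norm (euler h B x n))\<^sup>2) + ennreal (h * CARD('d)) \<partial>gauss_seq h n)"
      unfolding inner using h ub
      by (intro nn_integral_mono) (simp add: ennreal_plus[symmetric] ennreal_mult[symmetric] del: ennreal_plus)
    also have "\<dots> = ennreal ((1 + h * c)\<^sup>2) * (\<integral>\<^sup>+x. ennreal ((norm (euler h B x n))\<^sup>2) \<partial>gauss_seq h n) + ennreal (h * CARD('d))"
      using euler_measurable[of n n h B]
      by (subst nn_integral_add) (simp_all add: nn_integral_cmult measurable_cong_sets[OF sets_PiM_gauss refl] emeasure_PiM_gauss_space)
    also have "\<dots> \<le> ennreal ((1 + h * c)\<^sup>2) * ennreal (real n * h * CARD('d) * (1 + h * c) ^ (2 * n)) + ennreal (h * CARD('d))"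
      by (intro add_right_mono mult_left_mono Suc.IH) auto
    also have "\<dots> = ennreal ((1 + h * c)\<^sup>2 * (real n * h * CARD('d) * (1 + h * c) ^ (2 * n)) + h * CARD('d))"
      using h c by (simp add: ennreal_plus ennreal_mult)
    also have "\<dots> \<le> ennreal (real k * h * CARD('d) * (1 + h * c) ^ (2 * k))"
    proof (rule ennreal_leI)
      have "(1::real) \<le> (1 + h * c) ^ (2 * k)" using h c by (intro one_le_power) simp
      then have "h * CARD('d) * 1 \<le> h * CARD('d) * (1 + h * c) ^ (2 * k)" using h by (intro mult_left_mono) auto
      then show "(1 + h * c)\<^sup>2 * (real n * h * CARD('d) * (1 + h * c) ^ (2 * n)) + h * CARD('d) \<le> real k * h * CARD('d) * (1 + h * c) ^ (2 * k)"
        unfolding k by (simp add: algebra_simps power2_eq_square)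
    qed
    finally show ?thesis .
  qed
qed

text \<open>After the change of variables the left-hand side is the probability that the logarithm of the density,
  evaluated along the Euler scheme, exceeds \<^term>\<open>2 * L\<close>; its second moments are bounded.\<close>

lemma girsanov_tail_bound:
  fixes B :: "nat \<Rightarrow> real^'d^'d"
  assumes h: "h \<ge> 0" and B: "\<And>k. norm (B k) \<le> c" and T: "real n * h = T" and L: "L \<ge> 1"
  shows "(\<integral>\<^sup>+z. ennreal (girsanov h B n z) * indicator {z. girsanov h B n z > exp (2 * L)} z \<partial>gauss_seq h n)
    \<le> ennreal (2 * T * c\<^sup>2 * (T * CARD('d) * exp (2 * T * c)) / L)"
proof -
  let ?P = "gauss_seq h n :: (nat \<Rightarrow> real^'d) measure"
  note cs = measurable_cong_sets[OF sets_PiM_gauss refl]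
  have c: "c \<ge> 0" using B[of 0] norm_ge_zero order_trans by blast
  have T0: "T \<ge> 0" using T h by auto
  define S where "S z = (\<Sum>k<n. (B k *v euler h B z k) \<bullet> z k)" for z
  define R where "R z = (\<Sum>k<n. h * (norm (B k *v euler h B z k))\<^sup>2)" for z
  have R0: "R z \<ge> 0" for z unfolding R_def using h by (intro sum_nonneg) auto
  have gR: "girsanov h B n (euler_shift h B n z) = exp (S z + R z / 2)" for z
    unfolding girsanov_euler_shift S_def R_def by (simp add: sum.distrib sum_divide_distrib)
  have ev: "(\<lambda>z. B k *v euler h B z k) \<in> borel_measurable ?P" if "k \<le> n" for k
    using euler_measurable[OF that, of h B] by (simp add: cs)
  have Rm: "R \<in> borel_measurable ?P" unfolding R_def using ev
    by (intro borel_measurable_sum borel_measurable_times borel_measurable_power borel_measurable_norm) auto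
  have Sm: "S \<in> borel_measurable ?P" unfolding S_def using ev
    by (intro borel_measurable_sum borel_measurable_inner) (auto simp: cs)
  \<comment> \<open>A value above \<open>2 * L\<close> forces \<open>S\<close> or
    \<open>R / 2\<close> above \<open>L\<close>. Chebyshev serves the first case and Markov the
    second; \<open>L \<ge> 1\<close> allows the common factor \<open>1 / L\<close>.\<close>
  have ind: "indicator {z. girsanov h B n z > exp (2 * L)} (euler_shift h B n z) \<le> ennreal (1 / L) * (ennreal ((S z)\<^sup>2) + ennreal (R z))" for z
  proof (cases "S z + R z / 2 > 2 * L")
    case True
    then consider "S z > L" | "R z / 2 > L" by linarith
    then have "1 \<le> 1 / L * ((S z)\<^sup>2 + R z)"
    proof cases
      case 1
      then have "L * 1 \<le> S z * S z" using L by (intro mult_mono) auto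
      then show ?thesis using R0[of z] L by (simp add: power2_eq_square field_simps)
    next
      case 2
      then have "L \<le> (S z)\<^sup>2 + R z" using R0[of z] zero_le_power2[of "S z"] by linarith
      then show ?thesis using L by (simp add: field_simps)
    qed
    then show ?thesis using R0[of z] L
      by (simp add: ennreal_plus[symmetric] ennreal_mult[symmetric] ennreal_1[symmetric] indicator_def gR
            del: ennreal_plus ennreal_1)
  qed (simp add: gR)
  have Fm: "(\<lambda>z. indicator {z. girsanov h B n z > exp (2 * L)} z :: ennreal) \<in> borel_measurable (borel_seq n)"
    using girsanov_measurable[of h B n] by measurable
  have "(\<integral>\<^sup>+z. ennreal (R z) \<partial>?P) \<le> ennreal (T * c\<^sup>2 * (T * CARD('d) * exp (2 * T * c)))"
  proof -
    have "(\<integral>\<^sup>+z. ennreal (R z) \<partial>?P) \<le> (\<integral>\<^sup>+z. (\<Sum>k<n. ennreal (h * c\<^sup>2) * ennreal ((norm (euler h B z k))\<^sup>2)) \<partial>?P)"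
    proof (rule nn_integral_mono)
      fix z
      have "R z \<le> (\<Sum>k<n. h * c\<^sup>2 * (norm (euler h B z k))\<^sup>2)"
        unfolding R_def
      proof (rule sum_mono)
        fix k
        have "norm (B k *v euler h B z k) \<le> c * norm (euler h B z k)"
          using order_trans[OF norm_matrix_vector_le mult_right_mono[OF B]] by auto
        then have "(norm (B k *v euler h B z k))\<^sup>2 \<le> c\<^sup>2 * (norm (euler h B z k))\<^sup>2"
          using power_mono[of "norm (B k *v euler h B z k)" "c * norm (euler h B z k)" 2] by (simp add: power_mult_distrib)
        then show "h * (norm (B k *v euler h B z k))\<^sup>2 \<le> h * c\<^sup>2 * (norm (euler h B z k))\<^sup>2"
          using h by (simp add: mult_left_mono mult.assoc)
      qed
      then show "ennreal (R z) \<le> (\<Sum>k<n. ennreal (h * c\<^sup>2) * ennreal ((norm (euler h B z k))\<^sup>2))"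
        using h by (simp add: ennreal_mult[symmetric] sum_ennreal ennreal_leI)
    qed
    also have "\<dots> = (\<Sum>k<n. ennreal (h * c\<^sup>2) * (\<integral>\<^sup>+z. ennreal ((norm (euler h B z k))\<^sup>2) \<partial>?P))"
      using euler_measurable[of _ n h B]
      by (subst nn_integral_sum) (auto simp: cs intro!: sum.cong nn_integral_cmult)
    also have "\<dots> \<le> (\<Sum>k<n. ennreal (h * c\<^sup>2) * ennreal (T * CARD('d) * exp (2 * T * c)))"
    proof (intro sum_mono mult_left_mono)
      fix k assume k: "k \<in> {..<n}"
      have kh: "real k * h \<le> T" using k h T[symmetric] by (auto intro!: mult_right_mono)
      \<comment> \<open>By 1 + x \<le> exp x and \<open>kh\<close> the moment bound becomes uniform
        in the node and the number of steps.\<close>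
      have "(1 + h * c) ^ (2 * k) \<le> exp (h * c) ^ (2 * k)"
        using h c by (intro power_mono) auto
      also have "\<dots> = exp (2 * (real k * h) * c)" by (simp add: exp_of_nat_mult[symmetric] mult_ac)
      also have "\<dots> \<le> exp (2 * T * c)" using kh c by (simp add: mult_right_mono)
      finally have "real k * h * CARD('d) * (1 + h * c) ^ (2 * k) \<le> T * CARD('d) * exp (2 * T * c)"
        using kh h T0 c by (intro mult_mono) auto
      then show "(\<integral>\<^sup>+z. ennreal ((norm (euler h B z k))\<^sup>2) \<partial>?P) \<le> ennreal (T * CARD('d) * exp (2 * T * c))"
        using k by (intro order_trans[OF euler_second_moment[where B=B, OF h B] ennreal_leI]) auto
    qed simp
    also have "\<dots> = ennreal (real n * h * c\<^sup>2 * (T * CARD('d) * exp (2 * T * c)))"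
      using h T0 by (simp add: ennreal_mult[symmetric] ennreal_of_nat_eq_real_of_nat mult.assoc)
    finally show ?thesis unfolding T .
  qed
  moreover have "(\<integral>\<^sup>+z. ennreal ((S z)\<^sup>2) \<partial>?P) \<le> (\<integral>\<^sup>+z. ennreal (R z) \<partial>?P)"
    unfolding S_def R_def
  proof (rule ito_isometry_bound[OF h])
    show "B k *v euler h B x k = B k *v euler h B y k" if "\<And>j. j < k \<Longrightarrow> x j = y j" for k x y
      using euler_cong[of k x y h B, OF that] by simp
    show "(\<lambda>z. B k *v euler h B z k) \<in> borel_measurable (borel_seq n)" if "k \<le> n" for k n
      by (intro matrix_vector_measurable euler_measurable that)
  qed
  \<comment> \<open>By the isometry both moments obey one bound, hence the factor 2 in the
    constant.\<close>
  ultimately have SR: "(\<integral>\<^sup>+z. ennreal ((S z)\<^sup>2) \<partial>?P) + (\<integral>\<^sup>+z. ennreal (R z) \<partial>?P) \<le> ennreal (2 * T * c\<^sup>2 * (T * CARD('d) * exp (2 * T * c)))"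
  proof -
    let ?K = "T * c\<^sup>2 * (T * CARD('d) * exp (2 * T * c))"
    assume R: "(\<integral>\<^sup>+z. ennreal (R z) \<partial>?P) \<le> ennreal ?K"
      and S: "(\<integral>\<^sup>+z. ennreal ((S z)\<^sup>2) \<partial>?P) \<le> (\<integral>\<^sup>+z. ennreal (R z) \<partial>?P)"
    have "(\<integral>\<^sup>+z. ennreal ((S z)\<^sup>2) \<partial>?P) + (\<integral>\<^sup>+z. ennreal (R z) \<partial>?P) \<le> ennreal ?K + ennreal ?K"
      by (intro add_mono R order_trans[OF S R])
    also have "\<dots> = ennreal (?K + ?K)" using T0 by (intro ennreal_plus[symmetric]) auto
    finally show ?thesis by (simp add: algebra_simps)
  qed
  have "(\<integral>\<^sup>+z. ennreal (girsanov h B n z) * indicator {z. girsanov h B n z > exp (2 * L)} z \<partial>?P)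
    = (\<integral>\<^sup>+z. indicator {z. girsanov h B n z > exp (2 * L)} (euler_shift h B n z) \<partial>?P)"
    by (rule girsanov_change_of_variables[OF h Fm])
  also have "\<dots> \<le> (\<integral>\<^sup>+z. ennreal (1 / L) * (ennreal ((S z)\<^sup>2) + ennreal (R z)) \<partial>?P)"
    by (intro nn_integral_mono ind)
  also have "\<dots> = ennreal (1 / L) * ((\<integral>\<^sup>+z. ennreal ((S z)\<^sup>2) \<partial>?P) + (\<integral>\<^sup>+z. ennreal (R z) \<partial>?P))"
    using Sm Rm by (subst nn_integral_cmult) (auto simp: nn_integral_add)
  also have "\<dots> \<le> ennreal (1 / L) * ennreal (2 * T * c\<^sup>2 * (T * CARD('d) * exp (2 * T * c)))"
    by (intro mult_left_mono SR) simp
  also have "\<dots> = ennreal (2 * T * c\<^sup>2 * (T * CARD('d) * exp (2 * T * c)) / L)"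
    using T0 L by (simp add: ennreal_mult[symmetric])
  finally show ?thesis .
qed

subsection \<open>The path space and the linear integral equation\<close>

lemma clampT_mem: "T \<ge> 0 \<Longrightarrow> clampT T t \<in> {0..T}"
  by (simp add: clampT_def)

lemma clampT_id: "t \<in> {0..T} \<Longrightarrow> clampT T t = t"
  by (auto simp: clampT_def)

lemma continuous_on_clampT: "continuous_on S f \<Longrightarrow> continuous_on S (\<lambda>t. clampT T (f t))"
  unfolding clampT_def by (intro continuous_intros)

lemma WspD:
  assumes "w \<in> Wsp T"
  shows "continuous_on UNIV w" "w 0 = 0" "w (clampT T t) = w t"
  using assms by (auto simp: Wsp_def)

lemma Wsp_continuous_on: "w \<in> Wsp T \<Longrightarrow> continuous_on S w"
  using WspD(1) continuous_on_subset by blast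

lemma Wsp_lincomb:
  assumes "v \<in> Wsp T" "w \<in> Wsp T"
  shows "(\<lambda>t. a *\<^sub>R v t + b *\<^sub>R w t) \<in> Wsp T"
  using assms unfolding Wsp_def by (auto intro!: continuous_intros)

lemma Wsp_diff: "v \<in> Wsp T \<Longrightarrow> w \<in> Wsp T \<Longrightarrow> (\<lambda>t. v t - w t) \<in> Wsp T"
  using Wsp_lincomb[of v T w 1 "-1"] by simp

lemma Wsp_add: "v \<in> Wsp T \<Longrightarrow> w \<in> Wsp T \<Longrightarrow> (\<lambda>t. v t + w t) \<in> Wsp T"
  using Wsp_lincomb[of v T w 1 1] by simp

lemma norm_le_supn:
  assumes "continuous_on {0..T} w" "t \<in> {0..T}"
  shows "norm (w t) \<le> supn T w"
  unfolding supn_def using assms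
  by (intro cSUP_upper bounded_imp_bdd_above compact_imp_bounded compact_continuous_image continuous_on_norm) auto

lemma norm_le_supnM:
  assumes "continuous_on {0..T} chi" "t \<in> {0..T}"
  shows "norm (chi t) \<le> supnM T chi"
  unfolding supnM_def using assms
  by (intro cSUP_upper bounded_imp_bdd_above compact_imp_bounded compact_continuous_image continuous_on_norm) auto

lemma supn_le: "T \<ge> 0 \<Longrightarrow> (\<And>t. t \<in> {0..T} \<Longrightarrow> norm (w t) \<le> c) \<Longrightarrow> supn T w \<le> c"
  unfolding supn_def by (intro cSUP_least) auto

lemma norm_Wsp_le_supn: "T \<ge> 0 \<Longrightarrow> w \<in> Wsp T \<Longrightarrow> norm (w t) \<le> supn T w"
  using norm_le_supn[OF Wsp_continuous_on clampT_mem] WspD(3) by metis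

lemma bounded_bilinear_matrix_vector: "bounded_bilinear ((*v) :: real^'n^'m \<Rightarrow> real^'n \<Rightarrow> real^'m)"
proof
  show "\<exists>K. \<forall>A x. norm (A *v x :: real^'m) \<le> norm A * norm (x :: real^'n) * K"
    by (intro exI[of _ 1]) (simp add: norm_matrix_vector_le)
qed (simp_all add: matrix_vector_mult_add_rdistrib matrix_vector_right_distrib
      scaleR_matrix_vector_assoc[symmetric] matrix_vector_mult_scaleR)

lemmas continuous_on_matrix_vector [continuous_intros] =
  bounded_bilinear.continuous_on[OF bounded_bilinear_matrix_vector]

lemma Fchi_Wsp:
  assumes T: "T \<ge> 0" and chi: "continuous_on {0..T} chi" and y: "continuous_on {0..T} y"
  shows "Fchi T chi y \<in> Wsp T"
proof -
  have "continuous_on {0..T} (\<lambda>t. integral {0..t} (\<lambda>s. chi s *v y s))"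
    by (intro indefinite_integral_continuous_1 integrable_continuous_interval continuous_intros chi y)
  then have "continuous_on UNIV (\<lambda>t. integral {0..clampT T t} (\<lambda>s. chi s *v y s))"
    by (rule continuous_on_compose2) (use clampT_mem[OF T] in \<open>auto intro!: continuous_on_clampT continuous_intros\<close>)
  moreover have "clampT T (clampT T t) = clampT T t" for t using clampT_id clampT_mem[OF T] by blast
  ultimately show ?thesis using T by (auto simp: Wsp_def Fchi_def clampT_id intro!: continuous_on_minus)
qed

lemma norm_Fchi_le:
  assumes T: "T \<ge> 0" and chi: "continuous_on {0..T} chi" and y: "continuous_on {0..T} y"
    and M: "\<And>s. s \<in> {0..T} \<Longrightarrow> norm (y s) \<le> M"
  shows "norm (Fchi T chi y t) \<le> T * supnM T chi * M"
proof -
  have ct: "clampT T t \<in> {0..T}" using T by (rule clampT_mem)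
  have M0: "M \<ge> 0" using M[of 0] norm_ge_zero[of "y 0"] T by (meson atLeastAtMost_iff order_refl order_trans)
  have c0: "supnM T chi \<ge> 0" using norm_le_supnM[OF chi, of 0] norm_ge_zero[of "chi 0"] T
    by (meson atLeastAtMost_iff order_refl order_trans)
  have "norm (integral {0..clampT T t} (\<lambda>s. chi s *v y s)) \<le> supnM T chi * M * (clampT T t - 0)"
  proof (rule integral_bound)
    show "continuous_on {0..clampT T t} (\<lambda>s. chi s *v y s)"
      using ct by (intro continuous_intros continuous_on_subset[OF chi] continuous_on_subset[OF y]) auto
    show "norm (chi s *v y s) \<le> supnM T chi * M" if "s \<in> {0..clampT T t}" for s
      using that ct M norm_le_supnM[OF chi] c0
      by (auto intro!: order_trans[OF norm_matrix_vector_le] mult_mono)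
  qed (use ct in auto)
  also have "\<dots> \<le> supnM T chi * M * T" using ct c0 M0 by (intro mult_left_mono) auto
  finally show ?thesis by (simp add: Fchi_def mult_ac)
qed

lemma Fchi_lincomb:
  assumes T: "T \<ge> 0" and chi: "continuous_on {0..T} chi" and y: "continuous_on {0..T} y" "continuous_on {0..T} z"
  shows "Fchi T chi (\<lambda>t. a *\<^sub>R y t + b *\<^sub>R z t) t = a *\<^sub>R Fchi T chi y t + b *\<^sub>R Fchi T chi z t"
proof -
  have i: "(\<lambda>s. chi s *v u s) integrable_on {0..clampT T t}" if "continuous_on {0..T} u" for u
    using clampT_mem[OF T, of t]
    by (intro integrable_continuous_interval continuous_intros continuous_on_subset[OF chi] continuous_on_subset[OF that]) auto
  show ?thesis unfolding Fchi_def
    by (simp add: matrix_vector_right_distrib matrix_vector_mult_scaleR i y integral_add integrable_cmul)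
qed

text \<open>The term \<open>Fchi T chi u\<close> has norm at most q = \<open>T * supnM T chi\<close>
  times that of \<open>u\<close> and, as q < 1, is absorbed on the left. With \<open>w\<close> zero
  this yields uniqueness; in general it bounds the inverse.\<close>

lemma Wsp_resolvent_bound:
  assumes T: "T > 0" and chi: "continuous_on {0..T} chi" and q: "T * supnM T chi < 1"
    and u: "u \<in> Wsp T" and eq: "\<And>t. u t + Fchi T chi u t = w t" and w: "w \<in> Wsp T"
  shows "supn T u \<le> 1 / (1 - T * supnM T chi) * supn T w"
proof -
  have "supn T u \<le> supn T w + T * supnM T chi * supn T u"
  proof (rule supn_le)
    fix t
    have "u t = w t - Fchi T chi u t" using eq[of t] by (simp add: algebra_simps)
    then have "norm (u t) \<le> norm (w t) + norm (Fchi T chi u t)" by (simp add: norm_triangle_ineq4)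
    also have "\<dots> \<le> supn T w + T * supnM T chi * supn T u"
      using T chi u w by (intro add_mono norm_Fchi_le norm_Wsp_le_supn) (auto intro: Wsp_continuous_on)
    finally show "norm (u t) \<le> supn T w + T * supnM T chi * supn T u" .
  qed (use T in simp)
  then have "(1 - T * supnM T chi) * supn T u \<le> supn T w" by (simp add: algebra_simps)
  then show ?thesis using q by (simp add: field_simps)
qed

text \<open>Banach's fixed point theorem for y = w - F(y). Paths that are constant outside the
  interval are bounded continuous functions on the line, which form a complete type; the map sends
  every such function into \<open>Wsp T\<close>, so its fixed point is a path.\<close>

lemma Wsp_resolvent_exists:
  fixes chi :: "real \<Rightarrow> real^'d^'d"
  assumes T: "T > 0" and chi: "continuous_on {0..T} chi" and q: "T * supnM T chi < 1" and w: "w \<in> Wsp T"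
  shows "\<exists>!y. y \<in> Wsp T \<and> (\<lambda>t. y t + Fchi T chi y t) = w"
proof -
  have q0: "0 \<le> T * supnM T chi"
    using order_trans[OF norm_ge_zero norm_le_supnM[OF chi, of 0]] T by simp
  have bc: "v \<in> bcontfun" if "v \<in> Wsp T" for v :: "real \<Rightarrow> real^'d"
    using norm_Wsp_le_supn[OF _ that] T WspD(1)[OF that]
    by (auto simp: bcontfun_def bounded_iff)
  define \<Phi> where "\<Phi> y = Bcontfun (\<lambda>t. w t - Fchi T chi (apply_bcontfun y) t)" for y :: "real \<Rightarrow>\<^sub>C (real^'d)"
  have cy: "continuous_on S (apply_bcontfun y)" for y :: "real \<Rightarrow>\<^sub>C (real^'d)" and S
    by (rule continuous_on_apply_bcontfun)
  have mem: "(\<lambda>t. w t - Fchi T chi (apply_bcontfun y) t) \<in> Wsp T" for y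
    using T by (intro Wsp_diff w Fchi_Wsp chi cy) simp
  have ap: "apply_bcontfun (\<Phi> y) t = w t - Fchi T chi (apply_bcontfun y) t" for y t
    unfolding \<Phi>_def using Bcontfun_inverse[OF bc[OF mem[of y]]] by simp
  have "\<exists>!y. \<Phi> y = y"
  proof (rule banach_fix_type[OF q0 q], intro allI)
    fix y z :: "real \<Rightarrow>\<^sub>C (real^'d)"
    show "dist (\<Phi> y) (\<Phi> z) \<le> T * supnM T chi * dist y z"
    proof (rule dist_bound)
      fix t
      have "Fchi T chi (\<lambda>t. 1 *\<^sub>R apply_bcontfun y t + (-1) *\<^sub>R apply_bcontfun z t) t = 1 *\<^sub>R Fchi T chi y t + (-1) *\<^sub>R Fchi T chi z t"
        using T by (intro Fchi_lincomb chi cy) simp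
      then have "dist (apply_bcontfun (\<Phi> y) t) (apply_bcontfun (\<Phi> z) t) = norm (Fchi T chi (\<lambda>t. apply_bcontfun y t - apply_bcontfun z t) t)"
        unfolding ap by (simp add: dist_norm norm_minus_commute)
      also have "\<dots> \<le> T * supnM T chi * dist y z"
        using T by (intro norm_Fchi_le chi continuous_intros cy) (auto simp: dist_norm[symmetric] dist_bounded)
      finally show "dist (apply_bcontfun (\<Phi> y) t) (apply_bcontfun (\<Phi> z) t) \<le> T * supnM T chi * dist y z" .
    qed
  qed
  then obtain y where y: "\<Phi> y = y" by blast
  have e: "apply_bcontfun y t = w t - Fchi T chi (apply_bcontfun y) t" for t using ap[of y t] y by simp
  show ?thesis
  proof (rule ex1I[of _ "apply_bcontfun y"])
    have "apply_bcontfun y = (\<lambda>t. w t - Fchi T chi (apply_bcontfun y) t)" using e by blast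
    with mem[of y] have "apply_bcontfun y \<in> Wsp T" by (rule ssubst[where P="\<lambda>v. v \<in> Wsp T", rotated])
    then show ym: "apply_bcontfun y \<in> Wsp T \<and> (\<lambda>t. apply_bcontfun y t + Fchi T chi (apply_bcontfun y) t) = w"
      using ap[of y] y by (auto simp: fun_eq_iff)
    fix v assume v: "v \<in> Wsp T \<and> (\<lambda>t. v t + Fchi T chi v t) = w"
    define u where "u t = v t - apply_bcontfun y t" for t
    have uW: "u \<in> Wsp T" unfolding u_def using v ym by (intro Wsp_diff) auto
    have "Fchi T chi (\<lambda>t. 1 *\<^sub>R v t + (-1) *\<^sub>R apply_bcontfun y t) t = 1 *\<^sub>R Fchi T chi v t + (-1) *\<^sub>R Fchi T chi y t" for t
      using T v by (intro Fchi_lincomb chi cy Wsp_continuous_on[where w=v]) auto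
    then have "u t + Fchi T chi u t = (v t + Fchi T chi v t) - (apply_bcontfun y t + Fchi T chi (apply_bcontfun y) t)" for t
      unfolding u_def by simp
    then have "u t + Fchi T chi u t = 0" for t
      using fun_cong[OF conjunct2[OF v], of t] fun_cong[OF conjunct2[OF ym], of t] by simp
    moreover have "(\<lambda>t. 0) \<in> Wsp T" by (simp add: Wsp_def)
    ultimately have "supn T u \<le> 1 / (1 - T * supnM T chi) * supn T (\<lambda>t. 0 :: real^'d)"
      by (intro Wsp_resolvent_bound[OF T chi q uW]) auto
    also have "supn T (\<lambda>t. 0 :: real^'d) = 0" using T unfolding supn_def by simp
    finally have "supn T u \<le> 0" by simp
    then have "norm (u t) \<le> 0" for t by (rule order_trans[OF norm_Wsp_le_supn[OF less_imp_le[OF T] uW]])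
    then show "v = apply_bcontfun y" by (simp add: u_def fun_eq_iff)
  qed
qed

lemma Fchi_inverse_exists:
  fixes chi :: "real \<Rightarrow> real^'d^'d"
  assumes T: "T > 0" and chi: "continuous_on {0..T} chi" and q: "T * supnM T chi < 1"
  shows "\<exists>G. (\<forall>w\<in>Wsp T. (\<lambda>t. w t + Fchi T chi w t) \<in> Wsp T)
          \<and> (\<forall>w\<in>Wsp T. G w \<in> Wsp T)
          \<and> (\<forall>w\<in>Wsp T. G (\<lambda>t. w t + Fchi T chi w t) = w)
          \<and> (\<forall>w\<in>Wsp T. (\<lambda>t. G w t + Fchi T chi (G w) t) = w)
          \<and> (\<forall>v\<in>Wsp T. \<forall>w\<in>Wsp T. \<forall>a b::real.
                G (\<lambda>t. a *\<^sub>R v t + b *\<^sub>R w t) = (\<lambda>t. a *\<^sub>R G v t + b *\<^sub>R G w t))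
          \<and> (\<exists>C. \<forall>w\<in>Wsp T. supn T (G w) \<le> C * supn T w)"
proof -
  define G where "G w = (THE y. y \<in> Wsp T \<and> (\<lambda>t. y t + Fchi T chi y t) = w)" for w :: "real \<Rightarrow> real^'d"
  have G: "G w \<in> Wsp T \<and> (\<lambda>t. G w t + Fchi T chi (G w) t) = w" if "w \<in> Wsp T" for w
    unfolding G_def by (rule theI'[OF Wsp_resolvent_exists[OF T chi q that]])
  have GI: "G w = y" if "y \<in> Wsp T" "(\<lambda>t. y t + Fchi T chi y t) = w" "w \<in> Wsp T" for y w
    unfolding G_def using that by (intro the1_equality[OF Wsp_resolvent_exists[OF T chi q]]) auto
  have F: "(\<lambda>t. w t + Fchi T chi w t) \<in> Wsp T" if "w \<in> Wsp T" for w
    using T that by (intro Wsp_add Fchi_Wsp chi Wsp_continuous_on[OF that]) auto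
  have lin: "G (\<lambda>t. a *\<^sub>R v t + b *\<^sub>R w t) = (\<lambda>t. a *\<^sub>R G v t + b *\<^sub>R G w t)" if v: "v \<in> Wsp T" and w: "w \<in> Wsp T" for v w and a b :: real
  proof (rule GI)
    have "Fchi T chi (\<lambda>t. a *\<^sub>R G v t + b *\<^sub>R G w t) t = a *\<^sub>R Fchi T chi (G v) t + b *\<^sub>R Fchi T chi (G w) t" for t
      using T G[OF v] G[OF w] by (intro Fchi_lincomb chi Wsp_continuous_on) auto
    moreover have "v t = G v t + Fchi T chi (G v) t" "w t = G w t + Fchi T chi (G w) t" for t
      using G[OF v] G[OF w] by (auto simp: fun_eq_iff)
    ultimately show "(\<lambda>t. a *\<^sub>R G v t + b *\<^sub>R G w t + Fchi T chi (\<lambda>t. a *\<^sub>R G v t + b *\<^sub>R G w t) t) = (\<lambda>t. a *\<^sub>R v t + b *\<^sub>R w t)"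
      by (auto simp: fun_eq_iff scaleR_add_right)
  qed (use G v w in \<open>auto intro!: Wsp_lincomb\<close>)
  have bd: "supn T (G w) \<le> 1 / (1 - T * supnM T chi) * supn T w" if "w \<in> Wsp T" for w
    using G[OF that] by (intro Wsp_resolvent_bound[OF T chi q _ _ that]) (auto simp: fun_eq_iff)
  show ?thesis
    using F G GI lin bd by (intro exI[of _ G] conjI) (blast | rule exI ballI)+
qed

section \<open>Grids, polygonal paths and the Euler scheme\<close>

lemma mult_div_mono: "T > 0 \<Longrightarrow> j \<le> k \<Longrightarrow> real j * T / real n \<le> real k * T / real n"
  by (intro divide_right_mono mult_right_mono) auto

lemma node_in_interval: "T > 0 \<Longrightarrow> k \<le> n \<Longrightarrow> real k * T / real n \<in> {0..T}"
  \<comment> \<open>At \<open>n = 0\<close> division by zero sends the node to 0.\<close>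
  by (cases "n = 0") (auto simp: field_simps)

text \<open>By uniform continuity each cell contributes at most \<open>e / T\<close> times its
  length, so one mesh serves all partial sums. The Euler estimate needs the bound at every
  node.\<close>

lemma riemann_sum_uniform:
  fixes g :: "real \<Rightarrow> 'b::euclidean_space"
  assumes T: "T > 0" and g: "continuous_on {0..T} g" and e: "e > 0"
  shows "\<forall>\<^sub>F n in sequentially. \<forall>k\<le>n. norm ((T / real n) *\<^sub>R (\<Sum>j<k. g (real j * T / real n)) - integral {0..real k * T / real n} g) \<le> e"
proof -
  have "uniformly_continuous_on {0..T} g" by (rule compact_uniformly_continuous[OF g]) simp
  then obtain d where d: "d > 0" "\<And>s t. s \<in> {0..T} \<Longrightarrow> t \<in> {0..T} \<Longrightarrow> dist t s < d \<Longrightarrow> dist (g t) (g s) < e / T"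
    unfolding uniformly_continuous_on_def using e T by (metis divide_pos_pos)
  have "(\<lambda>n. T / real n) \<longlonglongrightarrow> 0" by (rule lim_const_over_n)
  then have "\<forall>\<^sub>F n in sequentially. T / real n < d" using d(1) by (rule order_tendstoD)
  with eventually_gt_at_top[of 0] show ?thesis
  proof eventually_elim
    case (elim n)
    let ?h = "T / real n"
    have *: "norm (?h *\<^sub>R (\<Sum>j<k. g (real j * T / real n)) - integral {0..real k * T / real n} g) \<le> real k * ?h * (e / T)" if "k \<le> n" for k
      using that
    proof (induction k)
      case (Suc k)
      let ?a = "real k * T / real n" and ?b = "real (Suc k) * T / real n"
      have ab: "?a \<in> {0..T}" "?b \<in> {0..T}" "?a \<le> ?b"
        by (rule node_in_interval[OF T], use Suc.prems in simp)+ (rule mult_div_mono[OF T], simp)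
      have ba: "?b - ?a = ?h" by (simp add: diff_divide_distrib[symmetric] algebra_simps)
      have gi: "g integrable_on {0..?b}" using ab
        by (intro integrable_continuous_interval continuous_on_subset[OF g]) auto
      have gc: "continuous_on {?a..?b} g" using ab by (intro continuous_on_subset[OF g]) auto
      have ic: "integral {0..?b} g = integral {0..?a} g + integral {?a..?b} g"
        using ab gi by (intro Henstock_Kurzweil_Integration.integral_combine[symmetric]) auto
      have "norm (integral {?a..?b} (\<lambda>s. g ?a - g s)) \<le> e / T * (?b - ?a)"
      proof (rule integral_bound[OF ab(3)])
        show "norm (g ?a - g s) \<le> e / T" if s: "s \<in> {?a..?b}" for s
        proof -
          have "dist ?a s < d" using s ba elim by (auto simp: dist_real_def)
          moreover have "s \<in> {0..T}" using s ab by auto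
          ultimately show "norm (g ?a - g s) \<le> e / T" using d(2)[of s ?a] ab by (simp add: dist_norm)
        qed
      qed (intro continuous_intros gc)
      moreover have "integral {?a..?b} (\<lambda>s. g ?a - g s) = ?h *\<^sub>R g ?a - integral {?a..?b} g"
        using ab ba by (subst integral_diff) (auto intro!: integrable_continuous_interval gc simp del: of_nat_Suc)
      ultimately have st: "norm (?h *\<^sub>R g ?a - integral {?a..?b} g) \<le> e / T * ?h" unfolding ba by metis
      have "?h *\<^sub>R (\<Sum>j<Suc k. g (real j * T / real n)) - integral {0..?b} g
        = (?h *\<^sub>R (\<Sum>j<k. g (real j * T / real n)) - integral {0..?a} g) + (?h *\<^sub>R g ?a - integral {?a..?b} g)"
        unfolding ic by (simp add: scaleR_add_right del: of_nat_Suc)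
      also have "norm \<dots> \<le> real k * ?h * (e / T) + e / T * ?h"
        using Suc by (intro order_trans[OF norm_triangle_ineq] add_mono st) auto
      also have "\<dots> = real (Suc k) * ?h * (e / T)" by (simp add: algebra_simps add_divide_distrib)
      finally show ?case .
    qed simp
    show ?case
    proof (intro allI impI)
      fix k assume k: "k \<le> n"
      have "real k * ?h * (e / T) = real k / real n * e" using T by simp
      also have "\<dots> \<le> 1 * e" using k elim e by (intro mult_right_mono) auto
      finally show "norm (?h *\<^sub>R (\<Sum>j<k. g (real j * T / real n)) - integral {0..real k * T / real n} g) \<le> e"
        using *[OF k] by simp
    qed
  qed
qed


text \<open>The restriction to \<open>{..<n}\<close> makes the sequence a point of the product space
  \<open>borel_seq n\<close>.\<close>

definition incs :: "real \<Rightarrow> nat \<Rightarrow> (real \<Rightarrow> real^'d) \<Rightarrow> nat \<Rightarrow> real^'d" where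
  "incs T n w = (\<lambda>k\<in>{..<n}. w (real (Suc k) * T / real n) - w (real k * T / real n))"

lemma sum_incs: "w 0 = 0 \<Longrightarrow> k \<le> n \<Longrightarrow> (\<Sum>j<k. incs T n w j) = w (real k * T / real n)"
  by (induction k) (simp_all add: incs_def del: of_nat_Suc)

text \<open>The clamped factor is the fraction of cell \<open>k\<close> that has been traversed at
  time \<open>t\<close>, being 0 before and 1 after it. The sum is therefore the polygonal path with
  increments \<open>z\<close>, constant outside the interval as \<open>Wsp\<close> demands.\<close>

definition interp :: "real \<Rightarrow> nat \<Rightarrow> (nat \<Rightarrow> real^'d) \<Rightarrow> real \<Rightarrow> real^'d" where
  "interp T n z t = (\<Sum>k<n. clampT 1 (t * real n / T - real k) *\<^sub>R z k)"

lemma interp_Wsp: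
  assumes T: "T > 0"
  shows "interp T n z \<in> Wsp T"
proof -
  have c: "continuous_on UNIV (interp T n z)"
    unfolding interp_def using T by (intro continuous_intros continuous_on_clampT) auto
  have z0: "interp T n z 0 = 0" unfolding interp_def by (simp add: clampT_def)
  have cl: "clampT 1 (t * real n / T - real k) = clampT 1 (clampT T t * real n / T - real k)" if k: "k < n" for k t
  proof -
    consider "t < 0" | "t > T" | "t \<in> {0..T}" by fastforce
    then show ?thesis
    proof cases
      case 1
      then have "t * real n / T \<le> 0" using T by (simp add: divide_nonpos_pos mult_nonpos_nonneg)
      moreover have "clampT T t = 0" using 1 T by (simp add: clampT_def)
      ultimately show ?thesis by (simp add: clampT_def)
    next
      case 2
      have "real n \<le> t * real n / T" using 2 T by (simp add: field_simps mult_right_mono)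
      moreover have "clampT T t = T" using 2 T by (simp add: clampT_def)
      moreover have "real k + 1 \<le> real n" using k by simp
      ultimately show ?thesis using T by (simp add: clampT_def)
    qed (simp add: clampT_id)
  qed
  have "interp T n z t = interp T n z (clampT T t)" for t
    unfolding interp_def by (intro sum.cong[OF refl] arg_cong2[where f=scaleR] cl) auto
  with c z0 show ?thesis unfolding Wsp_def by blast
qed

lemma interp_convex:
  assumes T: "T > 0" and n: "n > 0" and t: "t \<in> {0..T}"
  obtains k \<alpha> where "k < n" "0 \<le> \<alpha>" "\<alpha> \<le> 1" "real k * T / real n \<le> t" "t \<le> real (Suc k) * T / real n"
    "\<And>z :: nat \<Rightarrow> real^'d. interp T n z t = (1 - \<alpha>) *\<^sub>R (\<Sum>j<k. z j) + \<alpha> *\<^sub>R (\<Sum>j<Suc k. z j)"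
proof -
  define x where "x = t * real n / T"
  have x: "0 \<le> x" "x \<le> real n" using t T by (auto simp: x_def field_simps mult_right_mono)
  have "\<exists>k<n. real k \<le> x \<and> x \<le> real (Suc k)"
  proof (cases "x = real n")
    case True
    \<comment> \<open>The right end point is assigned to the last cell; elsewhere the floor of
      \<open>x\<close> is the cell.\<close>
    then show ?thesis using n by (intro exI[of _ "n - 1"]) auto
  next
    case False
    then show ?thesis using x by (intro exI[of _ "nat \<lfloor>x\<rfloor>"]) (auto, linarith+)
  qed
  then obtain k where k: "k < n" "real k \<le> x" "x \<le> real (Suc k)" by blast
  have tx: "t = x * T / real n" using T n by (simp add: x_def)
  show ?thesis
  proof
    show "k < n" by fact
    show "0 \<le> x - real k" "x - real k \<le> 1" using k by auto
    show "real k * T / real n \<le> t" "t \<le> real (Suc k) * T / real n" unfolding tx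
      using k T by (auto intro!: divide_right_mono mult_right_mono simp del: of_nat_Suc)
    fix z :: "nat \<Rightarrow> real^'d"
    have "interp T n z t = (\<Sum>j<n. (if j < k then z j else if j = k then (x - real k) *\<^sub>R z j else 0))"
      unfolding interp_def x_def[symmetric]
    proof (rule sum.cong[OF refl])
      fix j assume "j \<in> {..<n}"
      have "real j + 1 \<le> real k" if "j < k" using that by simp
      moreover have "real k + 1 \<le> real j" if "k < j" using that by simp
      ultimately show "clampT 1 (x - real j) *\<^sub>R z j = (if j < k then z j else if j = k then (x - real k) *\<^sub>R z j else 0)"
        using k by (auto simp: clampT_def max_def min_def)
    qed
    also have "\<dots> = (\<Sum>j<Suc k. (if j < k then z j else if j = k then (x - real k) *\<^sub>R z j else 0))"
      using k by (intro sum.mono_neutral_right) auto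
    also have "\<dots> = (\<Sum>j<k. z j) + (x - real k) *\<^sub>R z k" by simp
    also have "\<dots> = (1 - (x - real k)) *\<^sub>R (\<Sum>j<k. z j) + (x - real k) *\<^sub>R (\<Sum>j<Suc k. z j)"
      by (simp add: scaleR_add_right scaleR_diff_left)
    finally show "interp T n z t = (1 - (x - real k)) *\<^sub>R (\<Sum>j<k. z j) + (x - real k) *\<^sub>R (\<Sum>j<Suc k. z j)" .
  qed
qed

lemma norm_convex_comb_le:
  fixes a b v :: "'b::real_normed_vector"
  assumes "0 \<le> \<alpha>" "\<alpha> \<le> 1" "norm (a - v) \<le> e" "norm (b - v) \<le> e"
  shows "norm ((1 - \<alpha>) *\<^sub>R a + \<alpha> *\<^sub>R b - v) \<le> e"
proof -
  have "(1 - \<alpha>) *\<^sub>R a + \<alpha> *\<^sub>R b - v = (1 - \<alpha>) *\<^sub>R (a - v) + \<alpha> *\<^sub>R (b - v)"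
    by (simp add: algebra_simps)
  also have "norm \<dots> \<le> (1 - \<alpha>) * norm (a - v) + \<alpha> * norm (b - v)"
    using assms by (intro order_trans[OF norm_triangle_ineq]) simp
  also have "\<dots> \<le> (1 - \<alpha>) * e + \<alpha> * e" using assms by (intro add_mono mult_left_mono) auto
  finally show ?thesis by (simp add: algebra_simps)
qed

lemma interp_diff: "interp T n z t - interp T n z' t = interp T n (\<lambda>k. z k - z' k) t"
  by (simp add: interp_def scaleR_diff_right sum_subtractf)

text \<open>In each cell both polygonal paths are convex combinations of their node values with the
  same weights, so the nodes decide.\<close>

lemma norm_interp_diff_le:
  assumes "T > 0" "n > 0" "t \<in> {0..T}" and e: "\<And>k. k \<le> n \<Longrightarrow> norm ((\<Sum>j<k. z j) - (\<Sum>j<k. z' j)) \<le> e"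
  shows "norm (interp T n z t - interp T n z' t) \<le> e"
proof -
  obtain k \<alpha> where "k < n" "0 \<le> \<alpha>" "\<alpha> \<le> 1" and eq: "\<And>z :: nat \<Rightarrow> real^'a. interp T n z t = (1 - \<alpha>) *\<^sub>R (\<Sum>j<k. z j) + \<alpha> *\<^sub>R (\<Sum>j<Suc k. z j)"
    using interp_convex[OF assms(1-3)] by metis
  then have "norm ((1 - \<alpha>) *\<^sub>R (\<Sum>j<k. z j - z' j) + \<alpha> *\<^sub>R (\<Sum>j<Suc k. z j - z' j) - 0) \<le> e"
    using e[of k] e[of "Suc k"] by (intro norm_convex_comb_le) (auto simp: sum_subtractf)
  then show ?thesis unfolding interp_diff eq[of "\<lambda>k. z k - z' k"] by simp
qed

lemma interp_incs_uniform:
  assumes T: "T > 0" and u: "u \<in> Wsp T" and e: "e > 0"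
  shows "\<forall>\<^sub>F n in sequentially. \<forall>t\<in>{0..T}. norm (interp T n (incs T n u) t - u t) \<le> e"
proof -
  have "uniformly_continuous_on {0..T} u"
    by (intro compact_uniformly_continuous Wsp_continuous_on[OF u]) simp
  then obtain d where d: "d > 0" "\<And>s t. s \<in> {0..T} \<Longrightarrow> t \<in> {0..T} \<Longrightarrow> dist t s < d \<Longrightarrow> dist (u t) (u s) < e"
    unfolding uniformly_continuous_on_def using e by metis
  have "(\<lambda>n. T / real n) \<longlonglongrightarrow> 0" by (rule lim_const_over_n)
  then have "\<forall>\<^sub>F n in sequentially. T / real n < d" using d(1) by (rule order_tendstoD)
  with eventually_gt_at_top[of 0] show ?thesis
  proof eventually_elim
    case (elim n)
    show ?case
    proof
      fix t assume t: "t \<in> {0..T}"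
      obtain k \<alpha> where k: "k < n" "0 \<le> \<alpha>" "\<alpha> \<le> 1" and kt: "real k * T / real n \<le> t" "t \<le> real (Suc k) * T / real n"
        and eq: "\<And>z :: nat \<Rightarrow> real^'a. interp T n z t = (1 - \<alpha>) *\<^sub>R (\<Sum>j<k. z j) + \<alpha> *\<^sub>R (\<Sum>j<Suc k. z j)"
        using interp_convex[OF T elim(1) t] by metis
      have h: "real (Suc k) * T / real n - real k * T / real n = T / real n"
        by (simp add: diff_divide_distrib[symmetric] algebra_simps)
      have "dist (real k * T / real n) t < d" "dist (real (Suc k) * T / real n) t < d"
        using kt h elim(2) by (auto simp: dist_real_def simp del: of_nat_Suc)
      moreover have "real k * T / real n \<in> {0..T}" "real (Suc k) * T / real n \<in> {0..T}"
        using k by (auto intro!: node_in_interval[OF T] simp del: of_nat_Suc atLeastAtMost_iff)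
      ultimately have "norm (u (real k * T / real n) - u t) \<le> e" "norm (u (real (Suc k) * T / real n) - u t) \<le> e"
        using d(2)[OF t] by (auto simp: dist_norm intro!: less_imp_le simp del: of_nat_Suc atLeastAtMost_iff)
      then show "norm (interp T n (incs T n u) t - u t) \<le> e"
        unfolding eq using k WspD(2)[OF u]
        by (intro norm_convex_comb_le) (auto simp: sum_incs simp del: of_nat_Suc sum.lessThan_Suc)
    qed
  qed
qed

text \<open>The recursion in summed form, a discrete version of y = w + int chi y from which the
  integral equation can be subtracted.\<close>

lemma euler_incs:
  assumes "w 0 = 0" "k \<le> n"
  shows "euler h B (incs T n w) k = w (real k * T / real n) + h *\<^sub>R (\<Sum>j<k. B j *v euler h B (incs T n w) j)"
  using assms(2)
proof (induction k)
  case (Suc k)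
  have "incs T n w k = w (real (Suc k) * T / real n) - w (real k * T / real n)"
    using Suc.prems by (simp add: incs_def del: of_nat_Suc)
  then show ?case using Suc by (simp add: scaleR_add_right del: of_nat_Suc)
qed (use assms in simp)

text \<open>The largest node error \<open>M\<close> is at most q M plus a Riemann sum error, with q
  = \<open>T * supnM T chi\<close>, because the drift sum runs over at most \<open>n\<close> cells
  of length \<open>T / n\<close>. As q < 1, the first term is absorbed. The argument concerns a
  single path.\<close>

lemma euler_uniform:
  fixes chi :: "real \<Rightarrow> real^'d^'d"
  assumes T: "T > 0" and chi: "continuous_on {0..T} chi" and q: "T * supnM T chi < 1"
    and w: "w \<in> Wsp T" and y: "y \<in> Wsp T" and eq: "\<And>t. y t + Fchi T chi y t = w t" and e: "e > 0"
  shows "\<forall>\<^sub>F n in sequentially. supn T (interp T n (euler_shift (T / real n) (\<lambda>k. chi (real k * T / real n)) n (incs T n w)) - y) \<le> e"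
proof -
  let ?q = "T * supnM T chi"
  have c0: "0 \<le> supnM T chi" using order_trans[OF norm_ge_zero norm_le_supnM[OF chi, of 0]] T by simp
  have gc: "continuous_on {0..T} (\<lambda>s. chi s *v y s)" by (intro continuous_intros chi Wsp_continuous_on[OF y])
  \<comment> \<open>The factor \<open>1 - ?q\<close> is chosen so that absorption leaves
    \<open>M \<le> e / 2\<close>; the other half is for the interpolation of \<open>y\<close>
    between the nodes.\<close>
  have e2: "e / 2 * (1 - ?q) > 0" "e / 2 > 0" using e q by auto
  from eventually_gt_at_top[of 0] riemann_sum_uniform[OF T gc e2(1)] interp_incs_uniform[OF T y e2(2)]
  show ?thesis
  proof eventually_elim
    case (elim n)
    let ?h = "T / real n" and ?B = "\<lambda>k. chi (real k * T / real n)"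
    let ?z = "incs T n w"
    define E where "E k = norm (euler ?h ?B ?z k - y (real k * T / real n))" for k
    define M where "M = Max (E ` {..n})"
    have EM: "E k \<le> M" if "k \<le> n" for k unfolding M_def using that by (intro Max_ge) auto
    have M0: "M \<ge> 0" using EM[of 0] norm_ge_zero order_trans unfolding E_def by blast
    have Bn: "norm (?B j) \<le> supnM T chi" if "j \<le> n" for j
      using norm_le_supnM[OF chi node_in_interval[OF T that]] .
    have "E k \<le> ?q * M + e / 2 * (1 - ?q)" if k: "k \<le> n" for k
    proof -
      have yk: "y (real k * T / real n) = w (real k * T / real n) + integral {0..real k * T / real n} (\<lambda>s. chi s *v y s)"
        using eq[of "real k * T / real n"] clampT_id[OF node_in_interval[OF T k]] by (simp add: Fchi_def algebra_simps)
      have "euler ?h ?B ?z k - y (real k * T / real n)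
        = ?h *\<^sub>R (\<Sum>j<k. ?B j *v (euler ?h ?B ?z j - y (real j * T / real n)))
          + (?h *\<^sub>R (\<Sum>j<k. ?B j *v y (real j * T / real n)) - integral {0..real k * T / real n} (\<lambda>s. chi s *v y s))"
        unfolding euler_incs[where w=w and n=n, OF WspD(2)[OF w] k] yk
        by (simp add: matrix_vector_mult_diff_distrib sum_subtractf scaleR_diff_right)
      then have "E k \<le> norm (?h *\<^sub>R (\<Sum>j<k. ?B j *v (euler ?h ?B ?z j - y (real j * T / real n)))) + e / 2 * (1 - ?q)"
        unfolding E_def using elim(2) k by (auto intro!: order_trans[OF norm_triangle_ineq])
      also have "norm (?h *\<^sub>R (\<Sum>j<k. ?B j *v (euler ?h ?B ?z j - y (real j * T / real n)))) \<le> ?h * (\<Sum>j<k. supnM T chi * M)"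
      proof -
        have "norm (?B j *v (euler ?h ?B ?z j - y (real j * T / real n))) \<le> supnM T chi * M" if "j < k" for j
          using Bn[of j] EM[of j] that k c0
          by (intro order_trans[OF norm_matrix_vector_le] mult_mono) (auto simp: E_def)
        then have "norm (\<Sum>j<k. ?B j *v (euler ?h ?B ?z j - y (real j * T / real n))) \<le> (\<Sum>j<k. supnM T chi * M)"
          by (intro order_trans[OF norm_sum] sum_mono) simp
        then show ?thesis using T unfolding norm_scaleR by (intro mult_mono) auto
      qed
      also have "?h * (\<Sum>j<k. supnM T chi * M) = (real k / real n) * (?q * M)" by simp
      also have "\<dots> \<le> 1 * (?q * M)" using k elim(1) T c0 M0 by (intro mult_right_mono) auto
      finally show ?thesis by simp
    qed
    moreover have "M \<in> E ` {..n}" unfolding M_def by (intro Max_in) auto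
    ultimately have "M \<le> ?q * M + e / 2 * (1 - ?q)" by auto
    then have "(1 - ?q) * M \<le> (1 - ?q) * (e / 2)" by (simp add: algebra_simps)
    then have Me: "M \<le> e / 2" using q by simp
    show ?case
    proof (rule supn_le)
      fix t assume t: "t \<in> {0..T}"
      have "norm (interp T n (euler_shift ?h ?B n ?z) t - interp T n (incs T n y) t) \<le> e / 2"
      proof (rule norm_interp_diff_le[OF T elim(1) t])
        fix k assume "k \<le> n"
        then show "norm ((\<Sum>j<k. euler_shift ?h ?B n ?z j) - (\<Sum>j<k. incs T n y j)) \<le> e / 2"
          using EM[of k] Me WspD(2)[OF y] by (simp add: sum_euler_shift sum_incs E_def)
      qed
      then show "norm ((interp T n (euler_shift ?h ?B n ?z) - y) t) \<le> e"
        using elim(3) t norm_triangle_ineq[of "interp T n (euler_shift ?h ?B n ?z) t - interp T n (incs T n y) t" "interp T n (incs T n y) t - y t"]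
        by (force simp: )
    qed (use T in simp)
  qed
qed

section \<open>Bounded continuous functionals of polygonal paths\<close>

lemma Cb_tendsto:
  assumes f: "f \<in> Cb T" and y: "y \<in> Wsp T" and v: "\<And>n. v n \<in> Wsp T"
    and lim: "\<And>e. e > 0 \<Longrightarrow> \<forall>\<^sub>F n in sequentially. supn T (v n - y) \<le> e"
  shows "(\<lambda>n. f (v n)) \<longlonglongrightarrow> f y"
proof (rule tendstoI)
  fix e :: real assume "e > 0"
  then obtain d where d: "d > 0" "\<And>u. u \<in> Wsp T \<Longrightarrow> supn T (u - y) < d \<Longrightarrow> \<bar>f u - f y\<bar> < e"
    using f y unfolding Cb_def by blast
  have "\<forall>\<^sub>F n in sequentially. supn T (v n - y) \<le> d / 2" using d by (intro lim) simp
  then show "\<forall>\<^sub>F n in sequentially. dist (f (v n)) (f y) < e"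
    by eventually_elim (use d v in \<open>auto simp: dist_real_def\<close>)
qed

text \<open>In the sup norm the polygonal path depends continuously on finitely many increments. The
  composition is thus continuous on sequences, where the Borel sets are those of the countable
  product. This is how measurability is obtained from \<open>Cb\<close>, which speaks of continuity
  only.\<close>

lemma Cb_interp_measurable:
  fixes f :: "(real \<Rightarrow> real^'d) \<Rightarrow> real"
  assumes T: "T > 0" and f: "f \<in> Cb T"
  shows "(\<lambda>z. f (interp T n z)) \<in> borel_measurable (borel_seq n)"
proof -
  have "continuous_on UNIV (\<lambda>z. f (interp T n z))"
    unfolding continuous_on_def
  proof (intro ballI tendstoI)
    fix z :: "nat \<Rightarrow> real^'d" and e :: real assume "e > 0"
    then obtain d where d: "d > 0" "\<And>u. u \<in> Wsp T \<Longrightarrow> supn T (u - interp T n z) < d \<Longrightarrow> \<bar>f u - f (interp T n z)\<bar> < e"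
      using f interp_Wsp[OF T, of n z] unfolding Cb_def by blast
    have "((\<lambda>x. \<Sum>k<n. norm (x k - z k)) \<longlongrightarrow> (\<Sum>k<n. norm (z k - z k))) (at z within UNIV)"
    proof (intro tendsto_sum tendsto_norm tendsto_diff tendsto_const)
      fix k :: nat
      have "continuous_on UNIV (\<lambda>x. x k :: real^'d)" by (rule continuous_on_product_coordinates)
      then show "((\<lambda>x. x k) \<longlongrightarrow> z k) (at z within UNIV)" unfolding continuous_on_def by auto
    qed
    then have "\<forall>\<^sub>F x in at z within UNIV. (\<Sum>k<n. norm (x k - z k)) < d"
      using d(1) by (intro order_tendstoD(2)) auto
    then show "\<forall>\<^sub>F x in at z within UNIV. dist (f (interp T n x)) (f (interp T n z)) < e"
    proof eventually_elim
      case (elim x)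
      have "supn T (interp T n x - interp T n z) \<le> (\<Sum>k<n. norm (x k - z k))"
      proof (rule supn_le)
        fix t
        have "norm (clampT 1 s *\<^sub>R v) \<le> norm v" for s and v :: "real^'d"
          using clampT_mem[of 1 s] by (auto intro: mult_left_le_one_le)
        then show "norm ((interp T n x - interp T n z) t) \<le> (\<Sum>k<n. norm (x k - z k))"
          unfolding minus_apply interp_diff unfolding interp_def
          by (intro order_trans[OF norm_sum] sum_mono)
      qed (use T in simp)
      then show ?case using elim d(2)[OF interp_Wsp[OF T]] by (simp add: dist_real_def)
    qed
  qed
  then have c: "(\<lambda>z. f (interp T n z)) \<in> borel_measurable borel" by (rule borel_measurable_continuous_onI)
  have c: "(\<lambda>z. f (interp T n z)) \<in> borel_measurable (Pi\<^sub>M UNIV (\<lambda>_::nat. borel :: (real^'d) measure))"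
    using c by (subst measurable_cong_sets[OF sets_PiM_equal_borel refl])
  \<comment> \<open>Points of \<open>borel_seq n\<close> are \<open>undefined\<close> from index
    \<open>n\<close> on; extension by zero makes them measurable sequences on all indices and leaves
    the interpolation unchanged.\<close>
  have "(\<lambda>z k. if k < n then z k else 0) \<in> measurable (Pi\<^sub>M {..<n} (\<lambda>_. borel :: (real^'d) measure)) (Pi\<^sub>M UNIV (\<lambda>_. borel))"
  proof (rule measurable_PiM_single')
    fix k show "(\<lambda>z. if k < n then z k else 0) \<in> borel_measurable (Pi\<^sub>M {..<n} (\<lambda>_. borel :: (real^'d) measure))"
      by (cases "k < n") simp_all
  qed simp
  from measurable_compose[OF this c]
  have "(\<lambda>z. f (interp T n (\<lambda>k. if k < n then z k else 0))) \<in> borel_measurable (borel_seq n)" .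
  moreover have "interp T n (\<lambda>k. if k < n then z k else 0) = interp T n z" for z :: "nat \<Rightarrow> real^'d"
    unfolding interp_def by (intro ext sum.cong) auto
  ultimately show ?thesis by simp
qed

subsection \<open>Left-point Riemann sums\<close>

text \<open>The Riesz-Fischer argument: a rapidly Cauchy subsequence converges almost everywhere,
  and Fatou followed by Chebyshev returns to the full sequence.\<close>

lemma L2_Cauchy_imp_converges_in_probability:
  fixes u :: "nat \<Rightarrow> 'a \<Rightarrow> real"
  assumes "prob_space M" and um [measurable]: "\<And>n. u n \<in> borel_measurable M"
    and C: "\<And>e. e > 0 \<Longrightarrow> \<exists>N. \<forall>m\<ge>N. \<forall>n\<ge>N. (\<integral>\<^sup>+x. ennreal ((u m x - u n x)\<^sup>2) \<partial>M) \<le> ennreal e"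
  shows "\<exists>X\<in>borel_measurable M. \<forall>\<epsilon>>0. (\<lambda>n. measure M {x\<in>space M. \<bar>u n x - X x\<bar> > \<epsilon>}) \<longlonglongrightarrow> 0"
proof -
  interpret prob_space M by fact
  have "\<forall>k. \<exists>N. \<forall>m\<ge>N. \<forall>n\<ge>N. (\<integral>\<^sup>+x. ennreal ((u m x - u n x)\<^sup>2) \<partial>M) \<le> ennreal ((1/4) ^ k)"
    using C by simp
  then obtain N where N: "\<And>k m n. m \<ge> N k \<Longrightarrow> n \<ge> N k \<Longrightarrow> (\<integral>\<^sup>+x. ennreal ((u m x - u n x)\<^sup>2) \<partial>M) \<le> ennreal ((1/4) ^ k)"
    by metis
  \<comment> \<open>The sum makes \<open>r\<close> monotone and at least \<open>N k\<close>; the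
    extra \<open>k\<close> makes it unbounded.\<close>
  define r where "r k = (\<Sum>i\<le>k. N i) + k" for k
  have rN: "N k \<le> r k" for k unfolding r_def by (simp add: member_le_sum trans_le_add1)
  have rS: "r k \<le> r (Suc k)" "k \<le> r k" for k unfolding r_def by auto
  define v where "v k x = u (r (Suc k)) x - u (r k) x" for k x
  have [measurable]: "v k \<in> borel_measurable M" for k unfolding v_def by simp
  have iv: "(\<integral>\<^sup>+x. ennreal \<bar>v k x\<bar> \<partial>M) \<le> ennreal (2 * (1/2) ^ k)" for k
  proof -
    \<comment> \<open>Splitting at 2^-k trades the L2 bound 4^-k for an L1 bound of order 2^-k,
      which is summable.\<close>
    have "\<bar>a\<bar> \<le> 2 ^ k * a\<^sup>2 + (1/2) ^ k" for a :: real
    proof (cases "\<bar>a\<bar> \<le> (1/2) ^ k")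
      case False
      have "\<bar>a\<bar> = 2 ^ k * ((1/2) ^ k * \<bar>a\<bar>)" by (simp add: power_one_over)
      also have "\<dots> \<le> 2 ^ k * (\<bar>a\<bar> * \<bar>a\<bar>)" using False by (intro mult_left_mono mult_right_mono) auto
      also have "\<dots> = 2 ^ k * a\<^sup>2" by (simp add: power2_eq_square)
      finally have "\<bar>a\<bar> \<le> 2 ^ k * a\<^sup>2" .
      moreover have "0 \<le> (1/2 :: real) ^ k" by simp
      ultimately show ?thesis by linarith
    qed (simp add: add_increasing)
    then have "(\<integral>\<^sup>+x. ennreal \<bar>v k x\<bar> \<partial>M) \<le> (\<integral>\<^sup>+x. ennreal (2 ^ k) * ennreal ((v k x)\<^sup>2) + ennreal ((1/2) ^ k) \<partial>M)"
      by (intro nn_integral_mono) (simp add: ennreal_plus[symmetric] ennreal_mult[symmetric] del: ennreal_plus)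
    also have "\<dots> = ennreal (2 ^ k) * (\<integral>\<^sup>+x. ennreal ((v k x)\<^sup>2) \<partial>M) + ennreal ((1/2) ^ k)"
      using emeasure_space_1 by (subst nn_integral_add) (simp_all add: nn_integral_cmult)
    also have "\<dots> \<le> ennreal (2 ^ k) * ennreal ((1/4) ^ k) + ennreal ((1/2) ^ k)"
      unfolding v_def using rN[of k] rS(1)[of k] by (intro add_right_mono mult_left_mono N) auto
    also have "\<dots> = ennreal (2 ^ k * (1/4) ^ k + (1/2) ^ k)" by (simp add: ennreal_mult[symmetric])
    also have "2 ^ k * (1/4) ^ k + (1/2) ^ k = 2 * (1/2 :: real) ^ k"
      by (simp add: power_mult_distrib[symmetric])
    finally show ?thesis .
  qed
  have "(\<integral>\<^sup>+x. (\<Sum>k. ennreal \<bar>v k x\<bar>) \<partial>M) = (\<Sum>k. \<integral>\<^sup>+x. ennreal \<bar>v k x\<bar> \<partial>M)"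
    by (intro nn_integral_suminf) measurable
  also have "\<dots> \<le> (\<Sum>k. ennreal (2 * (1/2) ^ k))" by (intro suminf_le iv) auto
  also have "\<dots> = ennreal (\<Sum>k. 2 * (1/2) ^ k)" by (intro suminf_ennreal2 summable_mult) (auto intro: summable_geometric)
  finally have "(\<integral>\<^sup>+x. (\<Sum>k. ennreal \<bar>v k x\<bar>) \<partial>M) \<noteq> \<infinity>" by (auto simp: top_unique)
  then have "AE x in M. (\<Sum>k. ennreal \<bar>v k x\<bar>) \<noteq> \<infinity>" by (intro nn_integral_PInf_AE) measurable
  then have conv: "AE x in M. convergent (\<lambda>k. u (r k) x)"
  proof eventually_elim
    case (elim x)
    then have "summable (\<lambda>k. \<bar>v k x\<bar>)" by (intro summable_suminf_not_top) auto
    then have "summable (\<lambda>k. v k x)" by (rule summable_rabs_cancel)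
    then have "convergent (\<lambda>n. \<Sum>k<n. v k x)" by (simp add: summable_iff_convergent)
    then have "convergent (\<lambda>n. (\<Sum>k<n. v k x) + u (r 0) x)" by (intro convergent_add convergent_const)
    moreover have "(\<Sum>k<n. v k x) = u (r n) x - u (r 0) x" for n
      unfolding v_def by (rule sum_lessThan_telescope)
    ultimately show ?case by simp
  qed
  define X where "X x = lim (\<lambda>k. u (r k) x)" for x
  have Xm [measurable]: "X \<in> borel_measurable M" unfolding X_def by (intro borel_measurable_lim_metric) simp
  have lim: "AE x in M. (\<lambda>k. u (r k) x) \<longlonglongrightarrow> X x"
    using conv by eventually_elim (simp add: X_def convergent_LIMSEQ_iff)
  have "(\<lambda>n. measure M {x\<in>space M. \<bar>u n x - X x\<bar> > \<epsilon>}) \<longlonglongrightarrow> 0" if \<epsilon>: "\<epsilon> > 0" for \<epsilon>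
  proof (rule LIMSEQ_I)
    fix e :: real assume e: "e > 0"
    \<comment> \<open>Chebyshev divides by \<open>\<epsilon>\<^sup>2\<close>, and the factor 1/2
      makes the final inequality strict.\<close>
    define e' where "e' = e * \<epsilon>\<^sup>2 / 2"
    have e': "e' > 0" using e \<epsilon> by (simp add: e'_def)
    obtain K where K: "\<And>m n. m \<ge> K \<Longrightarrow> n \<ge> K \<Longrightarrow> (\<integral>\<^sup>+x. ennreal ((u m x - u n x)\<^sup>2) \<partial>M) \<le> ennreal e'"
      using C[OF e'] by blast
    show "\<exists>no. \<forall>n\<ge>no. norm (measure M {x\<in>space M. \<bar>u n x - X x\<bar> > \<epsilon>} - 0) < e"
    proof (intro exI[of _ K] allI impI)
      fix n assume n: "K \<le> n"
      have "(\<integral>\<^sup>+x. ennreal ((u n x - X x)\<^sup>2) \<partial>M) = (\<integral>\<^sup>+x. liminf (\<lambda>k. ennreal ((u n x - u (r k) x)\<^sup>2)) \<partial>M)"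
      proof (rule nn_integral_cong_AE)
        show "AE x in M. ennreal ((u n x - X x)\<^sup>2) = liminf (\<lambda>k. ennreal ((u n x - u (r k) x)\<^sup>2))"
          using lim
        proof eventually_elim
          case (elim x)
          then have "(\<lambda>k. ennreal ((u n x - u (r k) x)\<^sup>2)) \<longlonglongrightarrow> ennreal ((u n x - X x)\<^sup>2)"
            by (intro tendsto_intros)
          then show ?case by (intro lim_imp_Liminf[symmetric]) auto
        qed
      qed
      also have "\<dots> \<le> liminf (\<lambda>k. \<integral>\<^sup>+x. ennreal ((u n x - u (r k) x)\<^sup>2) \<partial>M)"
        by (intro nn_integral_liminf) measurable
      also have "\<dots> \<le> ennreal e'"
      proof (rule Liminf_le)
        show "\<forall>\<^sub>F k in sequentially. (\<integral>\<^sup>+x. ennreal ((u n x - u (r k) x)\<^sup>2) \<partial>M) \<le> ennreal e'"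
          using eventually_ge_at_top[of K] by eventually_elim (use n rS(2) in \<open>auto intro!: K intro: order_trans\<close>)
      qed simp
      finally have L2: "(\<integral>\<^sup>+x. ennreal ((u n x - X x)\<^sup>2) \<partial>M) \<le> ennreal e'" .
      let ?A = "{x\<in>space M. \<bar>u n x - X x\<bar> > \<epsilon>}"
      have "ennreal (\<epsilon>\<^sup>2) * emeasure M ?A = (\<integral>\<^sup>+x. ennreal (\<epsilon>\<^sup>2) * indicator ?A x \<partial>M)"
        by (simp add: nn_integral_cmult_indicator)
      also have "\<dots> \<le> (\<integral>\<^sup>+x. ennreal ((u n x - X x)\<^sup>2) \<partial>M)"
      proof (rule nn_integral_mono)
        fix x
        have "\<epsilon>\<^sup>2 \<le> \<bar>u n x - X x\<bar>\<^sup>2" if "\<bar>u n x - X x\<bar> > \<epsilon>" using that \<epsilon> by (intro power_mono) auto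
        then show "ennreal (\<epsilon>\<^sup>2) * indicator ?A x \<le> ennreal ((u n x - X x)\<^sup>2)"
          by (auto simp: indicator_def intro!: ennreal_leI)
      qed
      also note L2
      finally have "\<epsilon>\<^sup>2 * measure M ?A \<le> e'"
        using e' by (simp add: emeasure_eq_measure ennreal_mult[symmetric])
      then have "measure M ?A \<le> e / 2" using \<epsilon> by (simp add: e'_def field_simps)
      then show "norm (measure M ?A - 0) < e" using e by simp
    qed
  qed
  with Xm show ?thesis by blast
qed

lemma wiener_incs_measurable:
  "wiener T \<mu> \<Longrightarrow> incs T n \<in> measurable \<mu> (borel_seq n)"
  unfolding incs_def using wiener_increments_measurable[where n=n and t="\<lambda>k. real k * T / real n"] by simp

lemma wiener_nn_integral_incs:
  assumes W: "wiener T \<mu>" and T: "T > 0" and n: "n > 0" and F: "F \<in> borel_measurable (borel_seq n)"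
  shows "(\<integral>\<^sup>+w. F (incs T n w) \<partial>\<mu>) = (\<integral>\<^sup>+z. F z \<partial>gauss_seq (T / real n) n)"
proof -
  have "distr \<mu> (borel_seq n) (incs T n) = Pi\<^sub>M {..<n} (\<lambda>k. gauss (real (Suc k) * T / real n - real k * T / real n))"
    unfolding incs_def
    by (rule wiener_increments_law[OF W, where t="\<lambda>k. real k * T / real n"])
       (use T n in \<open>auto intro!: mult_div_mono simp del: of_nat_Suc\<close>)
  also have "(\<lambda>k. gauss (real (Suc k) * T / real n - real k * T / real n)) = (\<lambda>k. gauss (T / real n))"
    by (simp add: diff_divide_distrib[symmetric] algebra_simps)
  finally have D: "distr \<mu> (borel_seq n) (incs T n) = Pi\<^sub>M {..<n} (\<lambda>k. gauss (T / real n))" .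
  show ?thesis unfolding D[symmetric] using F
    by (subst nn_integral_distr[OF wiener_incs_measurable[OF W]]) auto
qed

lemma wiener_space_Wsp: "wiener T \<mu> \<Longrightarrow> space \<mu> = Wsp T" by (simp add: wiener_def)

lemma riemann_p_incs:
  assumes "w 0 = 0"
  shows "riemann_p T \<sigma> n w = (\<Sum>k<n. (\<sigma> (real k * T / real n) *v (\<Sum>j<k. incs T n w j)) \<bullet> incs T n w k)"
  unfolding riemann_p_def
  by (rule sum.cong) (auto simp: sum_incs[where w=w, OF assms] simp del: of_nat_Suc, simp add: incs_def del: of_nat_Suc)

text \<open>On the fine grid the coarse sum has its integrand frozen at \<open>j div m * m\<close>,
  the last coarse node up to \<open>j\<close>. Coarse and fine sums then share their Gaussian
  increments, and the difference is a discrete stochastic integral.\<close>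

lemma riemann_p_refine:
  assumes w: "w 0 = 0" and n: "n > 0" and m: "m > 0"
  shows "riemann_p T \<sigma> n w = (\<Sum>j<n * m. (\<sigma> (real (j div m * m) * T / real (n * m)) *v (\<Sum>i<j div m * m. incs T (n * m) w i)) \<bullet> incs T (n * m) w j)"
proof -
  let ?z = "incs T (n * m) w"
  define a where "a k = \<sigma> (real k * T / real n) *v w (real k * T / real n)" for k
  have node: "real (k * m) * T / real (n * m) = real k * T / real n" for k using m by simp
  have "(\<Sum>j<n * m. (\<sigma> (real (j div m * m) * T / real (n * m)) *v (\<Sum>i<j div m * m. ?z i)) \<bullet> ?z j)
    = (\<Sum>j<n * m. a (j div m) \<bullet> ?z j)"
  proof (rule sum.cong[OF refl])
    fix j assume "j \<in> {..<n * m}"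
    then have "j div m * m \<le> n * m" using div_times_less_eq_dividend[of j m] by (simp only: lessThan_iff)
    then show "(\<sigma> (real (j div m * m) * T / real (n * m)) *v (\<Sum>i<j div m * m. ?z i)) \<bullet> ?z j = a (j div m) \<bullet> ?z j"
      by (simp only: sum_incs[where w=w, OF w] node a_def)
  qed
  also have "\<dots> = (\<Sum>k<n. \<Sum>j\<in>{k*m..<k*m+m}. a (j div m) \<bullet> ?z j)" by (rule sum.nat_group[symmetric])
  also have "\<dots> = (\<Sum>k<n. a k \<bullet> (w (real (Suc k) * T / real n) - w (real k * T / real n)))"
  proof (rule sum.cong[OF refl])
    fix k assume k: "k \<in> {..<n}"
    have km: "k * m + m \<le> n * m" using k by (metis Suc_leI lessThan_iff mult_Suc mult_le_mono1 add.commute)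
    have "(\<Sum>j\<in>{k*m..<k*m+m}. a (j div m) \<bullet> ?z j) = (\<Sum>j\<in>{k*m..<k*m+m}. a k \<bullet> ?z j)"
    proof (rule sum.cong[OF refl])
      fix j assume "j \<in> {k*m..<k*m+m}"
      then have "j div m = k" by (intro div_nat_eqI) (auto simp: mult_ac)
      then show "a (j div m) \<bullet> ?z j = a k \<bullet> ?z j" by simp
    qed
    also have "\<dots> = a k \<bullet> (\<Sum>j\<in>{k*m..<k*m+m}. ?z j)" by (simp add: inner_sum_right)
    also have "(\<Sum>j\<in>{k*m..<k*m+m}. ?z j) = (\<Sum>j<k*m+m. ?z j) - (\<Sum>j<k*m. ?z j)"
      by (simp add: lessThan_atLeast0 sum_diff_nat_ivl)
    also have "\<dots> = w (real (Suc k * m) * T / real (n * m)) - w (real (k * m) * T / real (n * m))"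
      using km k by (subst (1 2) sum_incs[where w=w, OF w]) (auto simp: add.commute)
    finally show "(\<Sum>j\<in>{k*m..<k*m+m}. a (j div m) \<bullet> ?z j) = a k \<bullet> (w (real (Suc k) * T / real n) - w (real k * T / real n))"
      unfolding node .
  qed
  finally show ?thesis unfolding riemann_p_def a_def by simp
qed

lemma norm_matrix_vector_diff_square:
  fixes A A' :: "real^'d^'d"
  shows "(norm (A *v x - A' *v x'))\<^sup>2 \<le> 2 * (norm (A - A'))\<^sup>2 * (norm x)\<^sup>2 + 2 * (norm A')\<^sup>2 * (norm (x - x'))\<^sup>2"
proof -
  have "A *v x - A' *v x' = (A - A') *v x + A' *v (x - x')"
    by (simp add: matrix_vector_mult_diff_rdistrib matrix_vector_mult_diff_distrib)
  then have "norm (A *v x - A' *v x') \<le> norm (A - A') * norm x + norm A' * norm (x - x')"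
    by (simp only:) (rule order_trans[OF norm_triangle_ineq add_mono[OF norm_matrix_vector_le norm_matrix_vector_le]])
  then have "(norm (A *v x - A' *v x'))\<^sup>2 \<le> (norm (A - A') * norm x + norm A' * norm (x - x'))\<^sup>2"
    by (intro power_mono) auto
  also have "\<dots> \<le> 2 * (norm (A - A') * norm x)\<^sup>2 + 2 * (norm A' * norm (x - x'))\<^sup>2"
    using zero_le_power2[of "norm (A - A') * norm x - norm A' * norm (x - x')"]
    by (simp add: power2_sum power2_diff)
  finally show ?thesis by (simp add: power_mult_distrib)
qed

text \<open>The isometry reduces the claim to second moments of the difference of \<sigma> w between
  a fine node and the last coarse node. Changing the matrix costs \<open>\<eta>\<close> against a
  second moment of the path, at most T d; changing the path costs \<open>C\<close> against that of
  an increment over at most one coarse cell, at most (T / n) d. The outer factor \<open>T\<close> is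
  the total length of the cells.\<close>

lemma riemann_p_refine_L2:
  fixes \<mu> :: "(real \<Rightarrow> real^'d) measure" and \<sigma> :: "real \<Rightarrow> real^'d^'d"
  assumes W: "wiener T \<mu>" and T: "T > 0" and n: "n > 0" and m: "m > 0"
    and C: "\<And>t. t \<in> {0..T} \<Longrightarrow> norm (\<sigma> t) \<le> C"
    and \<eta>: "\<And>s t. s \<in> {0..T} \<Longrightarrow> t \<in> {0..T} \<Longrightarrow> \<bar>t - s\<bar> \<le> T / real n \<Longrightarrow> norm (\<sigma> t - \<sigma> s) \<le> \<eta>"
  shows "(\<integral>\<^sup>+w. ennreal ((riemann_p T \<sigma> (n * m) w - riemann_p T \<sigma> n w)\<^sup>2) \<partial>\<mu>)
    \<le> ennreal (T * (2 * \<eta>\<^sup>2 * (T * CARD('d)) + 2 * C\<^sup>2 * (T / real n * CARD('d))))"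
proof -
  let ?N = "n * m"
  let ?h = "T / real ?N"
  have N: "?N > 0" using n m by simp
  have h: "?h \<ge> 0" using T by simp
  define s where "s j = real j * T / real ?N" for j
  define pr where "pr j = j div m * m" for j
  have prj: "pr j \<le> j" for j unfolding pr_def by (rule div_times_less_eq_dividend)
  have prd: "j \<le> pr j + m" for j
    unfolding pr_def using m by (metis div_mult_mod_eq less_imp_le mod_less_divisor nat_add_left_cancel_le)
  define c where "c j z = \<sigma> (s j) *v (\<Sum>i<j. z i) - \<sigma> (s (pr j)) *v (\<Sum>i<pr j. z i)" for j and z :: "nat \<Rightarrow> real^'d"
  have c_m: "c j \<in> borel_measurable (borel_seq k)" if "j \<le> k" for j k
  proof -
    have "(\<lambda>z. \<Sum>i<l. z i) \<in> borel_measurable (Pi\<^sub>M {..<k} (\<lambda>_. borel :: (real^'d) measure))" if "l \<le> j" for l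
      using that \<open>j \<le> k\<close> by (intro borel_measurable_sum) auto
    then show ?thesis unfolding c_def using prj[of j]
      by (intro borel_measurable_diff matrix_vector_measurable) auto
  qed
  have Wm: "(\<lambda>w. w t) \<in> borel_measurable \<mu>" for t by (rule wiener_coord_measurable[OF W])
  have w0: "w 0 = 0" if "w \<in> space \<mu>" for w using that WspD(2) wiener_space_Wsp[OF W] by blast
  have R: "riemann_p T \<sigma> ?N w - riemann_p T \<sigma> n w = (\<Sum>j<?N. c j (incs T ?N w) \<bullet> incs T ?N w j)" if "w \<in> space \<mu>" for w
    unfolding riemann_p_incs[where w=w and n="?N", OF w0[OF that]] riemann_p_refine[where w=w, OF w0[OF that] n m] c_def s_def pr_def sum_subtractf[symmetric] inner_diff_left ..
  have mS: "(\<lambda>z. \<Sum>j<?N. c j z \<bullet> z j) \<in> borel_measurable (borel_seq ?N)"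
    by (intro borel_measurable_sum borel_measurable_inner c_m) auto
  have mV: "(\<lambda>z. \<Sum>j<?N. ?h * (norm (c j z))\<^sup>2) \<in> borel_measurable (borel_seq ?N)"
    by (intro borel_measurable_sum borel_measurable_times borel_measurable_power measurable_compose[OF c_m borel_measurable_norm]) auto
  have "(\<integral>\<^sup>+w. ennreal ((riemann_p T \<sigma> ?N w - riemann_p T \<sigma> n w)\<^sup>2) \<partial>\<mu>)
    = (\<integral>\<^sup>+w. ennreal ((\<Sum>j<?N. c j (incs T ?N w) \<bullet> incs T ?N w j)\<^sup>2) \<partial>\<mu>)"
    by (intro nn_integral_cong) (simp only: R)
  also have "\<dots> = (\<integral>\<^sup>+z. ennreal ((\<Sum>j<?N. c j z \<bullet> z j)\<^sup>2) \<partial>gauss_seq ?h ?N)"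
    by (rule wiener_nn_integral_incs[OF W T N measurable_compose[OF borel_measurable_power[OF mS] measurable_ennreal]])
  also have "\<dots> \<le> (\<integral>\<^sup>+z. ennreal (\<Sum>j<?N. ?h * (norm (c j z))\<^sup>2) \<partial>gauss_seq ?h ?N)"
  proof (rule ito_isometry_bound[OF h])
    show "c k x = c k y" if "\<And>j. j < k \<Longrightarrow> x j = y j" for k x y
      unfolding c_def using that prj[of k] by (intro arg_cong2[where f="(-)"] arg_cong2[where f="(*v)"] sum.cong) auto
  qed (rule c_m)
  also have "\<dots> = (\<integral>\<^sup>+w. ennreal (\<Sum>j<?N. ?h * (norm (c j (incs T ?N w)))\<^sup>2) \<partial>\<mu>)"
    by (rule wiener_nn_integral_incs[OF W T N measurable_compose[OF mV measurable_ennreal], symmetric])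
  \<comment> \<open>\<open>w 0\<close> is zero and is written out so that both moments are those of
    increments.\<close>
  also have "\<dots> \<le> (\<integral>\<^sup>+w. (\<Sum>j<?N. ennreal ?h * (ennreal (2 * \<eta>\<^sup>2) * ennreal ((norm (w (s j) - w 0))\<^sup>2) + ennreal (2 * C\<^sup>2) * ennreal ((norm (w (s j) - w (s (pr j))))\<^sup>2))) \<partial>\<mu>)"
  proof (rule nn_integral_mono)
    fix w assume w: "w \<in> space \<mu>"
    have "(\<Sum>j<?N. ?h * (norm (c j (incs T ?N w)))\<^sup>2) \<le> (\<Sum>j<?N. ?h * (2 * \<eta>\<^sup>2 * (norm (w (s j) - w 0))\<^sup>2 + 2 * C\<^sup>2 * (norm (w (s j) - w (s (pr j))))\<^sup>2))"
    proof (intro sum_mono mult_left_mono)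
      fix j assume j: "j \<in> {..<?N}"
      have sj: "s j \<in> {0..T}" "s (pr j) \<in> {0..T}" unfolding s_def
        using j prj[of j] node_in_interval[OF T, of j ?N] node_in_interval[OF T, of "pr j" ?N] by (simp_all only: lessThan_iff)
      have "s j - s (pr j) = real (j - pr j) * T / real ?N"
        using prj[of j] by (simp add: s_def of_nat_diff diff_divide_distrib[symmetric] algebra_simps)
      also have "\<dots> \<le> real m * T / real ?N" using prd[of j] T by (intro divide_right_mono mult_right_mono) auto
      also have "\<dots> = T / real n" using m by simp
      finally have "\<bar>s j - s (pr j)\<bar> \<le> T / real n"
        using mult_div_mono[OF T prj[of j], of ?N] by (simp add: s_def)
      then have e: "norm (\<sigma> (s j) - \<sigma> (s (pr j))) \<le> \<eta>" using sj by (intro \<eta>) auto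
      have cj: "c j (incs T ?N w) = \<sigma> (s j) *v w (s j) - \<sigma> (s (pr j)) *v w (s (pr j))"
        unfolding c_def using j prj[of j] by (simp add: sum_incs[where w=w, OF w0[OF w]] s_def)
      have "(norm (c j (incs T ?N w)))\<^sup>2 \<le> 2 * (norm (\<sigma> (s j) - \<sigma> (s (pr j))))\<^sup>2 * (norm (w (s j)))\<^sup>2
          + 2 * (norm (\<sigma> (s (pr j))))\<^sup>2 * (norm (w (s j) - w (s (pr j))))\<^sup>2"
        unfolding cj by (rule norm_matrix_vector_diff_square)
      also have "\<dots> \<le> 2 * \<eta>\<^sup>2 * (norm (w (s j)))\<^sup>2 + 2 * C\<^sup>2 * (norm (w (s j) - w (s (pr j))))\<^sup>2"
        using e C[OF sj(2)] by (intro add_mono mult_right_mono mult_left_mono power_mono) auto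
      finally show "(norm (c j (incs T ?N w)))\<^sup>2 \<le> 2 * \<eta>\<^sup>2 * (norm (w (s j) - w 0))\<^sup>2 + 2 * C\<^sup>2 * (norm (w (s j) - w (s (pr j))))\<^sup>2"
        using w0[OF w] by simp
    qed (rule h)
    then have "ennreal (\<Sum>j<?N. ?h * (norm (c j (incs T ?N w)))\<^sup>2) \<le> ennreal (\<Sum>j<?N. ?h * (2 * \<eta>\<^sup>2 * (norm (w (s j) - w 0))\<^sup>2 + 2 * C\<^sup>2 * (norm (w (s j) - w (s (pr j))))\<^sup>2))"
      by (rule ennreal_leI)
    also have "\<dots> = (\<Sum>j<?N. ennreal (?h * (2 * \<eta>\<^sup>2 * (norm (w (s j) - w 0))\<^sup>2 + 2 * C\<^sup>2 * (norm (w (s j) - w (s (pr j))))\<^sup>2)))"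
      by (intro sum_ennreal[symmetric] mult_nonneg_nonneg h add_nonneg_nonneg) auto
    also have "\<dots> = (\<Sum>j<?N. ennreal ?h * (ennreal (2 * \<eta>\<^sup>2) * ennreal ((norm (w (s j) - w 0))\<^sup>2) + ennreal (2 * C\<^sup>2) * ennreal ((norm (w (s j) - w (s (pr j))))\<^sup>2)))"
      by (intro sum.cong refl, subst ennreal_mult[OF h]) (auto simp: ennreal_mult)
    finally show "ennreal (\<Sum>j<?N. ?h * (norm (c j (incs T ?N w)))\<^sup>2) \<le> (\<Sum>j<?N. ennreal ?h * (ennreal (2 * \<eta>\<^sup>2) * ennreal ((norm (w (s j) - w 0))\<^sup>2) + ennreal (2 * C\<^sup>2) * ennreal ((norm (w (s j) - w (s (pr j))))\<^sup>2)))" .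
  qed
  also have "\<dots> = (\<Sum>j<?N. ennreal ?h * (ennreal (2 * \<eta>\<^sup>2) * (\<integral>\<^sup>+w. ennreal ((norm (w (s j) - w 0))\<^sup>2) \<partial>\<mu>) + ennreal (2 * C\<^sup>2) * (\<integral>\<^sup>+w. ennreal ((norm (w (s j) - w (s (pr j))))\<^sup>2) \<partial>\<mu>)))"
  proof -
    have d [measurable]: "(\<lambda>w. ennreal ((norm (w a - w b))\<^sup>2)) \<in> borel_measurable \<mu>" for a b using Wm[of a] Wm[of b] by simp
    show ?thesis
      by (subst nn_integral_sum, measurable)
         (intro sum.cong refl, subst nn_integral_cmult, measurable, subst nn_integral_add, measurable, simp add: nn_integral_cmult d)
  qed
  also have "\<dots> \<le> (\<Sum>j<?N. ennreal ?h * (ennreal (2 * \<eta>\<^sup>2) * ennreal (T * CARD('d)) + ennreal (2 * C\<^sup>2) * ennreal (T / real n * CARD('d))))"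
  proof (intro sum_mono mult_left_mono add_mono)
    fix j assume j: "j \<in> {..<?N}"
    have sj: "s j \<in> {0..T}" "s (pr j) \<in> {0..T}" unfolding s_def
        using j prj[of j] node_in_interval[OF T, of j ?N] node_in_interval[OF T, of "pr j" ?N] by (simp_all only: lessThan_iff)
    have le: "s (pr j) \<le> s j" unfolding s_def by (rule mult_div_mono[OF T prj])
    have "s j - s (pr j) = real (j - pr j) * T / real ?N"
      using prj[of j] by (simp add: s_def of_nat_diff diff_divide_distrib[symmetric] algebra_simps)
    also have "\<dots> \<le> real m * T / real ?N" using prd[of j] T by (intro divide_right_mono mult_right_mono) auto
    also have "\<dots> = T / real n" using m by simp
    finally have d: "s j - s (pr j) \<le> T / real n" .
    show "(\<integral>\<^sup>+w. ennreal ((norm (w (s j) - w 0))\<^sup>2) \<partial>\<mu>) \<le> ennreal (T * CARD('d))"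
      using sj by (subst wiener_nn_integral_increment[OF W]) (auto intro!: ennreal_leI mult_right_mono)
    show "(\<integral>\<^sup>+w. ennreal ((norm (w (s j) - w (s (pr j))))\<^sup>2) \<partial>\<mu>) \<le> ennreal (T / real n * CARD('d))"
      using sj le by (subst wiener_nn_integral_increment[OF W]) (auto intro!: ennreal_leI mult_right_mono[OF d, of "real CARD('d)", simplified])
  qed auto
  also have "\<dots> = ennreal (real ?N * (?h * (2 * \<eta>\<^sup>2 * (T * CARD('d)) + 2 * C\<^sup>2 * (T / real n * CARD('d)))))"
    using T h by (simp add: ennreal_mult[symmetric] ennreal_plus[symmetric] ennreal_of_nat_eq_real_of_nat del: ennreal_plus of_nat_mult)
  also have "real ?N * (?h * (2 * \<eta>\<^sup>2 * (T * CARD('d)) + 2 * C\<^sup>2 * (T / real n * CARD('d)))) = T * (2 * \<eta>\<^sup>2 * (T * CARD('d)) + 2 * C\<^sup>2 * (T / real n * CARD('d)))"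
    using N by simp
  finally show ?thesis .
qed

lemma riemann_p_measurable:
  assumes W: "wiener T \<mu>"
  shows "riemann_p T \<sigma> n \<in> borel_measurable \<mu>"
proof -
  have [measurable]: "(\<lambda>w. w t) \<in> borel_measurable \<mu>" for t by (rule wiener_coord_measurable[OF W])
  show ?thesis unfolding riemann_p_def by measurable
qed

text \<open>Grids with \<open>m\<close> and \<open>n\<close> steps are each compared with the common
  refinement of \<open>m * n\<close> steps, which makes the Riemann sums Cauchy in L2.\<close>

lemma ito_integral_exists:
  fixes \<mu> :: "(real \<Rightarrow> real^'d) measure" and \<sigma> :: "real \<Rightarrow> real^'d^'d"
  assumes W: "wiener T \<mu>" and T: "T > 0" and \<sigma>: "continuous_on {0..T} \<sigma>"
  shows "\<exists>X. is_ito_p T \<mu> \<sigma> X"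
proof -
  let ?R = "riemann_p T \<sigma>"
  have Rm: "?R n \<in> borel_measurable \<mu>" for n by (rule riemann_p_measurable[OF W])
  have "\<exists>N. \<forall>m\<ge>N. \<forall>n\<ge>N. (\<integral>\<^sup>+w. ennreal ((?R m w - ?R n w)\<^sup>2) \<partial>\<mu>) \<le> ennreal e" if e: "e > 0" for e
  proof -
    define D where "D = 2 * T * (T * CARD('d))"
    define C where "C = supnM T \<sigma>"
    have D0: "D > 0" using T by (simp add: D_def)
    \<comment> \<open>With this choice each of the two error terms is at most \<open>e / 8\<close>,
      so a refinement costs \<open>e / 4\<close>; (a - b)^2 \<le> 2 a^2 + 2 b^2 doubles each of the
      two refinements, which gives \<open>e\<close>.\<close>
    define \<eta> where "\<eta> = sqrt (e / (8 * D))"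
    have \<eta>: "\<eta> > 0" "\<eta>\<^sup>2 = e / (8 * D)" using e D0 by (auto simp: \<eta>_def)
    have "uniformly_continuous_on {0..T} \<sigma>" by (rule compact_uniformly_continuous[OF \<sigma>]) simp
    then obtain d where d: "d > 0" "\<And>s t. s \<in> {0..T} \<Longrightarrow> t \<in> {0..T} \<Longrightarrow> dist t s < d \<Longrightarrow> dist (\<sigma> t) (\<sigma> s) < \<eta>"
      unfolding uniformly_continuous_on_def using \<eta> by metis
    have "(\<lambda>n. T / real n) \<longlonglongrightarrow> 0" by (rule lim_const_over_n)
    then have e1: "\<forall>\<^sub>F n in sequentially. T / real n < d" using d(1) by (rule order_tendstoD)
    have "(\<lambda>n. C\<^sup>2 * D / real n) \<longlonglongrightarrow> 0" by (rule lim_const_over_n)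
    then have e2: "\<forall>\<^sub>F n in sequentially. C\<^sup>2 * D / real n < e / 8" by (rule order_tendstoD) (use e in simp)
    obtain N where N: "\<And>n. n \<ge> N \<Longrightarrow> n > 0 \<and> T / real n < d \<and> C\<^sup>2 * D / real n < e / 8"
      using eventually_conj[OF eventually_gt_at_top[of 0] eventually_conj[OF e1 e2]]
      unfolding eventually_sequentially by blast
    have b: "(\<integral>\<^sup>+w. ennreal ((?R (n * m) w - ?R n w)\<^sup>2) \<partial>\<mu>) \<le> ennreal (e / 4)" if n: "n \<ge> N" and m: "m > 0" for n m
    proof -
      have "(\<integral>\<^sup>+w. ennreal ((?R (n * m) w - ?R n w)\<^sup>2) \<partial>\<mu>) \<le> ennreal (T * (2 * \<eta>\<^sup>2 * (T * CARD('d)) + 2 * C\<^sup>2 * (T / real n * CARD('d))))"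
      proof (rule riemann_p_refine_L2[OF W T _ m])
        show "n > 0" using N[OF n] by simp
        show "norm (\<sigma> t) \<le> C" if "t \<in> {0..T}" for t unfolding C_def by (rule norm_le_supnM[OF \<sigma> that])
        show "norm (\<sigma> t - \<sigma> s) \<le> \<eta>" if "s \<in> {0..T}" "t \<in> {0..T}" "\<bar>t - s\<bar> \<le> T / real n" for s t
          using d(2)[OF that(1,2)] that(3) N[OF n] by (auto simp: dist_norm)
      qed
      also have "T * (2 * \<eta>\<^sup>2 * (T * CARD('d)) + 2 * C\<^sup>2 * (T / real n * CARD('d))) = D * \<eta>\<^sup>2 + C\<^sup>2 * D / real n"
        by (simp add: D_def algebra_simps)
      finally show ?thesis
      proof (rule order_trans, intro ennreal_leI)
        have "D * \<eta>\<^sup>2 = e / 8" using D0 by (simp add: \<eta>(2))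
        then show "D * \<eta>\<^sup>2 + C\<^sup>2 * D / real n \<le> e / 4" using N[OF n] by linarith
      qed
    qed
    have "(\<integral>\<^sup>+w. ennreal ((?R m w - ?R n w)\<^sup>2) \<partial>\<mu>) \<le> ennreal e" if m: "m \<ge> N" and n: "n \<ge> N" for m n
    proof -
      have sq: "(?R m w - ?R n w)\<^sup>2 \<le> 2 * (?R (m * n) w - ?R m w)\<^sup>2 + 2 * (?R (n * m) w - ?R n w)\<^sup>2" for w
        using zero_le_power2[of "(?R (n * m) w - ?R m w) + (?R (n * m) w - ?R n w)"]
        by (simp add: power2_eq_square algebra_simps)
      have "(\<integral>\<^sup>+w. ennreal ((?R m w - ?R n w)\<^sup>2) \<partial>\<mu>) \<le> (\<integral>\<^sup>+w. ennreal 2 * ennreal ((?R (m * n) w - ?R m w)\<^sup>2) + ennreal 2 * ennreal ((?R (n * m) w - ?R n w)\<^sup>2) \<partial>\<mu>)"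
        using sq by (intro nn_integral_mono) (simp add: ennreal_mult[symmetric] ennreal_plus[symmetric] ennreal_leI del: ennreal_plus ennreal_numeral)
      also have "\<dots> = ennreal 2 * (\<integral>\<^sup>+w. ennreal ((?R (m * n) w - ?R m w)\<^sup>2) \<partial>\<mu>) + ennreal 2 * (\<integral>\<^sup>+w. ennreal ((?R (n * m) w - ?R n w)\<^sup>2) \<partial>\<mu>)"
        using Rm[of m] Rm[of n] Rm[of "m * n"] Rm[of "n * m"] by (subst nn_integral_add) (simp_all add: nn_integral_cmult del: ennreal_numeral)
      also have "\<dots> \<le> ennreal 2 * ennreal (e / 4) + ennreal 2 * ennreal (e / 4)"
        using m n N[OF m] N[OF n] by (intro add_mono mult_left_mono b) auto
      also have "\<dots> = ennreal (2 * (e / 4) + 2 * (e / 4))"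
        using e by (simp add: ennreal_mult[symmetric] ennreal_plus[symmetric] del: ennreal_plus ennreal_numeral)
      finally show ?thesis by simp
    qed
    then show ?thesis by blast
  qed
  from L2_Cauchy_imp_converges_in_probability[OF wiener_prob_space[OF W] Rm this]
  show ?thesis unfolding is_ito_p_def by blast
qed

text \<open>The centred forms are martingale differences whose variances are of order (T / n)^2, and
  \<open>n\<close> of them leave order 1 / n.\<close>

lemma quadratic_variation_L2:
  fixes \<mu> :: "(real \<Rightarrow> real^'d) measure" and A :: "nat \<Rightarrow> real^'d^'d"
  assumes W: "wiener T \<mu>" and T: "T > 0" and n: "n > 0" and C: "\<And>k. norm (A k) \<le> C"
  shows "(\<integral>\<^sup>+w. ennreal ((\<Sum>k<n. incs T n w k \<bullet> (A k *v incs T n w k) - T / real n * trace (A k))\<^sup>2) \<partial>\<mu>)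
    \<le> ennreal (gauss_quad_const TYPE('d) * T\<^sup>2 * C\<^sup>2 / real n)"
proof -
  let ?h = "T / real n"
  have h: "?h \<ge> 0" using T by simp
  have K0: "gauss_quad_const TYPE('d) \<ge> 0" unfolding gauss_quad_const_def by (intro integral_nonneg_AE) auto
  have mp: "(\<lambda>z. z k \<bullet> (A k *v z k) - ?h * trace (A k)) \<in> borel_measurable (borel_seq j)" if "k < j" for k j
  proof -
    have [measurable]: "(\<lambda>z. z k) \<in> borel_measurable (Pi\<^sub>M {..<j} (\<lambda>_. borel :: (real^'d) measure))" using that by simp
    show ?thesis by measurable
  qed
  have mS: "(\<lambda>z. \<Sum>k<n. z k \<bullet> (A k *v z k) - ?h * trace (A k)) \<in> borel_measurable (borel_seq n)"
    by (intro borel_measurable_sum mp) auto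
  have "(\<integral>\<^sup>+w. ennreal ((\<Sum>k<n. incs T n w k \<bullet> (A k *v incs T n w k) - ?h * trace (A k))\<^sup>2) \<partial>\<mu>)
    = (\<integral>\<^sup>+z. ennreal ((\<Sum>k<n. z k \<bullet> (A k *v z k) - ?h * trace (A k))\<^sup>2) \<partial>gauss_seq ?h n)"
    by (rule wiener_nn_integral_incs[OF W T n measurable_compose[OF borel_measurable_power[OF mS] measurable_ennreal]])
  also have "\<dots> \<le> (\<integral>\<^sup>+z. ennreal (\<Sum>k<n. gauss_quad_const TYPE('d) * (?h\<^sup>2 * C\<^sup>2)) \<partial>(gauss_seq ?h n :: (nat \<Rightarrow> real^'d) measure))"
  proof (rule martingale_square_bound)
    fix k :: nat and x :: "nat \<Rightarrow> real^'d"
    have i: "integrable (gauss ?h) (\<lambda>y. y \<bullet> (A k *v y))" "(\<integral>y. y \<bullet> (A k *v y) \<partial>gauss ?h) = ?h * trace (A k)"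
      by (rule gauss_integral_quad[OF h])+
    show "integrable (gauss ?h) (\<lambda>y. (x(k := y)) k \<bullet> (A k *v (x(k := y)) k) - ?h * trace (A k))"
      using i by simp
    show "(\<integral>y. (x(k := y)) k \<bullet> (A k *v (x(k := y)) k) - ?h * trace (A k) \<partial>gauss ?h) = 0"
      using i by simp
    show "integrable (gauss ?h) (\<lambda>y. ((x(k := y)) k \<bullet> (A k *v (x(k := y)) k) - ?h * trace (A k))\<^sup>2)"
      using gauss_integral_quad_var(1)[OF h, of "A k"] by simp
    have "(\<integral>y. (y \<bullet> (A k *v y) - ?h * trace (A k))\<^sup>2 \<partial>gauss ?h) \<le> gauss_quad_const TYPE('d) * (?h\<^sup>2 * (norm (A k))\<^sup>2)"
      by (rule gauss_integral_quad_var(2)[OF h])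
    also have "\<dots> \<le> gauss_quad_const TYPE('d) * (?h\<^sup>2 * C\<^sup>2)"
      using K0 C[of k] by (intro mult_left_mono power_mono) auto
    finally show "(\<integral>y. ((x(k := y)) k \<bullet> (A k *v (x(k := y)) k) - ?h * trace (A k))\<^sup>2 \<partial>gauss ?h) \<le> gauss_quad_const TYPE('d) * (?h\<^sup>2 * C\<^sup>2)"
      by simp
  qed (auto intro: mp)
  also have "\<dots> = ennreal (real n * (gauss_quad_const TYPE('d) * (?h\<^sup>2 * C\<^sup>2)))"
    by (simp add: emeasure_PiM_gauss_space)
  also have "real n * (gauss_quad_const TYPE('d) * (?h\<^sup>2 * C\<^sup>2)) = gauss_quad_const TYPE('d) * T\<^sup>2 * C\<^sup>2 / real n"
    using n by (simp add: power2_eq_square)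
  finally show ?thesis .
qed

subsection \<open>Passage to the limit\<close>

text \<open>Truncating the distance at 1 turns convergence in probability into L1 convergence, which
  supplies the subsequence; along it the truncation is eventually inactive.\<close>

lemma converges_in_probability_AE_subseq:
  fixes u :: "nat \<Rightarrow> 'a \<Rightarrow> real"
  assumes "prob_space M" and um [measurable]: "\<And>n. u n \<in> borel_measurable M" "X \<in> borel_measurable M"
    and C: "\<And>\<epsilon>. \<epsilon> > 0 \<Longrightarrow> (\<lambda>n. measure M {x\<in>space M. \<bar>u n x - X x\<bar> > \<epsilon>}) \<longlonglongrightarrow> 0"
  shows "\<exists>r::nat\<Rightarrow>nat. strict_mono r \<and> (AE x in M. (\<lambda>n. u (r n) x) \<longlonglongrightarrow> X x)"
proof -
  interpret prob_space M by fact
  define v where "v n x = min 1 \<bar>u n x - X x\<bar>" for n x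
  have vm [measurable]: "v n \<in> borel_measurable M" for n unfolding v_def by simp
  have vi: "integrable M (v n)" for n
    by (rule integrable_const_bound[of _ 1]) (auto simp: v_def)
  have "(\<lambda>n. \<integral>x. norm (v n x) \<partial>M) \<longlonglongrightarrow> 0"
  proof (rule LIMSEQ_I)
    fix e :: real assume e: "e > 0"
    obtain N where N: "\<And>n. n \<ge> N \<Longrightarrow> measure M {x\<in>space M. \<bar>u n x - X x\<bar> > e / 2} < e / 2"
      using LIMSEQ_D[OF C[of "e / 2"], of "e / 2"] e by auto
    show "\<exists>N. \<forall>n\<ge>N. norm ((\<integral>x. norm (v n x) \<partial>M) - 0) < e"
    proof (intro exI[of _ N] allI impI)
      fix n assume n: "n \<ge> N"
      let ?A = "{x\<in>space M. \<bar>u n x - X x\<bar> > e / 2}"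
      have "(\<integral>x. norm (v n x) \<partial>M) \<le> (\<integral>x. e / 2 + indicator ?A x \<partial>M)"
      proof (rule Bochner_Integration.integral_mono)
        show "norm (v n x) \<le> e / 2 + indicator ?A x" if "x \<in> space M" for x
          using e that by (cases "x \<in> ?A") (auto simp: v_def min_def)
      qed (use vi in \<open>auto simp: emeasure_eq_measure\<close>)
      also have "\<dots> = e / 2 + measure M ?A"
        using prob_space by (subst Bochner_Integration.integral_add) (auto simp: emeasure_eq_measure Int_absorb2)
      also have "\<dots> < e" using N[OF n] by simp
      finally show "norm ((\<integral>x. norm (v n x) \<partial>M) - 0) < e" by simp
    qed
  qed
  from tendsto_L1_AE_subseq[OF vi this]
  obtain r where r: "strict_mono (r :: nat \<Rightarrow> nat)" "AE x in M. (\<lambda>n. v (r n) x) \<longlonglongrightarrow> 0" by blast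
  have "AE x in M. (\<lambda>n. u (r n) x) \<longlonglongrightarrow> X x" using r(2)
  proof eventually_elim
    case (elim x)
    have "(\<lambda>n. \<bar>u (r n) x - X x\<bar>) \<longlonglongrightarrow> 0"
    proof (rule Lim_transform_eventually[OF elim])
      have "\<forall>\<^sub>F n in sequentially. v (r n) x < 1" using elim by (rule order_tendstoD) simp
      then show "\<forall>\<^sub>F n in sequentially. v (r n) x = \<bar>u (r n) x - X x\<bar>"
        by eventually_elim (auto simp: v_def)
    qed
    then show ?case by (simp add: tendsto_rabs_zero_iff LIM_zero_iff)
  qed
  with r(1) show ?thesis by blast
qed

text \<open>The tail bound forces the limit density to have mass 1, and Scheffe's lemma then gives convergence in
  mean.\<close>

lemma limit_of_densities:
  fixes D :: "nat \<Rightarrow> 'a \<Rightarrow> real" and f g :: "nat \<Rightarrow> 'a \<Rightarrow> real"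
  assumes "prob_space M"
    and m [measurable]: "\<And>n. D n \<in> borel_measurable M" "D' \<in> borel_measurable M"
      "\<And>n. f n \<in> borel_measurable M" "f' \<in> borel_measurable M"
      "\<And>n. g n \<in> borel_measurable M" "g' \<in> borel_measurable M"
    and D0: "\<And>n x. 0 \<le> D n x" "\<And>x. 0 \<le> D' x"
    and DD: "AE x in M. (\<lambda>n. D n x) \<longlonglongrightarrow> D' x"
    and D1: "\<And>n. (\<integral>\<^sup>+x. ennreal (D n x) \<partial>M) = 1"
    and tail: "\<And>n L. L \<ge> 1 \<Longrightarrow> (\<integral>\<^sup>+x. ennreal (D n x) * indicator {x. D n x > exp (2 * L)} x \<partial>M) \<le> ennreal (K / L)"
    and K: "K \<ge> 0"
    and fb: "\<And>n x. x \<in> space M \<Longrightarrow> \<bar>f n x\<bar> \<le> B" "\<And>x. x \<in> space M \<Longrightarrow> \<bar>f' x\<bar> \<le> B"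
    and gb: "\<And>n x. x \<in> space M \<Longrightarrow> \<bar>g n x\<bar> \<le> B" "\<And>x. x \<in> space M \<Longrightarrow> \<bar>g' x\<bar> \<le> B"
    and ff: "\<And>x. x \<in> space M \<Longrightarrow> (\<lambda>n. f n x) \<longlonglongrightarrow> f' x"
    and gg: "\<And>x. x \<in> space M \<Longrightarrow> (\<lambda>n. g n x) \<longlonglongrightarrow> g' x"
    and eq: "\<And>n. (\<integral>\<^sup>+x. ennreal (D n x) * ennreal (f n x + B) \<partial>M) = (\<integral>\<^sup>+x. ennreal (g n x + B) \<partial>M)"
  shows "integrable M (\<lambda>x. D' x * f' x) \<and> (\<integral>x. D' x * f' x \<partial>M) = (\<integral>x. g' x \<partial>M)"
proof -
  interpret prob_space M by fact
  obtain x0 where "x0 \<in> space M" using not_empty by blast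
  then have B0: "B \<ge> 0" using fb(2) abs_ge_zero order_trans by blast
  have Di: "integrable M (D n)" for n
    by (rule integrableI_nonneg) (use D0 D1[of n] in auto)
  have D1r: "(\<integral>x. D n x \<partial>M) = 1" for n
    using D1[of n] D0 by (simp add: nn_integral_eq_integral[OF Di])
  \<comment> \<open>Fatou: the limit density has mass at most 1, hence is integrable.\<close>
  have "(\<integral>\<^sup>+x. ennreal (D' x) \<partial>M) = (\<integral>\<^sup>+x. liminf (\<lambda>n. ennreal (D n x)) \<partial>M)"
  proof (rule nn_integral_cong_AE)
    show "AE x in M. ennreal (D' x) = liminf (\<lambda>n. ennreal (D n x))" using DD
      by eventually_elim (auto intro!: lim_imp_Liminf[symmetric] tendsto_intros)
  qed
  also have "\<dots> \<le> liminf (\<lambda>n. \<integral>\<^sup>+x. ennreal (D n x) \<partial>M)" by (intro nn_integral_liminf) measurable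
  also have "\<dots> = 1" unfolding D1 by (simp add: Liminf_const)
  finally have le1: "(\<integral>\<^sup>+x. ennreal (D' x) \<partial>M) \<le> 1" .
  then have Di': "integrable M D'"
    by (intro integrableI_nonneg) (use D0 in \<open>auto simp: less_top[symmetric] top_unique\<close>)
  \<comment> \<open>Cutting the densities at \<open>?c\<close> loses at most \<open>K / L\<close>
    uniformly in \<open>n\<close>, and the cut densities converge by domination. Letting
    \<open>L\<close> grow gives mass at least 1.\<close>
  have lower: "1 - K / L \<le> (\<integral>x. D' x \<partial>M)" if L: "L \<ge> 1" for L
  proof -
    let ?c = "exp (2 * L)"
    have mi: "integrable M (\<lambda>x. min (F x) ?c)" if "F \<in> borel_measurable M" "\<And>x. 0 \<le> F x" for F :: "'a \<Rightarrow> real"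
      by (rule integrable_const_bound[of _ ?c]) (use that in auto)
    have "1 - K / L \<le> (\<integral>x. min (D n x) ?c \<partial>M)" for n
    proof -
      have "1 = (\<integral>\<^sup>+x. ennreal (D n x) \<partial>M)" by (simp add: D1)
      also have "\<dots> \<le> (\<integral>\<^sup>+x. ennreal (min (D n x) ?c) + ennreal (D n x) * indicator {x. D n x > ?c} x \<partial>M)"
        by (intro nn_integral_mono) (auto simp: indicator_def)
      also have "\<dots> = (\<integral>\<^sup>+x. ennreal (min (D n x) ?c) \<partial>M) + (\<integral>\<^sup>+x. ennreal (D n x) * indicator {x. D n x > ?c} x \<partial>M)"
        by (intro nn_integral_add) measurable
      also have "\<dots> \<le> ennreal (\<integral>x. min (D n x) ?c \<partial>M) + ennreal (K / L)"
        using D0 by (intro add_mono tail[OF L]) (subst nn_integral_eq_integral[OF mi], auto)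
      also have "\<dots> = ennreal ((\<integral>x. min (D n x) ?c \<partial>M) + K / L)"
        using D0 K L by (intro ennreal_plus[symmetric] integral_nonneg_AE) auto
      finally have "1 \<le> (\<integral>x. min (D n x) ?c \<partial>M) + K / L" by (simp only: ennreal_1[symmetric] ennreal_le_iff2) auto
      then show ?thesis by simp
    qed
    moreover have "(\<lambda>n. \<integral>x. min (D n x) ?c \<partial>M) \<longlonglongrightarrow> (\<integral>x. min (D' x) ?c \<partial>M)"
    proof (rule integral_dominated_convergence[where w="\<lambda>_. ?c"])
      show "AE x in M. (\<lambda>n. min (D n x) ?c) \<longlonglongrightarrow> min (D' x) ?c" using DD
        by eventually_elim (intro tendsto_intros)
      show "AE x in M. norm (min (D n x) ?c) \<le> ?c" for n using D0 by auto
    qed simp_all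
    ultimately have "1 - K / L \<le> (\<integral>x. min (D' x) ?c \<partial>M)" by (intro LIMSEQ_le_const) auto
    also have "\<dots> \<le> (\<integral>x. D' x \<partial>M)" using D0 by (intro Bochner_Integration.integral_mono mi Di') auto
    finally show ?thesis .
  qed
  have "(\<lambda>n. 1 - K / real n) \<longlonglongrightarrow> 1 - 0" by (intro tendsto_diff tendsto_const lim_const_over_n)
  then have ge1: "1 - 0 \<le> (\<integral>x. D' x \<partial>M)" by (rule LIMSEQ_le_const2) (auto intro!: exI[of _ 1] lower)
  have scheffe: "(\<lambda>n. \<integral>\<^sup>+x. norm (D n x - D' x) \<partial>M) \<longlonglongrightarrow> 0"
  proof (rule Scheffe_lemma2[OF m(1) Di' DD])
    fix n
    have "1 \<le> ennreal (\<integral>x. D' x \<partial>M)" using ge1 by (simp add: ennreal_ge_1)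
    then show "(\<integral>\<^sup>+x. norm (D n x) \<partial>M) \<le> (\<integral>\<^sup>+x. norm (D' x) \<partial>M)"
      using D0 D1[of n] by (simp add: nn_integral_eq_integral[OF Di'])
  qed
  have fi: "integrable M (\<lambda>x. F x * p x)" if "integrable M F" "p \<in> borel_measurable M" "\<And>x. x \<in> space M \<Longrightarrow> \<bar>p x\<bar> \<le> B" for F p :: "'a \<Rightarrow> real"
  proof (rule Bochner_Integration.integrable_bound[of M "\<lambda>x. B * F x"])
    show "AE x in M. norm (F x * p x) \<le> norm (B * F x)"
      using that(3) B0 by (intro AE_I2) (simp add: abs_mult mult.commute[of B] mult_left_mono)
  qed (use that in simp_all)
  have Dfi: "integrable M (\<lambda>x. D' x * f' x)" by (intro fi Di' m fb)
  have gi: "integrable M (g n)" for n by (rule integrable_const_bound[of _ B]) (use gb in auto)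
  \<comment> \<open>\<open>B\<close> had been added to make the integrands nonnegative; it cancels
    because \<open>D n\<close> has mass 1 and \<open>M\<close> is a probability measure.\<close>
  have eqr: "(\<integral>x. D n x * f n x \<partial>M) = (\<integral>x. g n x \<partial>M)" for n
  proof -
    have a: "(\<integral>\<^sup>+x. ennreal (D n x) * ennreal (f n x + B) \<partial>M) = ennreal (\<integral>x. D n x * (f n x + B) \<partial>M)"
    proof -
      have "integrable M (\<lambda>x. D n x * (f n x + B))"
        using fi[OF Di[of n] m(3) fb(1)] Di[of n] by (simp add: distrib_left)
      moreover have p: "0 \<le> f n x + B" if "x \<in> space M" for x using fb(1)[OF that, of n] by (simp add: abs_le_iff)
      ultimately have "(\<integral>\<^sup>+x. ennreal (D n x * (f n x + B)) \<partial>M) = ennreal (\<integral>x. D n x * (f n x + B) \<partial>M)"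
        using D0 by (intro nn_integral_eq_integral AE_I2 mult_nonneg_nonneg) auto
      then show ?thesis using p D0 by (simp add: ennreal_mult cong: nn_integral_cong)
    qed
    have p: "0 \<le> g n x + B" if "x \<in> space M" for x using gb(1)[OF that, of n] by (simp add: abs_le_iff)
    have b: "(\<integral>\<^sup>+x. ennreal (g n x + B) \<partial>M) = ennreal (\<integral>x. g n x + B \<partial>M)"
      using gi[of n] p by (intro nn_integral_eq_integral) auto
    have pf: "0 \<le> f n x + B" if "x \<in> space M" for x using fb(1)[OF that, of n] by (simp add: abs_le_iff)
    have "(\<integral>x. D n x * (f n x + B) \<partial>M) = (\<integral>x. g n x + B \<partial>M)"
      using eq[of n] unfolding a b
      by (subst (asm) ennreal_inj) (auto intro!: integral_nonneg_AE AE_I2 mult_nonneg_nonneg D0 p pf)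
    then show ?thesis
      using fi[OF Di[of n] m(3) fb(1), of n] Di[of n] gi[of n] D1r[of n] prob_space by (simp add: distrib_left)
  qed
  \<comment> \<open>Two errors are separated: replacing \<open>D n\<close> by \<open>D'\<close>
    against the bounded \<open>f n\<close> uses convergence in mean, and replacing
    \<open>f n\<close> by \<open>f'\<close> against the fixed \<open>D'\<close> uses
    domination.\<close>
  have "(\<lambda>n. \<integral>x. D n x * f n x \<partial>M) \<longlonglongrightarrow> (\<integral>x. D' x * f' x \<partial>M)"
  proof -
    have l1: "(\<lambda>n. \<integral>x. D' x * f n x \<partial>M) \<longlonglongrightarrow> (\<integral>x. D' x * f' x \<partial>M)"
    proof (rule integral_dominated_convergence[where w="\<lambda>x. B * D' x"])
      show "AE x in M. (\<lambda>n. D' x * f n x) \<longlonglongrightarrow> D' x * f' x" by (intro AE_I2 tendsto_intros ff)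
      show "AE x in M. norm (D' x * f n x) \<le> B * D' x" for n
        using fb(1) D0 B0 by (intro AE_I2) (simp add: abs_mult mult.commute[of B] mult_left_mono)
    qed (use Di' in simp_all)
    have Dd: "integrable M (\<lambda>x. \<bar>D n x - D' x\<bar>)" for n using Di[of n] Di' by simp
    have "(\<lambda>n. ennreal (\<integral>x. \<bar>D n x - D' x\<bar> \<partial>M)) \<longlonglongrightarrow> ennreal 0"
      using scheffe by (simp add: nn_integral_eq_integral[OF Dd])
    then have "(\<lambda>n. \<integral>x. \<bar>D n x - D' x\<bar> \<partial>M) \<longlonglongrightarrow> 0"
      by (subst (asm) tendsto_ennreal_iff) auto
    then have l2: "(\<lambda>n. B * (\<integral>x. \<bar>D n x - D' x\<bar> \<partial>M)) \<longlonglongrightarrow> 0" by (rule tendsto_mult_right_zero)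
    have "(\<lambda>n. (\<integral>x. D n x * f n x \<partial>M) - (\<integral>x. D' x * f n x \<partial>M)) \<longlonglongrightarrow> 0"
    proof (rule Lim_null_comparison[OF _ l2], rule always_eventually, rule allI)
      fix n
      have "(\<integral>x. D n x * f n x \<partial>M) - (\<integral>x. D' x * f n x \<partial>M) = (\<integral>x. (D n x - D' x) * f n x \<partial>M)"
        using fi[OF Di[of n] m(3) fb(1), of n] fi[OF Di' m(3) fb(1), of n] by (simp add: left_diff_distrib)
      also have "norm \<dots> \<le> (\<integral>x. norm ((D n x - D' x) * f n x) \<partial>M)" by (rule integral_norm_bound)
      also have "\<dots> \<le> (\<integral>x. B * \<bar>D n x - D' x\<bar> \<partial>M)"
      proof (rule integral_mono_AE)
        show "integrable M (\<lambda>x. norm ((D n x - D' x) * f n x))"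
          using Di[of n] Di' by (intro integrable_norm fi m fb) auto
        show "AE x in M. norm ((D n x - D' x) * f n x) \<le> B * \<bar>D n x - D' x\<bar>"
          using fb(1) by (intro AE_I2) (simp add: abs_mult mult.commute[of B] mult_left_mono)
      qed (use Dd in simp)
      finally show "norm ((\<integral>x. D n x * f n x \<partial>M) - (\<integral>x. D' x * f n x \<partial>M)) \<le> B * (\<integral>x. \<bar>D n x - D' x\<bar> \<partial>M)" by simp
    qed
    from tendsto_add[OF this l1] show ?thesis by simp
  qed
  moreover have "(\<lambda>n. \<integral>x. g n x \<partial>M) \<longlonglongrightarrow> (\<integral>x. g' x \<partial>M)"
    by (rule integral_dominated_convergence[where w="\<lambda>_. B"]) (use gg gb in auto)
  ultimately have "(\<integral>x. D' x * f' x \<partial>M) = (\<integral>x. g' x \<partial>M)"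
    unfolding eqr by (rule LIMSEQ_unique)
  with Dfi show ?thesis ..
qed

text \<open>A discrete Ito formula for <A_k W_k, W_k>: its increments telescope, and the boundary
  terms vanish because \<open>W 0 = 0\<close> and \<open>A n = 0\<close>. Pairing the decrement of
  \<open>A\<close> with the new value \<open>W (Suc k)\<close> keeps the identity exact.\<close>

lemma summation_by_parts_quadratic:
  fixes A :: "nat \<Rightarrow> real^'d^'d" and z :: "nat \<Rightarrow> real^'d"
  defines "W \<equiv> \<lambda>k. \<Sum>j<k. z j"
  assumes sym: "\<And>k x y. k \<le> n \<Longrightarrow> x \<bullet> (A k *v y) = (A k *v x) \<bullet> y" and last: "A n = 0"
  shows "(\<Sum>k<n. (A k *v W k) \<bullet> z k)
    = 1/2 * (\<Sum>k<n. W (Suc k) \<bullet> ((A k - A (Suc k)) *v W (Suc k))) - 1/2 * (\<Sum>k<n. z k \<bullet> (A k *v z k))"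
proof -
  have "(\<Sum>k<m. 2 * ((A k *v W k) \<bullet> z k) + z k \<bullet> (A k *v z k) - W (Suc k) \<bullet> ((A k - A (Suc k)) *v W (Suc k))) = W m \<bullet> (A m *v W m)"
    if "m \<le> n" for m
    using that
  proof (induction m)
    case (Suc m)
    have "W (Suc m) = W m + z m" by (simp add: W_def)
    moreover have "W m \<bullet> (A m *v z m) = (A m *v W m) \<bullet> z m" using Suc.prems by (intro sym) simp
    ultimately show ?case using Suc
      by (simp add: matrix_vector_mult_diff_rdistrib matrix_vector_right_distrib inner_add_left inner_add_right
          inner_diff_right inner_commute[of "z m" "A m *v W m"])
  qed (simp add: W_def)
  from this[of n] last show ?thesis
    by (simp add: sum.distrib sum_subtractf sum_distrib_left[symmetric])
qed

lemma girsanov_cong: "(\<And>k. k < n \<Longrightarrow> B k = B' k) \<Longrightarrow> girsanov h B n z = girsanov h B' n z"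
  unfolding girsanov_def by (intro arg_cong[where f=exp] sum.cong) auto

section \<open>The density for a linear drift\<close>

locale wiener_linear_drift =
  fixes T :: real and chi :: "real \<Rightarrow> real^'d^'d"
  assumes T: "T > 0" and chi: "continuous_on {0..T} chi"
begin

definition Gram :: "real \<Rightarrow> real^'d^'d" where
  "Gram u = transpose (chi u) ** chi u"

text \<open>The matrix A of the overview, equal to \<open>chi - \<sigma>\<close> on the interval.
  Its zero at \<open>T\<close> is what removes the boundary term in the summation by parts.\<close>

definition tail_Gram :: "real \<Rightarrow> real^'d^'d" where
  "tail_Gram t = integral {t..T} Gram"

lemma continuous_on_Gram: "continuous_on {0..T} Gram"
  unfolding Gram_def matrix_matrix_mult_def transpose_def
  by (intro continuous_intros chi)

lemma continuous_on_tail_Gram: "continuous_on {0..T} tail_Gram"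
  unfolding tail_Gram_def
  by (intro indefinite_integral_continuous_1' integrable_continuous_interval continuous_on_Gram)

lemma tail_Gram_end: "tail_Gram T = 0" by (simp add: tail_Gram_def)

lemma inner_Gram: "x \<bullet> (Gram u *v y) = (chi u *v x) \<bullet> (chi u *v y)"
  unfolding Gram_def matrix_vector_mul_assoc[symmetric]
  by (metis dot_lmul_matrix inner_commute vector_transpose_matrix transpose_transpose)

text \<open>The integral commutes with the bounded linear form that sends M to <x, M y>, so
  questions about \<open>tail_Gram\<close> become scalar ones.\<close>

lemma inner_integral_Gram:
  assumes "0 \<le> a" "b \<le> T"
  shows "x \<bullet> (integral {a..b} Gram *v y) = integral {a..b} (\<lambda>u. (chi u *v x) \<bullet> (chi u *v y))"
proof -
  have bl: "bounded_linear (\<lambda>M :: real^'d^'d. x \<bullet> (M *v y))"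
    by (intro bounded_linear_inner_right_comp bounded_bilinear.bounded_linear_left[OF bounded_bilinear_matrix_vector])
  have "Gram integrable_on {a..b}"
    using assms by (intro integrable_continuous_interval continuous_on_subset[OF continuous_on_Gram]) auto
  from integral_linear[OF this bl] show ?thesis by (simp add: o_def inner_Gram)
qed

lemma tail_Gram_symmetric: "t \<in> {0..T} \<Longrightarrow> x \<bullet> (tail_Gram t *v y) = (tail_Gram t *v x) \<bullet> y"
  unfolding tail_Gram_def inner_commute[of "integral {t..T} Gram *v x"]
  by (simp add: inner_integral_Gram inner_commute)

lemma tail_Gram_diff:
  assumes "0 \<le> a" "a \<le> b" "b \<le> T"
  shows "tail_Gram a - tail_Gram b = integral {a..b} Gram"
proof -
  have "Gram integrable_on {a..T}"
    using assms by (intro integrable_continuous_interval continuous_on_subset[OF continuous_on_Gram]) auto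
  from Henstock_Kurzweil_Integration.integral_combine[OF assms(2,3) this]
  show ?thesis by (simp add: tail_Gram_def algebra_simps)
qed

text \<open>Both parts approximate int |chi w|^2. The first integrates \<open>Gram\<close> exactly
  over each cell but takes the path at the right end, as summation by parts dictates; the second is
  the left-point sum of the Girsanov exponent.\<close>

definition pathwise_error :: "nat \<Rightarrow> (real \<Rightarrow> real^'d) \<Rightarrow> real" where
  "pathwise_error n w = (\<Sum>k<n. w (real (Suc k) * T / real n) \<bullet>
      ((tail_Gram (real k * T / real n) - tail_Gram (real (Suc k) * T / real n)) *v w (real (Suc k) * T / real n))
      - T / real n * (norm (chi (real k * T / real n) *v w (real k * T / real n)))\<^sup>2)"

text \<open>Within a cell \<open>chi\<close> is taken at a moving time and \<open>w\<close> at the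
  right end, so uniform continuity is applied to a function of two separate times on the
  square.\<close>

lemma pathwise_error_tendsto:
  assumes w: "w \<in> Wsp T"
  shows "(\<lambda>n. pathwise_error n w) \<longlonglongrightarrow> 0"
proof (rule LIMSEQ_I)
  fix e :: real assume e: "e > 0"
  define g where "g p = (norm (chi (fst p) *v w (snd p)))\<^sup>2" for p :: "real \<times> real"
  have "continuous_on ({0..T} \<times> {0..T}) g"
    unfolding g_def
    by (intro continuous_intros continuous_on_compose2[OF chi] continuous_on_compose2[OF Wsp_continuous_on[OF w, of UNIV]]) auto
  then have "uniformly_continuous_on ({0..T} \<times> {0..T}) g"
    by (intro compact_uniformly_continuous compact_Times) auto
  then obtain d where d: "d > 0" "\<And>p q. p \<in> {0..T} \<times> {0..T} \<Longrightarrow> q \<in> {0..T} \<times> {0..T} \<Longrightarrow> dist q p < d \<Longrightarrow> dist (g q) (g p) < e / (2 * T)"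
    unfolding uniformly_continuous_on_def using e T by (metis divide_pos_pos mult_pos_pos zero_less_numeral)
  have "(\<lambda>n. T / real n) \<longlonglongrightarrow> 0" by (rule lim_const_over_n)
  \<comment> \<open>Half of \<open>d\<close>, since each of the two times may move by a cell
    length.\<close>
  then have "\<forall>\<^sub>F n in sequentially. T / real n < d / 2" by (rule order_tendstoD) (use d in simp)
  with eventually_gt_at_top[of 0]
  have "\<forall>\<^sub>F n in sequentially. norm (pathwise_error n w - 0) < e"
  proof eventually_elim
    case (elim n)
    have term_bound: "\<bar>w (real (Suc k) * T / real n) \<bullet>
      ((tail_Gram (real k * T / real n) - tail_Gram (real (Suc k) * T / real n)) *v w (real (Suc k) * T / real n))
      - T / real n * (norm (chi (real k * T / real n) *v w (real k * T / real n)))\<^sup>2\<bar> \<le> e / (2 * T) * (T / real n)"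
      if k: "k < n" for k
    proof -
      let ?a = "real k * T / real n" and ?b = "real (Suc k) * T / real n"
      have ab: "?a \<in> {0..T}" "?b \<in> {0..T}" "?a \<le> ?b"
        by (rule node_in_interval[OF T], use k in simp)+ (rule mult_div_mono[OF T], simp)
      have ba: "?b - ?a = T / real n" by (simp add: diff_divide_distrib[symmetric] algebra_simps)
      have gc: "continuous_on {?a..?b} (\<lambda>u. g (u, ?b))"
        unfolding g_def using ab by (auto intro!: continuous_intros continuous_on_subset[OF chi])
      have "w ?b \<bullet> ((tail_Gram ?a - tail_Gram ?b) *v w ?b) = integral {?a..?b} (\<lambda>u. g (u, ?b))"
        using ab by (simp add: tail_Gram_diff inner_integral_Gram g_def power2_norm_eq_inner)
      moreover have "T / real n * (norm (chi ?a *v w ?a))\<^sup>2 = integral {?a..?b} (\<lambda>u. g (?a, ?a))"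
        using ab(3) ba by (simp add: g_def del: of_nat_Suc)
      moreover have "integral {?a..?b} (\<lambda>u. g (u, ?b)) - integral {?a..?b} (\<lambda>u. g (?a, ?a)) = integral {?a..?b} (\<lambda>u. g (u, ?b) - g (?a, ?a))"
        by (intro integral_diff[symmetric] integrable_continuous_interval gc continuous_intros)
      moreover have "norm (integral {?a..?b} (\<lambda>u. g (u, ?b) - g (?a, ?a))) \<le> e / (2 * T) * (?b - ?a)"
      proof (rule integral_bound[OF ab(3)])
        show "norm (g (u, ?b) - g (?a, ?a)) \<le> e / (2 * T)" if u: "u \<in> {?a..?b}" for u
        proof -
          have "dist (u, ?b) (?a, ?a) \<le> dist u ?a + dist ?b ?a"
            unfolding dist_prod_def by (simp add: sqrt_sum_squares_le_sum)
          also have "\<dots> < d"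
          proof -
            have "dist u ?a = u - ?a" "dist ?b ?a = ?b - ?a" using u ab(3) unfolding dist_real_def atLeastAtMost_iff by linarith+
            moreover have "u - ?a \<le> ?b - ?a" using u by (simp del: of_nat_Suc)
            ultimately show ?thesis using ba elim(2) by linarith
          qed
          finally have "dist (u, ?b) (?a, ?a) < d" .
          moreover have "(u, ?b) \<in> {0..T} \<times> {0..T}" "(?a, ?a) \<in> {0..T} \<times> {0..T}" using u ab by (auto simp del: of_nat_Suc)
          ultimately show ?thesis using d(2)[of "(?a, ?a)" "(u, ?b)"] by (simp add: dist_real_def)
        qed
      qed (intro continuous_intros gc)
      ultimately show ?thesis unfolding ba by simp
    qed
    have "norm (pathwise_error n w) \<le> (\<Sum>k<n. e / (2 * T) * (T / real n))"
      unfolding pathwise_error_def real_norm_def by (intro order_trans[OF sum_abs] sum_mono term_bound) simp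
    also have "\<dots> = e / 2" using elim(1) T by simp
    also have "\<dots> < e" using e by simp
    finally show ?case by simp
  qed
  then show "\<exists>N. \<forall>n\<ge>N. norm (pathwise_error n w - 0) < e" by (simp add: eventually_sequentially)
qed

definition qv_error :: "nat \<Rightarrow> (real \<Rightarrow> real^'d) \<Rightarrow> real" where
  "qv_error n w = (\<Sum>k<n. incs T n w k \<bullet> (tail_Gram (real k * T / real n) *v incs T n w k)
      - T / real n * trace (tail_Gram (real k * T / real n)))"

text \<open>Exact for each path from 0. \<open>riemann_p\<close> contains - sum <A w, dw>, which
  summation by parts turns into -1/2 times the first sum of \<open>pathwise_error\<close> plus 1/2
  times the quadratic form of the increments; the mean of that form is the trace sum.\<close>

lemma girsanov_incs_decomposition:
  assumes w: "w 0 = 0" and n: "n > 0" and \<sigma>: "\<And>t. t \<in> {0..T} \<Longrightarrow> \<sigma> t = chi t - tail_Gram t"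
  shows "girsanov (T / real n) (\<lambda>k. chi (real k * T / real n)) n (incs T n w)
    = exp (riemann_p T \<sigma> n w + 1/2 * pathwise_error n w - 1/2 * qv_error n w
        - 1/2 * (T / real n * (\<Sum>k<n. trace (tail_Gram (real k * T / real n)))))"
proof -
  let ?t = "\<lambda>k. real k * T / real n" and ?z = "incs T n w" and ?h = "T / real n"
  have W: "(\<Sum>j<k. ?z j) = w (?t k)" if "k \<le> n" for k using sum_incs[where w=w, OF w that] .
  have An: "tail_Gram (?t n) = 0" using n tail_Gram_end by simp
  have parts: "(\<Sum>k<n. (tail_Gram (?t k) *v (\<Sum>j<k. ?z j)) \<bullet> ?z k)
    = 1/2 * (\<Sum>k<n. (\<Sum>j<Suc k. ?z j) \<bullet> ((tail_Gram (?t k) - tail_Gram (?t (Suc k))) *v (\<Sum>j<Suc k. ?z j))) - 1/2 * (\<Sum>k<n. ?z k \<bullet> (tail_Gram (?t k) *v ?z k))"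
    by (rule summation_by_parts_quadratic[of n "\<lambda>k. tail_Gram (?t k)"])
       (use An in \<open>auto intro!: tail_Gram_symmetric node_in_interval[OF T] simp del: atLeastAtMost_iff of_nat_Suc\<close>)
  have r: "riemann_p T \<sigma> n w = (\<Sum>k<n. (chi (?t k) *v (\<Sum>j<k. ?z j)) \<bullet> ?z k) - (\<Sum>k<n. (tail_Gram (?t k) *v (\<Sum>j<k. ?z j)) \<bullet> ?z k)"
    unfolding riemann_p_incs[where w=w, OF w] sum_subtractf[symmetric]
    by (intro sum.cong refl) (simp add: \<sigma>[OF node_in_interval[OF T]] matrix_vector_mult_diff_rdistrib inner_diff_left)
  have p: "pathwise_error n w = (\<Sum>k<n. (\<Sum>j<Suc k. ?z j) \<bullet> ((tail_Gram (?t k) - tail_Gram (?t (Suc k))) *v (\<Sum>j<Suc k. ?z j)))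
     - ?h * (\<Sum>k<n. (norm (chi (?t k) *v (\<Sum>j<k. ?z j)))\<^sup>2)"
    unfolding pathwise_error_def sum_subtractf sum_distrib_left
    by (intro arg_cong2[where f="(-)"] sum.cong refl) (simp_all add: W del: of_nat_Suc sum.lessThan_Suc)
  have q: "qv_error n w = (\<Sum>k<n. ?z k \<bullet> (tail_Gram (?t k) *v ?z k)) - ?h * (\<Sum>k<n. trace (tail_Gram (?t k)))"
    unfolding qv_error_def sum_subtractf sum_distrib_left ..
  have g: "(\<Sum>k<n. (chi (?t k) *v (\<Sum>j<k. ?z j)) \<bullet> ?z k - ?h / 2 * (norm (chi (?t k) *v (\<Sum>j<k. ?z j)))\<^sup>2)
    = (\<Sum>k<n. (chi (?t k) *v (\<Sum>j<k. ?z j)) \<bullet> ?z k) - 1/2 * (?h * (\<Sum>k<n. (norm (chi (?t k) *v (\<Sum>j<k. ?z j)))\<^sup>2))"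
    unfolding sum_subtractf sum_distrib_left by (simp add: mult.commute)
  show ?thesis unfolding girsanov_def g r p q parts by (simp add: algebra_simps)
qed

text \<open>The Riemann sums converge in probability and the quadratic variation in L2, so two
  successive extractions \<open>r\<close> and \<open>r'\<close> give convergence almost everywhere.
  The pathwise error and the trace sums converge along the full sequence.\<close>

lemma girsanov_incs_subseq_AE:
  fixes \<mu> :: "(real \<Rightarrow> real^'d) measure"
  assumes W: "wiener T \<mu>" and \<sigma>: "\<And>t. t \<in> {0..T} \<Longrightarrow> \<sigma> t = chi t - tail_Gram t" and X: "is_ito_p T \<mu> \<sigma> X"
  shows "\<exists>r. (\<forall>n. r n > 0) \<and> strict_mono r \<and>
    (AE w in \<mu>. (\<lambda>n. girsanov (T / real (r n)) (\<lambda>k. chi (real k * T / real (r n))) (r n) (incs T (r n) w))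
      \<longlonglongrightarrow> exp (X w - 1/2 * integral {0..T} (\<lambda>t. trace (tail_Gram t))))"
proof -
  interpret prob_space \<mu> using W by (rule wiener_prob_space)
  have Xm: "X \<in> borel_measurable \<mu>" and Xc: "\<And>\<epsilon>. \<epsilon> > 0 \<Longrightarrow> (\<lambda>n. measure \<mu> {w\<in>space \<mu>. \<bar>riemann_p T \<sigma> n w - X w\<bar> > \<epsilon>}) \<longlonglongrightarrow> 0"
    using X by (auto simp: is_ito_p_def)
  \<comment> \<open>\<open>Suc\<close> keeps the number of grid steps positive.\<close>
  obtain r where r: "strict_mono (r :: nat \<Rightarrow> nat)" "AE w in \<mu>. (\<lambda>n. riemann_p T \<sigma> (Suc (r n)) w) \<longlonglongrightarrow> X w"
    using converges_in_probability_AE_subseq[OF prob_space_axioms riemann_p_measurable[OF W] Xm LIMSEQ_Suc[OF Xc]] by blast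
  define Q where "Q n w = (qv_error (Suc (r n)) w)\<^sup>2" for n w
  define C where "C = gauss_quad_const TYPE('d) * T\<^sup>2 * (supnM T tail_Gram)\<^sup>2"
  have C0: "C \<ge> 0" unfolding C_def gauss_quad_const_def by (intro mult_nonneg_nonneg integral_nonneg_AE) auto
  have Qb: "(\<integral>\<^sup>+w. ennreal (Q n w) \<partial>\<mu>) \<le> ennreal (C / real (Suc (r n)))" for n
  proof -
    let ?N = "Suc (r n)"
    \<comment> \<open>\<open>quadratic_variation_L2\<close> asks for its bound at every index, and
      nodes beyond \<open>?N\<close> leave the interval; for \<open>k < ?N\<close> the clamp changes
      nothing.\<close>
    define A where "A k = tail_Gram (clampT T (real k * T / real ?N))" for k
    have "qv_error ?N w = (\<Sum>k<?N. incs T ?N w k \<bullet> (A k *v incs T ?N w k) - T / real ?N * trace (A k))" for w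
      unfolding qv_error_def A_def by (intro sum.cong refl) (simp add: clampT_id[OF node_in_interval[OF T]] del: of_nat_Suc)
    then have "(\<integral>\<^sup>+w. ennreal (Q n w) \<partial>\<mu>) = (\<integral>\<^sup>+w. ennreal ((\<Sum>k<?N. incs T ?N w k \<bullet> (A k *v incs T ?N w k) - T / real ?N * trace (A k))\<^sup>2) \<partial>\<mu>)"
      unfolding Q_def by (simp only:)
    also have "\<dots> \<le> ennreal (gauss_quad_const TYPE('d) * T\<^sup>2 * (supnM T tail_Gram)\<^sup>2 / real ?N)"
      by (rule quadratic_variation_L2[OF W T])
         (auto simp: A_def simp del: of_nat_Suc intro!: norm_le_supnM[OF continuous_on_tail_Gram] clampT_mem less_imp_le[OF T])
    finally show ?thesis unfolding C_def .
  qed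
  have Qm: "Q n \<in> borel_measurable \<mu>" for n
  proof -
    have [measurable]: "(\<lambda>w. w t) \<in> borel_measurable \<mu>" for t by (rule wiener_coord_measurable[OF W])
    have [measurable]: "(\<lambda>w. incs T m w k) \<in> borel_measurable \<mu>" if "k < m" for k m
      using that unfolding incs_def by simp
    show ?thesis unfolding Q_def qv_error_def by (intro borel_measurable_power borel_measurable_sum borel_measurable_diff) auto
  qed
  have Qi: "integrable \<mu> (Q n)" for n
    by (rule integrableI_nonneg) (use Qm Qb[of n] in \<open>auto simp: Q_def le_less_trans[OF _ ennreal_less_top]\<close>)
  have "(\<lambda>n. \<integral>w. norm (Q n w) \<partial>\<mu>) \<longlonglongrightarrow> 0"
  proof (rule tendsto_sandwich[OF _ _ tendsto_const])
    have "(\<integral>w. norm (Q n w) \<partial>\<mu>) \<le> C / real (Suc (r n))" for n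
    proof -
      have "ennreal (\<integral>w. Q n w \<partial>\<mu>) \<le> ennreal (C / real (Suc (r n)))"
        using Qb[of n] by (subst nn_integral_eq_integral[OF Qi[of n], symmetric]) (simp_all add: Q_def)
      moreover have "norm (Q n w) = Q n w" for w by (simp add: Q_def)
      ultimately show ?thesis using C0 by (simp only: ennreal_le_iff divide_nonneg_nonneg of_nat_0_le_iff)
    qed
    then show "\<forall>\<^sub>F n in sequentially. (\<integral>w. norm (Q n w) \<partial>\<mu>) \<le> C / real (Suc (r n))" by simp
    have "(\<lambda>n. C / real n) \<longlonglongrightarrow> 0" by (rule lim_const_over_n)
    from LIMSEQ_subseq_LIMSEQ[OF LIMSEQ_Suc[OF this] r(1)]
    show "(\<lambda>n. C / real (Suc (r n))) \<longlonglongrightarrow> 0" by (simp add: o_def)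
  qed simp
  from tendsto_L1_AE_subseq[OF Qi this]
  obtain r' where r': "strict_mono (r' :: nat \<Rightarrow> nat)" "AE w in \<mu>. (\<lambda>n. Q (r' n) w) \<longlonglongrightarrow> 0" by blast
  define \<rho> where "\<rho> n = Suc (r (r' n))" for n
  have \<rho>: "\<rho> n > 0" "strict_mono \<rho>" for n
    using r(1) r'(1) by (auto simp: \<rho>_def strict_mono_def)
  have trc: "continuous_on {0..T} (\<lambda>t. trace (tail_Gram t))"
    unfolding trace_def by (intro continuous_intros continuous_on_tail_Gram)
  have "(\<lambda>n. T / real n * (\<Sum>k<n. trace (tail_Gram (real k * T / real n)))) \<longlonglongrightarrow> integral {0..T} (\<lambda>t. trace (tail_Gram t))"
  proof (rule tendstoI)
    fix e :: real assume e: "e > 0"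
    then have e2: "e / 2 > 0" by simp
    from riemann_sum_uniform[OF T trc e2] eventually_gt_at_top[of 0]
    show "\<forall>\<^sub>F n in sequentially. dist (T / real n * (\<Sum>k<n. trace (tail_Gram (real k * T / real n)))) (integral {0..T} (\<lambda>t. trace (tail_Gram t))) < e"
    proof eventually_elim
      case (elim n)
      then show ?case using spec[OF elim(1), of n] e by (simp add: dist_norm)
    qed
  qed
  from LIMSEQ_subseq_LIMSEQ[OF this \<rho>(2)]
  have tr: "(\<lambda>n. T / real (\<rho> n) * (\<Sum>k<\<rho> n. trace (tail_Gram (real k * T / real (\<rho> n))))) \<longlonglongrightarrow> integral {0..T} (\<lambda>t. trace (tail_Gram t))"
    by (simp add: o_def)
  have "AE w in \<mu>. (\<lambda>n. girsanov (T / real (\<rho> n)) (\<lambda>k. chi (real k * T / real (\<rho> n))) (\<rho> n) (incs T (\<rho> n) w))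
      \<longlonglongrightarrow> exp (X w - 1/2 * integral {0..T} (\<lambda>t. trace (tail_Gram t)))"
    using r(2) r'(2) AE_space
  proof eventually_elim
    case (elim w)
    have w: "w \<in> Wsp T" using elim(3) wiener_space_Wsp[OF W] by simp
    have a: "(\<lambda>n. riemann_p T \<sigma> (\<rho> n) w) \<longlonglongrightarrow> X w"
      using LIMSEQ_subseq_LIMSEQ[OF elim(1) r'(1)] by (simp add: o_def \<rho>_def)
    have b: "(\<lambda>n. pathwise_error (\<rho> n) w) \<longlonglongrightarrow> 0"
      using LIMSEQ_subseq_LIMSEQ[OF pathwise_error_tendsto[OF w] \<rho>(2)] by (simp add: o_def)
    have "(\<lambda>n. \<bar>qv_error (\<rho> n) w\<bar>) \<longlonglongrightarrow> sqrt 0"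
      using tendsto_real_sqrt[OF elim(2)] by (simp add: Q_def \<rho>_def)
    then have c: "(\<lambda>n. qv_error (\<rho> n) w) \<longlonglongrightarrow> 0" by (simp add: tendsto_rabs_zero_iff)
    have "(\<lambda>n. exp (riemann_p T \<sigma> (\<rho> n) w + 1/2 * pathwise_error (\<rho> n) w - 1/2 * qv_error (\<rho> n) w
        - 1/2 * (T / real (\<rho> n) * (\<Sum>k<\<rho> n. trace (tail_Gram (real k * T / real (\<rho> n)))))))
      \<longlonglongrightarrow> exp (X w + 1/2 * 0 - 1/2 * 0 - 1/2 * integral {0..T} (\<lambda>t. trace (tail_Gram t)))"
      by (intro tendsto_intros a b c tr)
    then show ?case
      using girsanov_incs_decomposition[where w=w, OF WspD(2)[OF w] \<rho>(1) \<sigma>] by simp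
  qed
  then show ?thesis using \<rho> by blast
qed

text \<open>\<open>D\<close>, \<open>F\<close> and \<open>E\<close> are the discrete density, the
  functional on the interpolated path and the functional on the Euler path. Their identity passes to
  the limit by \<open>limit_of_densities\<close>, and the deterministic trace factor is moved across
  at the end.\<close>

lemma girsanov_linear_drift:
  fixes \<mu> :: "(real \<Rightarrow> real^'d) measure"
  assumes W: "wiener T \<mu>" and q: "T * supnM T chi < 1" and \<sigma>: "\<And>t. t \<in> {0..T} \<Longrightarrow> \<sigma> t = chi t - tail_Gram t"
    and X: "is_ito_p T \<mu> \<sigma> X" and f: "f \<in> Cb T"
    and G: "\<And>w. w \<in> Wsp T \<Longrightarrow> G w \<in> Wsp T" "\<And>w t. w \<in> Wsp T \<Longrightarrow> G w t + Fchi T chi (G w) t = w t"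
  shows "integrable \<mu> (\<lambda>w. exp (X w) * f w)"
    and "(\<integral>w. exp (X w) * f w \<partial>\<mu>) = exp (1/2 * integral {0..T} (\<lambda>t. trace (tail_Gram t))) * (\<integral>w. f (G w) \<partial>\<mu>)"
proof -
  let ?I = "integral {0..T} (\<lambda>t. trace (tail_Gram t))"
  interpret prob_space \<mu> using W by (rule wiener_prob_space)
  note sp = wiener_space_Wsp[OF W]
  have [measurable]: "X \<in> borel_measurable \<mu>" using X by (simp add: is_ito_p_def)
  obtain r where r: "\<And>n. r n > 0" "strict_mono r" and AE: "AE w in \<mu>. (\<lambda>n. girsanov (T / real (r n)) (\<lambda>k. chi (real k * T / real (r n))) (r n) (incs T (r n) w))
      \<longlonglongrightarrow> exp (X w - 1/2 * ?I)"
    using girsanov_incs_subseq_AE[OF W \<sigma> X] by blast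
  have rl: "filterlim r sequentially sequentially" using r(2) by (rule filterlim_subseq)
  obtain B where B: "\<And>w. w \<in> Wsp T \<Longrightarrow> \<bar>f w\<bar> \<le> B" using f unfolding Cb_def by blast
  define h where "h n = T / real (r n)" for n
  define b where "b n k = chi (real k * T / real (r n))" for n k
  define D where "D n w = girsanov (h n) (b n) (r n) (incs T (r n) w)" for n w
  define F where "F n w = f (interp T (r n) (incs T (r n) w))" for n w
  define E where "E n w = f (interp T (r n) (euler_shift (h n) (b n) (r n) (incs T (r n) w)))" for n w
  define c where "c = supnM T chi"
  define K where "K = 2 * T * c\<^sup>2 * (T * CARD('d) * exp (2 * T * c))"
  have h0: "h n \<ge> 0" "real (r n) * h n = T" for n using T r(1)[of n] by (auto simp: h_def)
  have Im [measurable]: "incs T (r n) \<in> measurable \<mu> (borel_seq (r n))" for n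
    by (rule wiener_incs_measurable[OF W])
  have fm: "(\<lambda>z. f (interp T (r n) z)) \<in> borel_measurable (borel_seq (r n))" for n
    by (rule Cb_interp_measurable[OF T f])
  have em: "(\<lambda>z. f (interp T (r n) (euler_shift (h n) (b n) (r n) z))) \<in> borel_measurable (borel_seq (r n))" for n
    by (rule measurable_compose[OF euler_shift_measurable fm])
  have Dm: "D n \<in> borel_measurable \<mu>" for n unfolding D_def by (rule measurable_compose[OF Im girsanov_measurable])
  have Fm: "F n \<in> borel_measurable \<mu>" for n unfolding F_def by (rule measurable_compose[OF Im fm])
  have Em: "E n \<in> borel_measurable \<mu>" for n unfolding E_def by (rule measurable_compose[OF Im em])
  have Fl: "(\<lambda>n. F n w) \<longlonglongrightarrow> f w" if "w \<in> space \<mu>" for w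
  proof -
    have w: "w \<in> Wsp T" using that sp by simp
    have "(\<lambda>n. f (interp T n (incs T n w))) \<longlonglongrightarrow> f w"
    proof (rule Cb_tendsto[OF f w interp_Wsp[OF T]])
      fix e :: real assume "e > 0"
      from interp_incs_uniform[OF T w this]
      show "\<forall>\<^sub>F n in sequentially. supn T (interp T n (incs T n w) - w) \<le> e"
        by eventually_elim (use T in \<open>auto intro!: supn_le\<close>)
    qed
    from filterlim_compose[OF this rl] show ?thesis by (simp add: F_def)
  qed
  have El: "(\<lambda>n. E n w) \<longlonglongrightarrow> f (G w)" if "w \<in> space \<mu>" for w
  proof -
    have w: "w \<in> Wsp T" using that sp by simp
    have "(\<lambda>n. f (interp T n (euler_shift (T / real n) (\<lambda>k. chi (real k * T / real n)) n (incs T n w)))) \<longlonglongrightarrow> f (G w)"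
      by (rule Cb_tendsto[OF f G(1)[OF w] interp_Wsp[OF T]], rule euler_uniform[OF T chi q w G(1)[OF w] G(2)[OF w]])
    from filterlim_compose[OF this rl] show ?thesis by (simp add: E_def h_def b_def[abs_def])
  qed
  \<comment> \<open>\<open>f\<close> and \<open>f \<circ> G\<close> become measurable as pointwise
    limits of functionals of finitely many increments.\<close>
  have fM: "f \<in> borel_measurable \<mu>" using Fl Fm by (rule borel_measurable_LIMSEQ_real)
  have gM: "(\<lambda>w. f (G w)) \<in> borel_measurable \<mu>" using El Em by (rule borel_measurable_LIMSEQ_real)
  \<comment> \<open>The discrete transformation transported from Gaussian sequences to
    \<open>\<mu>\<close>. The constant \<open>H = 1\<close> gives mass 1, and the shifted functional
    gives the identity to be passed to the limit.\<close>
  have change: "(\<integral>\<^sup>+w. ennreal (D n w) * H (incs T (r n) w) \<partial>\<mu>) = (\<integral>\<^sup>+w. H (euler_shift (h n) (b n) (r n) (incs T (r n) w)) \<partial>\<mu>)"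
    if H: "H \<in> borel_measurable (borel_seq (r n))" for n H
  proof -
    have m1: "(\<lambda>z. ennreal (girsanov (h n) (b n) (r n) z) * H z) \<in> borel_measurable (borel_seq (r n))"
      using H girsanov_measurable[of "h n" "b n" "r n"] by measurable
    show ?thesis unfolding D_def
      using wiener_nn_integral_incs[OF W T r(1) m1] girsanov_change_of_variables[OF h0(1) H]
        wiener_nn_integral_incs[OF W T r(1) measurable_compose[OF euler_shift_measurable H]]
      by (simp add: h_def)
  qed
  have c0: "c \<ge> 0" using order_trans[OF norm_ge_zero norm_le_supnM[OF chi, of 0]] T by (simp add: c_def)
  have tail: "(\<integral>\<^sup>+w. ennreal (D n w) * indicator {w. D n w > exp (2 * L)} w \<partial>\<mu>) \<le> ennreal (K / L)" if L: "L \<ge> 1" for n L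
  proof -
    \<comment> \<open>Clamped so that the drift bound holds at every index; the density uses indices
      below \<open>r n\<close>, where \<open>b n\<close> and \<open>b'\<close> agree.\<close>
    define b' where "b' k = chi (clampT T (real k * T / real (r n)))" for k
    have bb: "girsanov (h n) (b n) (r n) z = girsanov (h n) b' (r n) z" for z
      by (rule girsanov_cong) (simp add: b_def b'_def clampT_id[OF node_in_interval[OF T]])
    have b'c: "norm (b' k) \<le> c" for k
      unfolding b'_def c_def using T by (intro norm_le_supnM[OF chi] clampT_mem) simp
    have m1: "(\<lambda>z. ennreal (girsanov (h n) b' (r n) z) * indicator {z. girsanov (h n) b' (r n) z > exp (2 * L)} z) \<in> borel_measurable (borel_seq (r n))"
      using girsanov_measurable[of "h n" b' "r n"] by measurable
    have "(\<integral>\<^sup>+w. ennreal (D n w) * indicator {w. D n w > exp (2 * L)} w \<partial>\<mu>)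
      = (\<integral>\<^sup>+z. ennreal (girsanov (h n) b' (r n) z) * indicator {z. girsanov (h n) b' (r n) z > exp (2 * L)} z \<partial>gauss_seq (h n) (r n))"
      unfolding h_def wiener_nn_integral_incs[OF W T r(1) m1[unfolded h_def], symmetric]
      unfolding D_def bb unfolding h_def by (intro nn_integral_cong) (simp add: indicator_def)
    also have "\<dots> \<le> ennreal (K / L)"
      unfolding K_def by (rule girsanov_tail_bound[OF h0(1) b'c h0(2) L])
    finally show ?thesis .
  qed
  have lim: "integrable \<mu> (\<lambda>w. exp (X w - 1/2 * ?I) * f w) \<and> (\<integral>w. exp (X w - 1/2 * ?I) * f w \<partial>\<mu>) = (\<integral>w. f (G w) \<partial>\<mu>)"
  proof (rule limit_of_densities[OF prob_space_axioms Dm _ Fm fM Em gM _ _ _ _ tail])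
    show "AE w in \<mu>. (\<lambda>n. D n w) \<longlonglongrightarrow> exp (X w - 1/2 * ?I)" using AE unfolding D_def h_def b_def[abs_def] .
    show "(\<integral>\<^sup>+w. ennreal (D n w) \<partial>\<mu>) = 1" for n
      using change[of "\<lambda>_. 1" n] emeasure_space_1 by simp
    have m2: "(\<lambda>z. ennreal (f (interp T (r n) z) + B)) \<in> borel_measurable (borel_seq (r n))" for n
      using fm[of n] by simp
    show "(\<integral>\<^sup>+w. ennreal (D n w) * ennreal (F n w + B) \<partial>\<mu>) = (\<integral>\<^sup>+w. ennreal (E n w + B) \<partial>\<mu>)" for n
      using change[OF m2] by (simp add: F_def E_def)
    show "0 \<le> K" unfolding K_def using T by simp
  qed (use B G(1) sp Fl El in \<open>auto simp: D_def less_imp_le[OF girsanov_pos] F_def E_def interp_Wsp[OF T]\<close>)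
  have e: "exp (X w) * f w = exp (1/2 * ?I) * (exp (X w - 1/2 * ?I) * f w)" for w
    by (simp add: exp_diff)
  show "integrable \<mu> (\<lambda>w. exp (X w) * f w)" unfolding e by (intro integrable_mult_right conjunct1[OF lim])
  show "(\<integral>w. exp (X w) * f w \<partial>\<mu>) = exp (1/2 * ?I) * (\<integral>w. f (G w) \<partial>\<mu>)"
    unfolding e integral_mult_right_zero conjunct2[OF lim] ..
qed

end

theorem mainTheorem7:
  fixes T :: real and chi \<sigma> :: "real \<Rightarrow> real^'d^'d" and \<mu> :: "(real \<Rightarrow> real^'d) measure"
  assumes "T > 0"
    and "continuous_on {0..T} chi"
    and "T * supnM T chi < 1"
    and "\<forall>t\<in>{0..T}. \<sigma> t = chi t - integral {t..T} (\<lambda>u. transpose (chi u) ** chi u)"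
    and "wiener T \<mu>"
  shows "\<exists>G. (\<forall>w\<in>Wsp T. (\<lambda>t. w t + Fchi T chi w t) \<in> Wsp T)
          \<and> (\<forall>w\<in>Wsp T. G w \<in> Wsp T)
          \<and> (\<forall>w\<in>Wsp T. G (\<lambda>t. w t + Fchi T chi w t) = w)
          \<and> (\<forall>w\<in>Wsp T. (\<lambda>t. G w t + Fchi T chi (G w) t) = w)
          \<and> (\<forall>v\<in>Wsp T. \<forall>w\<in>Wsp T. \<forall>a b::real.
                G (\<lambda>t. a *\<^sub>R v t + b *\<^sub>R w t) = (\<lambda>t. a *\<^sub>R G v t + b *\<^sub>R G w t))
          \<and> (\<exists>C. \<forall>w\<in>Wsp T. supn T (G w) \<le> C * supn T w)
          \<and> (\<exists>X. is_ito_p T \<mu> \<sigma> X)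
          \<and> (\<forall>X. is_ito_p T \<mu> \<sigma> X \<longrightarrow> (\<forall>f\<in>Cb T.
                integrable \<mu> (\<lambda>w. exp (X w) * f w) \<and>
                (\<integral>w. exp (X w) * f w \<partial>\<mu>)
                  = exp ((1/2) * integral {0..T} (\<lambda>t. trace (chi t - \<sigma> t)))
                    * (\<integral>w. f (G w) \<partial>\<mu>)))"
proof -
  interpret wiener_linear_drift T chi by standard fact+
  have \<sigma>: "\<sigma> t = chi t - tail_Gram t" if "t \<in> {0..T}" for t
    using assms(4) that by (simp add: tail_Gram_def Gram_def[abs_def])
  have "continuous_on {0..T} \<sigma>"
    by (rule iffD2[OF continuous_on_cong[OF refl \<sigma>] continuous_on_diff[OF chi continuous_on_tail_Gram]])
  then have X: "\<exists>X. is_ito_p T \<mu> \<sigma> X" by (rule ito_integral_exists[OF assms(5) T])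
  have tr: "integral {0..T} (\<lambda>t. trace (chi t - \<sigma> t)) = integral {0..T} (\<lambda>t. trace (tail_Gram t))"
    by (rule integral_cong) (simp add: \<sigma>)
  obtain G where G: "\<forall>w\<in>Wsp T. (\<lambda>t. w t + Fchi T chi w t) \<in> Wsp T" "\<forall>w\<in>Wsp T. G w \<in> Wsp T"
    "\<forall>w\<in>Wsp T. G (\<lambda>t. w t + Fchi T chi w t) = w"
    "\<forall>w\<in>Wsp T. (\<lambda>t. G w t + Fchi T chi (G w) t) = w"
    "\<forall>v\<in>Wsp T. \<forall>w\<in>Wsp T. \<forall>a b::real. G (\<lambda>t. a *\<^sub>R v t + b *\<^sub>R w t) = (\<lambda>t. a *\<^sub>R G v t + b *\<^sub>R G w t)"
    "\<exists>C. \<forall>w\<in>Wsp T. supn T (G w) \<le> C * supn T w"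
    using Fchi_inverse_exists[OF assms(1-3)] by (elim exE conjE) (rule that; (assumption | (rule exI, assumption)))
  have G1: "G w \<in> Wsp T" and G2: "G w t + Fchi T chi (G w) t = w t" if "w \<in> Wsp T" for w t
    using G(2) fun_cong[OF bspec[OF G(4) that]] that by auto
  have I: "integrable \<mu> (\<lambda>w. exp (X w) * f w) \<and> (\<integral>w. exp (X w) * f w \<partial>\<mu>)
      = exp ((1/2) * integral {0..T} (\<lambda>t. trace (chi t - \<sigma> t))) * (\<integral>w. f (G w) \<partial>\<mu>)"
    if "is_ito_p T \<mu> \<sigma> X" "f \<in> Cb T" for X f
    using girsanov_linear_drift[OF assms(5,3) \<sigma> that G1 G2] unfolding tr by blast
  show ?thesis
    by (intro exI[of _ G] conjI G X) (use I in blast)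
qed

end
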